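(* Let $\pi\colon M\to N$ be a normal covering of connected manifolds with group $\Gamma$ of covering transformations, let $L_0$ be an elliptic diffusion operator on $N$, symmetric with respect to a smooth volume element on $N$, and let $L$ be its pull back to $M$. If $N$ is $L_0$-recurrent, then any bounded $L$-harmonic function on $M$ is invariant under the $FC$-hypercenter of $\Gamma$. In particular, if $\Gamma$ is $FC$-hypercentral, then any bounded $L$-harmonic function on $M$ is constant.
   Context: An elliptic diffusion operator $L$ on a connected smooth manifold $M$ is written in local coordinates as $Lf=\frac12\sum a^{ij}\partial_i\partial_jf+\sum b^k\partial_kf$ with smooth coefficients and $(a^{ij})$ symmetric and positive definite. It is symmetric with respect to a smooth volume element $m$ (a measure with positive smooth density) if $\int (Lf)g\,dm=\int f(Lg)\,dm$ for all smooth compactly supported $f,g$. $N$ is $L_0$-recurrent if the diffusion process on $N$ with generator $L_0$ is recurrent. A smooth function $h$ is $L$-harmonic if $Lh=0$. The covering is normal if $\Gamma$ acts transitively on its fibers. For a group $\Gamma$, the $FC$-center $FC(\Gamma)$ is the normal subgroup of all elements whose conjugacy class is finite. The upper $FC$-central series is defined by $\Gamma_0=\{e\}$, $\Gamma_{\beta+1}/\Gamma_\beta=FC(\Gamma/\Gamma_\beta)$, and $\Gamma_\alpha=\bigcup_{\beta<\alpha}\Gamma_\beta$ for limit ordinals $\alpha$. It stabilizes at a normal subgroup, the $FC$-hypercenter of $\Gamma$. $\Gamma$ is $FC$-hypercentral if it equals its $FC$-hypercenter. *)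

theory Defs
  imports "HOL-Probability.Probability" "HOL-Algebra.Coset"
begin

section \<open>Smooth manifolds\<close>

text \<open>
  A manifold is a whole Hausdorff, second countable type together with a smooth atlas. Charts take
  values in a fixed Euclidean space, which therefore carries the dimension.
\<close>

primrec Ck_on :: "nat \<Rightarrow> 'a::real_normed_vector set \<Rightarrow> ('a \<Rightarrow> 'b::real_normed_vector) \<Rightarrow> bool" where
  "Ck_on 0 S f \<longleftrightarrow> continuous_on S f"
| "Ck_on (Suc k) S f \<longleftrightarrow>
     (\<forall>x\<in>S. f differentiable (at x)) \<and> (\<forall>v. Ck_on k S (\<lambda>x. frechet_derivative f (at x) v))"

text \<open>Only used for open \<open>S\<close>.\<close>

definition smooth_on :: "'a::real_normed_vector set \<Rightarrow> ('a \<Rightarrow> 'b::real_normed_vector) \<Rightarrow> bool" where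
  "smooth_on S f \<longleftrightarrow> (\<forall>k. Ck_on k S f)"

type_synonym ('m, 'e) chart = "'m set \<times> ('m \<Rightarrow> 'e)"

definition is_chart :: "('m::topological_space, 'e::euclidean_space) chart \<Rightarrow> bool" where
  "is_chart = (\<lambda>(U, \<phi>). open U \<and> open (\<phi> ` U) \<and> (\<exists>\<psi>. homeomorphism U (\<phi> ` U) \<phi> \<psi>))"

definition smooth_atlas ::
    "('m::{t2_space,second_countable_topology}, 'e::euclidean_space) chart set \<Rightarrow> bool" where
  "smooth_atlas A \<longleftrightarrow>
     (\<forall>c\<in>A. is_chart c) \<and> (\<Union>(U, \<phi>)\<in>A. U) = UNIV \<and>
     (\<forall>(U, \<phi>)\<in>A. \<forall>(V, \<psi>)\<in>A. smooth_on (\<phi> ` (U \<inter> V)) (\<psi> \<circ> inv_into U \<phi>))"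

definition smooth_fun :: "('m::topological_space, 'e::euclidean_space) chart set \<Rightarrow> ('m \<Rightarrow> real) \<Rightarrow> bool" where
  "smooth_fun A f \<longleftrightarrow> (\<forall>(U, \<phi>)\<in>A. smooth_on (\<phi> ` U) (f \<circ> inv_into U \<phi>))"

definition test_fun :: "('m::topological_space, 'e::euclidean_space) chart set \<Rightarrow> ('m \<Rightarrow> real) \<Rightarrow> bool" where
  "test_fun A f \<longleftrightarrow> smooth_fun A f \<and> compact (closure {x. f x \<noteq> 0})"

definition smooth_map_on ::
    "('m::topological_space, 'e::euclidean_space) chart set \<Rightarrow>
     ('n::topological_space, 'd::euclidean_space) chart set \<Rightarrow> 'm set \<Rightarrow> ('m \<Rightarrow> 'n) \<Rightarrow> bool" where
  "smooth_map_on A B W f \<longleftrightarrow>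
     open W \<and> continuous_on W f \<and>
     (\<forall>(U, \<phi>)\<in>A. \<forall>(V, \<psi>)\<in>B. smooth_on (\<phi> ` (U \<inter> W \<inter> f -` V)) (\<psi> \<circ> f \<circ> inv_into U \<phi>))"

definition local_diffeo ::
    "('m::topological_space, 'e::euclidean_space) chart set \<Rightarrow>
     ('n::topological_space, 'd::euclidean_space) chart set \<Rightarrow> ('m \<Rightarrow> 'n) \<Rightarrow> bool" where
  "local_diffeo A B f \<longleftrightarrow>
     (\<forall>x. \<exists>W. x \<in> W \<and> inj_on f W \<and>
        smooth_map_on A B W f \<and> smooth_map_on B A (f ` W) (inv_into W f))"


section \<open>Elliptic diffusion operators\<close>

definition partial :: "'e::euclidean_space \<Rightarrow> ('e \<Rightarrow> real) \<Rightarrow> 'e \<Rightarrow> real" where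
  "partial i F y = frechet_derivative F (at y) i"

text \<open>Only the values of \<open>L\<close> on globally defined smooth functions are meaningful.\<close>

definition elliptic_diffusion_operator ::
    "('m::topological_space, 'e::euclidean_space) chart set \<Rightarrow> (('m \<Rightarrow> real) \<Rightarrow> 'm \<Rightarrow> real) \<Rightarrow> bool" where
  "elliptic_diffusion_operator A L \<longleftrightarrow>
     (\<forall>(U, \<phi>)\<in>A. \<exists>(a :: 'e \<Rightarrow> 'e \<Rightarrow> 'e \<Rightarrow> real) (b :: 'e \<Rightarrow> 'e \<Rightarrow> real).
        (\<forall>i\<in>Basis. \<forall>j\<in>Basis. smooth_on (\<phi> ` U) (a i j)) \<and>
        (\<forall>k\<in>Basis. smooth_on (\<phi> ` U) (b k)) \<and>
        (\<forall>y\<in>\<phi> ` U. \<forall>i\<in>Basis. \<forall>j\<in>Basis. a i j y = a j i y) \<and>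
        (\<forall>y\<in>\<phi> ` U. \<forall>\<xi>. \<xi> \<noteq> 0 \<longrightarrow> (\<Sum>i\<in>Basis. \<Sum>j\<in>Basis. a i j y * (\<xi> \<bullet> i) * (\<xi> \<bullet> j)) > 0) \<and>
        (\<forall>f. smooth_fun A f \<longrightarrow> (\<forall>x\<in>U.
           L f x = 1/2 * (\<Sum>i\<in>Basis. \<Sum>j\<in>Basis.
                             a i j (\<phi> x) * partial i (partial j (f \<circ> inv_into U \<phi>)) (\<phi> x))
                   + (\<Sum>k\<in>Basis. b k (\<phi> x) * partial k (f \<circ> inv_into U \<phi>) (\<phi> x)))))"

definition smooth_volume ::
    "('m::topological_space, 'e::euclidean_space) chart set \<Rightarrow> 'm measure \<Rightarrow> bool" where
  "smooth_volume A m \<longleftrightarrow>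
     sets m = sets borel \<and>
     (\<forall>(U, \<phi>)\<in>A. \<exists>\<rho> :: 'e \<Rightarrow> real. smooth_on (\<phi> ` U) \<rho> \<and> (\<forall>y\<in>\<phi> ` U. \<rho> y > 0) \<and>
        (\<forall>B\<in>sets borel. B \<subseteq> U \<longrightarrow> emeasure m B = (\<integral>\<^sup>+y\<in>\<phi> ` B. ennreal (\<rho> y) \<partial>lborel)))"

definition symmetric_operator ::
    "('m::topological_space, 'e::euclidean_space) chart set \<Rightarrow> (('m \<Rightarrow> real) \<Rightarrow> 'm \<Rightarrow> real) \<Rightarrow>
     'm measure \<Rightarrow> bool" where
  "symmetric_operator A L m \<longleftrightarrow>
     (\<forall>f g. test_fun A f \<longrightarrow> test_fun A g \<longrightarrow>
        (\<integral>x. L f x * g x \<partial>m) = (\<integral>x. f x * L g x \<partial>m))"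

definition harmonic ::
    "('m::topological_space, 'e::euclidean_space) chart set \<Rightarrow> (('m \<Rightarrow> real) \<Rightarrow> 'm \<Rightarrow> real) \<Rightarrow>
     ('m \<Rightarrow> real) \<Rightarrow> bool" where
  "harmonic A L h \<longleftrightarrow> smooth_fun A h \<and> (\<forall>x. L h x = 0)"

text \<open>
  The pull back of an operator \<open>L\<^sub>0\<close> under a local diffeomorphism \<open>\<pi>\<close>: near a point \<open>x\<close>, write
  \<open>f = g \<circ> \<pi>\<close> and put \<open>L f x = L\<^sub>0 g (\<pi> x)\<close>. Since \<open>L\<^sub>0\<close> acts on global functions, \<open>g\<close> has to be
  cut off away from \<open>\<pi> x\<close>. As \<open>L\<^sub>0\<close> is local, the value is the same for all such \<open>g\<close>, so that
  the description is definite for every smooth \<open>f\<close>.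
\<close>

definition pullback_operator ::
    "('n::topological_space, 'e::euclidean_space) chart set \<Rightarrow> ('m::topological_space \<Rightarrow> 'n) \<Rightarrow>
     (('n \<Rightarrow> real) \<Rightarrow> 'n \<Rightarrow> real) \<Rightarrow> ('m \<Rightarrow> real) \<Rightarrow> 'm \<Rightarrow> real" where
  "pullback_operator B \<pi> L\<^sub>0 f x =
     (THE r. \<exists>g. smooth_fun B g \<and> (\<forall>\<^sub>F y in nhds x. f y = g (\<pi> y)) \<and> r = L\<^sub>0 g (\<pi> x))"


section \<open>The diffusion process and recurrence\<close>

text \<open>
  Paths run in the one-point compactification, the added point \<open>None\<close> being an absorbing cemetery
  which is reached at the explosion time. (If the manifold is compact, \<open>None\<close> is isolated and
  cannot be reached.)
\<close>

definition paths :: "(real \<Rightarrow> 'n::topological_space option) set" where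
  "paths = {\<omega> \<in> extensional {0..}.
     continuous_map (top_of_set {0..}) (Alexandroff_compactification euclidean) \<omega> \<and>
     (\<forall>s\<ge>0. \<forall>t\<ge>s. \<omega> s = None \<longrightarrow> \<omega> t = None)}"

definition path_algebra :: "real set \<Rightarrow> (real \<Rightarrow> 'n::topological_space option) measure" where
  "path_algebra I = sigma paths
     {{\<omega> \<in> paths. \<omega> t \<in> V} | t V. t \<in> I \<and> openin (Alexandroff_compactification euclidean) V}"

definition martingale :: "'w measure \<Rightarrow> (real \<Rightarrow> 'w measure) \<Rightarrow> (real \<Rightarrow> 'w \<Rightarrow> real) \<Rightarrow> bool" where
  "martingale P F X \<longleftrightarrow>
     (\<forall>t\<ge>0. X t \<in> borel_measurable (F t) \<and> integrable P (X t)) \<and>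
     (\<forall>s\<ge>0. \<forall>t\<ge>s. AE \<omega> in P. real_cond_exp P (F s) (X t) \<omega> = X s \<omega>)"

definition ext0 :: "('n \<Rightarrow> real) \<Rightarrow> 'n option \<Rightarrow> real" where
  "ext0 f z = (case z of None \<Rightarrow> 0 | Some x \<Rightarrow> f x)"

text \<open>
  The diffusion with generator \<open>L\<close> is given by its laws \<open>P x\<close>, for starting points \<open>x\<close>, on path
  space: the solutions of the martingale problem for \<open>L\<close>. For elliptic \<open>L\<close> with smooth coefficients
  they exist and are unique, hence have the strong Markov property.
\<close>

definition diffusion_process ::
    "('n::topological_space, 'e::euclidean_space) chart set \<Rightarrow> (('n \<Rightarrow> real) \<Rightarrow> 'n \<Rightarrow> real) \<Rightarrow>
     ('n \<Rightarrow> (real \<Rightarrow> 'n option) measure) \<Rightarrow> bool" where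
  "diffusion_process A L P \<longleftrightarrow>
     (\<forall>x. prob_space (P x) \<and> sets (P x) = sets (path_algebra {0..}) \<and>
        (AE \<omega> in P x. \<omega> 0 = Some x) \<and>
        (\<forall>f. test_fun A f \<longrightarrow>
           martingale (P x) (\<lambda>t. path_algebra {0..t})
             (\<lambda>t \<omega>. ext0 f (\<omega> t) - ext0 f (\<omega> 0) - (LBINT r:{0..t}. ext0 (L f) (\<omega> r)))))"

definition recurrent_process :: "('n::topological_space \<Rightarrow> (real \<Rightarrow> 'n option) measure) \<Rightarrow> bool" where
  "recurrent_process P \<longleftrightarrow>
     (\<forall>x U. open U \<longrightarrow> U \<noteq> {} \<longrightarrow> (AE \<omega> in P x. \<forall>T\<ge>0. \<exists>t\<ge>T. \<omega> t \<in> Some ` U))"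

definition recurrent_for ::
    "('n::topological_space, 'e::euclidean_space) chart set \<Rightarrow> (('n \<Rightarrow> real) \<Rightarrow> 'n \<Rightarrow> real) \<Rightarrow> bool" where
  "recurrent_for A L \<longleftrightarrow> (\<exists>P. diffusion_process A L P \<and> recurrent_process P)"


section \<open>Coverings\<close>

definition deck_group :: "('m::topological_space \<Rightarrow> 'n) \<Rightarrow> ('m \<Rightarrow> 'm) monoid" where
  "deck_group \<pi> =
     \<lparr>carrier = {\<gamma>. (\<exists>\<gamma>'. homeomorphism UNIV UNIV \<gamma> \<gamma>') \<and> \<pi> \<circ> \<gamma> = \<pi>}, mult = (\<circ>), one = id\<rparr>"

definition smooth_covering ::
    "('m::topological_space, 'e::euclidean_space) chart set \<Rightarrow>
     ('n::topological_space, 'e) chart set \<Rightarrow> ('m \<Rightarrow> 'n) \<Rightarrow> bool" where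
  "smooth_covering A B \<pi> \<longleftrightarrow> covering_space UNIV \<pi> UNIV \<and> local_diffeo A B \<pi>"

definition normal_covering ::
    "('m::topological_space, 'e::euclidean_space) chart set \<Rightarrow>
     ('n::topological_space, 'e) chart set \<Rightarrow> ('m \<Rightarrow> 'n) \<Rightarrow> bool" where
  "normal_covering A B \<pi> \<longleftrightarrow>
     smooth_covering A B \<pi> \<and>
     (\<forall>x y. \<pi> x = \<pi> y \<longrightarrow> (\<exists>\<gamma>\<in>carrier (deck_group \<pi>). \<gamma> x = y))"


section \<open>The FC-hypercenter\<close>

definition FC_center :: "('g, 'b) monoid_scheme \<Rightarrow> 'g set" where
  "FC_center G =
     {g \<in> carrier G. finite {x \<otimes>\<^bsub>G\<^esub> g \<otimes>\<^bsub>G\<^esub> inv\<^bsub>G\<^esub> x | x. x \<in> carrier G}}"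

text \<open>The preimage in \<open>G\<close> of the FC-center of \<open>G Mod H\<close>, for normal \<open>H\<close>.\<close>

definition FC_succ :: "('g, 'b) monoid_scheme \<Rightarrow> 'g set \<Rightarrow> 'g set" where
  "FC_succ G H = {g \<in> carrier G. H #>\<^bsub>G\<^esub> g \<in> FC_center (G Mod H)}"

text \<open>
  The set of all terms of the upper FC-central series. There is no type of all ordinals in HOL, so
  the transfinite iteration is expressed, as for \<^const>\<open>ccpo_class.iterates\<close>, by closure under the
  three clauses of the recursion. The terms are well-ordered by inclusion, hence the union of a
  nonempty set of terms is its largest element or the term at a limit ordinal.
\<close>

inductive_set upper_FC_series :: "('g, 'b) monoid_scheme \<Rightarrow> 'g set set" for G where
  zero: "{\<one>\<^bsub>G\<^esub>} \<in> upper_FC_series G"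
| succ: "H \<in> upper_FC_series G \<Longrightarrow> FC_succ G H \<in> upper_FC_series G"
| limit: "\<H> \<noteq> {} \<Longrightarrow> \<forall>H\<in>\<H>. H \<in> upper_FC_series G \<Longrightarrow> \<Union>\<H> \<in> upper_FC_series G"

text \<open>The term at which the series stabilizes is the largest one.\<close>

definition FC_hypercenter :: "('g, 'b) monoid_scheme \<Rightarrow> 'g set" where
  "FC_hypercenter G = \<Union>(upper_FC_series G)"

definition FC_hypercentral :: "('g, 'b) monoid_scheme \<Rightarrow> bool" where
  "FC_hypercentral G \<longleftrightarrow> FC_hypercenter G = carrier G"

end

theory Submission
  imports Defs
begin

text \<open>
  Let \<open>h\<close> be bounded and harmonic on \<open>M\<close>, let \<open>H\<close> be a normal subgroup of \<open>\<Gamma>\<close> leaving all such functions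
  invariant, and let the class of \<open>\<gamma>\<close> be finite modulo \<open>H\<close>. Put \<open>u = h \<circ> \<gamma> - h\<close> and suppose
  \<open>S = sup u > 0\<close>. The supremum of a harmonic function over the fibres of \<open>\<pi>\<close> is subharmonic on
  the recurrent \<open>N\<close>, hence constant, so each orbit \<open>\<Gamma> z\<close> contains points \<open>a z\<close> with \<open>u (a z)\<close>
  arbitrarily close to \<open>S\<close>. By a weak Harnack inequality for \<open>S - u\<close>, which is uniform over the translates, \<open>u\<close> is
  then at least \<open>S/2\<close> at \<open>a y\<close> for all \<open>y\<close> in a prescribed finite set. Since \<open>\<gamma> a = a (a\<^sup>-\<^sup>1 \<gamma> a)\<close>, where
  \<open>a\<^sup>-\<^sup>1 \<gamma> a\<close> takes finitely many values modulo \<open>H\<close>, this covers the points \<open>\<gamma>\<^sup>j a z\<close> with \<open>j < k\<close>, and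
  \<open>h (\<gamma>\<^sup>k a z) - h (a z) \<ge> k S/2\<close> contradicts the boundedness of \<open>h\<close> for large \<open>k\<close>.

  The Harnack inequality needs equicontinuity of the solutions, obtained by doubling variables with
  a reflection coupling, and a barrier. The recurrence argument only uses the martingale problem at times on a
  grid: in one step of length \<open>\<delta>\<close>, the fibrewise supremum, being locally a supremum of test functions, decreases in
  mean by at most \<open>O(\<delta>\<^sup>2)\<close>.
\<close>

section \<open>Calculus of smooth functions\<close>

text \<open>The order of the choices shapes the argument. The finite set of comparison points has to
  be fixed before \<open>a\<close>: it consists of the iterates of one base point under chosen
  representatives of the finitely many cosets, one of which contains the conjugate of \<gamma> by
  \<open>a\<close>, whatever \<open>a\<close> is. This set determines the tolerance in the Harnack
  inequality, and only then does recurrence supply \<open>a\<close>. So one constant must serve all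
  translates of a harmonic function, which is why coefficients are read in charts of the base and
  lifted by sections. The fibrewise supremum is merely lower semicontinuous, and its competitors are
  not compactly supported. Each competitor, minus a penalty growing towards the edge of a chart, is
  composed with exp(-1/x), extended by 0. This cuts it off smoothly where it is negative; by
  convexity the drift is bounded below through the penalty alone, since the harmonic part has drift
  zero. Where this bound is negative a second cutoff has already dropped.\<close>

lemma Ck_on_cong:
  assumes "Ck_on k S g" "\<And>x. x \<in> S \<Longrightarrow> g x = h x" "open S"
  shows "Ck_on k S h"
  using assms
proof (induction k arbitrary: g h)
  case 0
  then show ?case by (metis Ck_on.simps(1) continuous_on_cong)
next
  case (Suc k)
  have d: "(h has_derivative frechet_derivative g (at x)) (at x)" if x: "x \<in> S" for x
  proof -
    have "(g has_derivative frechet_derivative g (at x)) (at x)"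
      using Suc.prems(1) x frechet_derivative_works by auto
    then show ?thesis
      using Suc.prems x by (metis has_derivative_transform_within_open)
  qed
  then have e: "frechet_derivative g (at x) = frechet_derivative h (at x)" if "x \<in> S" for x
    using frechet_derivative_at that by blast
  have "Ck_on k S (\<lambda>x. frechet_derivative h (at x) v)" for v
    by (rule Suc.IH[of "\<lambda>x. frechet_derivative g (at x) v"]) (use Suc.prems(1) e Suc.prems(3) in simp_all)
  then show ?case using d by (auto intro: differentiableI)
qed

lemma Ck_on_Suc_derivI:
  assumes "\<And>x. x \<in> S \<Longrightarrow> (f has_derivative f' x) (at x)"
    and "\<And>v. Ck_on k S (\<lambda>x. f' x v)" and "open S"
  shows "Ck_on (Suc k) S f"
  unfolding Ck_on.simps
proof safe
  show "f differentiable at x" if "x \<in> S" for x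
    using assms(1)[OF that] by (rule differentiableI)
  show "Ck_on k S (\<lambda>x. frechet_derivative f (at x) v)" for v
    by (rule Ck_on_cong[OF assms(2)[of v] _ assms(3)]) (metis assms(1) frechet_derivative_at)
qed

lemma Ck_on_Suc_has_derivative:
  "Ck_on (Suc k) S f \<Longrightarrow> x \<in> S \<Longrightarrow> (f has_derivative frechet_derivative f (at x)) (at x)"
  using frechet_derivative_works by auto

lemma Ck_on_imp_continuous_on: "Ck_on k S f \<Longrightarrow> continuous_on S f"
  by (cases k) (auto intro!: continuous_at_imp_continuous_on differentiable_imp_continuous_within)

lemma Ck_on_lower: "Ck_on (Suc k) S f \<Longrightarrow> Ck_on k S f"
proof (induction k arbitrary: f)
  case 0 then show ?case by (metis Ck_on.simps(1) Ck_on_imp_continuous_on)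
next
  case (Suc k) then show ?case by (metis Ck_on.simps(2))
qed

lemma Ck_on_subset: "Ck_on k S f \<Longrightarrow> T \<subseteq> S \<Longrightarrow> Ck_on k T f"
  by (induction k arbitrary: f) (auto intro: continuous_on_subset)

lemma Ck_on_local:
  assumes "\<And>x. x \<in> S \<Longrightarrow> \<exists>T. open T \<and> x \<in> T \<and> Ck_on k T f"
  shows "Ck_on k S f"
  using assms
proof (induction k arbitrary: f)
  case 0
  then show ?case
    by (metis Ck_on.simps(1) continuous_at_imp_continuous_on continuous_on_eq_continuous_at)
next
  case (Suc k) then show ?case by (fastforce simp: Ck_on.simps(2))
qed

lemma Ck_on_const: "open S \<Longrightarrow> Ck_on k S (\<lambda>_. c)"
proof (induction k arbitrary: c)
  case (Suc k)
  then show ?case by (intro Ck_on_Suc_derivI[where f' = "\<lambda>_ _. 0"]) auto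
qed auto

lemma Ck_on_add: "open S \<Longrightarrow> Ck_on k S f \<Longrightarrow> Ck_on k S g \<Longrightarrow> Ck_on k S (\<lambda>x. f x + g x)"
proof (induction k arbitrary: f g)
  case 0 then show ?case by (auto intro: continuous_intros)
next
  case (Suc k)
  then show ?case
    by (intro Ck_on_Suc_derivI[where f' = "\<lambda>x v. frechet_derivative f (at x) v + frechet_derivative g (at x) v"]
          has_derivative_add) (auto simp: frechet_derivative_works[symmetric])
qed

lemma Ck_on_bounded_linear_comp:
  assumes "bounded_linear L"
  shows "open S \<Longrightarrow> Ck_on k S f \<Longrightarrow> Ck_on k S (\<lambda>x. L (f x))"
proof (induction k arbitrary: f)
  case 0 then show ?case using assms
    by (auto intro: bounded_linear.continuous_on)
next
  case (Suc k)
  then show ?case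
    by (intro Ck_on_Suc_derivI[where f' = "\<lambda>x v. L (frechet_derivative f (at x) v)"]
          bounded_linear.has_derivative[OF assms]) (auto simp: frechet_derivative_works[symmetric])
qed

lemma Ck_on_bounded_linear:
  assumes "bounded_linear L" "open S"
  shows "Ck_on k S L"
proof (cases k)
  case 0 then show ?thesis using assms by (auto simp: linear_continuous_on)
next
  case (Suc j)
  show ?thesis unfolding Suc
    by (rule Ck_on_Suc_derivI[where f' = "\<lambda>x v. L v"])
      (use assms in \<open>auto intro: Ck_on_const bounded_linear_imp_has_derivative\<close>)
qed

lemma Ck_on_scaleR:
  fixes f :: "'a::real_normed_vector \<Rightarrow> real"
  shows "open S \<Longrightarrow> Ck_on k S f \<Longrightarrow> Ck_on k S g \<Longrightarrow> Ck_on k S (\<lambda>x. f x *\<^sub>R g x)"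
proof (induction k arbitrary: f g)
  case 0 then show ?case by (auto intro: continuous_intros)
next
  case (Suc k)
  show ?case
  proof (rule Ck_on_Suc_derivI[where f' = "\<lambda>x v. f x *\<^sub>R frechet_derivative g (at x) v + frechet_derivative f (at x) v *\<^sub>R g x"])
    show "((\<lambda>x. f x *\<^sub>R g x) has_derivative (\<lambda>v. f x *\<^sub>R frechet_derivative g (at x) v + frechet_derivative f (at x) v *\<^sub>R g x)) (at x)"
      if "x \<in> S" for x
      using Suc.prems that by (intro has_derivative_scaleR) (auto simp: frechet_derivative_works[symmetric])
    show "Ck_on k S (\<lambda>x. f x *\<^sub>R frechet_derivative g (at x) v + frechet_derivative f (at x) v *\<^sub>R g x)" for v
    proof (rule Ck_on_add[OF Suc.prems(1) Suc.IH[OF Suc.prems(1)] Suc.IH[OF Suc.prems(1)]])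
      show "Ck_on k S f" "Ck_on k S g" by (rule Ck_on_lower, rule Suc.prems)+
      show "Ck_on k S (\<lambda>x. frechet_derivative f (at x) v)" "Ck_on k S (\<lambda>x. frechet_derivative g (at x) v)"
        using Suc.prems(2,3) by auto
    qed
  qed (rule Suc.prems(1))
qed

lemma Ck_on_sum:
  assumes "open S" "\<And>i. i \<in> I \<Longrightarrow> Ck_on k S (f i)"
  shows "Ck_on k S (\<lambda>x. \<Sum>i\<in>I. f i x)"
  using assms(2)
  by (induction I rule: infinite_finite_induct) (auto intro: Ck_on_add Ck_on_const assms)

text \<open>In the chain rule both the base point and the direction of the derivative of
  \<open>g\<close> depend on \<open>x\<close>. Expanding the direction in the basis separates them:
  each term is a scalar times a fixed partial derivative of \<open>g\<close> composed with
  \<open>f\<close>, and the induction hypothesis applies because \<open>g\<close> is kept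
  arbitrary.\<close>

lemma Ck_on_compose:
  fixes f :: "'a::real_normed_vector \<Rightarrow> 'b::euclidean_space"
  assumes "open S" "open T"
  shows "Ck_on k S f \<Longrightarrow> Ck_on k T g \<Longrightarrow> f ` S \<subseteq> T \<Longrightarrow> Ck_on k S (\<lambda>x. g (f x))"
proof (induction k arbitrary: g)
  case 0 then show ?case by (auto intro: continuous_on_compose2)
next
  case (Suc k)
  let ?f = "\<lambda>x. frechet_derivative f (at x)" and ?g = "\<lambda>x. frechet_derivative g (at x)"
  have lin: "?g y v = (\<Sum>b\<in>Basis. (v \<bullet> b) *\<^sub>R ?g y b)" if "y \<in> T" for y v
  proof -
    have "linear (?g y)" using Ck_on_Suc_has_derivative[OF Suc.prems(2) that]
      by (simp add: has_derivative_linear)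
    then have "?g y (\<Sum>b\<in>Basis. (v \<bullet> b) *\<^sub>R b) = (\<Sum>b\<in>Basis. (v \<bullet> b) *\<^sub>R ?g y b)"
      by (simp add: linear_sum linear_scale)
    then show ?thesis by (simp add: euclidean_representation)
  qed
  show ?case
  proof (rule Ck_on_Suc_derivI[where f' = "\<lambda>x v. \<Sum>b\<in>Basis. (?f x v \<bullet> b) *\<^sub>R ?g (f x) b"])
    fix x assume x: "x \<in> S"
    then have y: "f x \<in> T" using Suc.prems by auto
    have "((\<lambda>x. g (f x)) has_derivative (\<lambda>v. ?g (f x) (?f x v))) (at x)"
      using Ck_on_Suc_has_derivative[OF Suc.prems(1) x] Ck_on_Suc_has_derivative[OF Suc.prems(2) y]
        diff_chain_at[unfolded o_def] by blast
    moreover have "(\<lambda>v. ?g (f x) (?f x v)) = (\<lambda>v. \<Sum>b\<in>Basis. (?f x v \<bullet> b) *\<^sub>R ?g (f x) b)"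
      by (rule ext) (rule lin[OF y])
    ultimately show "((\<lambda>x. g (f x)) has_derivative (\<lambda>v. \<Sum>b\<in>Basis. (?f x v \<bullet> b) *\<^sub>R ?g (f x) b)) (at x)"
      by simp
  next
    fix v
    show "Ck_on k S (\<lambda>x. \<Sum>b\<in>Basis. (?f x v \<bullet> b) *\<^sub>R ?g (f x) b)"
    proof (intro Ck_on_sum Ck_on_scaleR assms)
      fix b :: 'b
      show "Ck_on k S (\<lambda>x. ?f x v \<bullet> b)"
        by (rule Ck_on_bounded_linear_comp[OF bounded_linear_inner_left assms(1)]) (use Suc.prems(1) in auto)
      have "Ck_on k T (\<lambda>y. ?g y b)" using Suc.prems(2) by simp
      then show "Ck_on k S (\<lambda>x. ?g (f x) b)"
        by (rule Suc.IH[OF Ck_on_lower[OF Suc.prems(1)] _ Suc.prems(3)])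
    qed
  qed (rule assms(1))
qed

section \<open>Closure properties of smooth functions\<close>

lemma smooth_on_cong: "smooth_on S g \<Longrightarrow> (\<And>x. x \<in> S \<Longrightarrow> g x = h x) \<Longrightarrow> open S \<Longrightarrow> smooth_on S h"
  by (metis smooth_on_def Ck_on_cong)

lemma smooth_on_subset: "smooth_on S f \<Longrightarrow> T \<subseteq> S \<Longrightarrow> smooth_on T f"
  by (metis smooth_on_def Ck_on_subset)

lemma smooth_on_local:
  "(\<And>x. x \<in> S \<Longrightarrow> \<exists>T. open T \<and> x \<in> T \<and> smooth_on T f) \<Longrightarrow> smooth_on S f"
  unfolding smooth_on_def by (meson Ck_on_local)

lemma smooth_on_const: "open S \<Longrightarrow> smooth_on S (\<lambda>_. c)"
  by (simp add: smooth_on_def Ck_on_const)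

lemma smooth_on_add: "open S \<Longrightarrow> smooth_on S f \<Longrightarrow> smooth_on S g \<Longrightarrow> smooth_on S (\<lambda>x. f x + g x)"
  by (simp add: smooth_on_def Ck_on_add)

lemma smooth_on_bounded_linear_comp:
  "bounded_linear L \<Longrightarrow> open S \<Longrightarrow> smooth_on S f \<Longrightarrow> smooth_on S (\<lambda>x. L (f x))"
  by (simp add: smooth_on_def Ck_on_bounded_linear_comp)

lemma smooth_on_bounded_linear: "bounded_linear L \<Longrightarrow> open S \<Longrightarrow> smooth_on S L"
  by (simp add: smooth_on_def Ck_on_bounded_linear)

lemma smooth_on_mult:
  fixes f g :: "'a::real_normed_vector \<Rightarrow> real"
  shows "open S \<Longrightarrow> smooth_on S f \<Longrightarrow> smooth_on S g \<Longrightarrow> smooth_on S (\<lambda>x. f x * g x)"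
  using Ck_on_scaleR[of S _ f g] by (simp add: smooth_on_def)

lemma smooth_on_cmult:
  fixes f :: "'a::real_normed_vector \<Rightarrow> real"
  shows "open S \<Longrightarrow> smooth_on S f \<Longrightarrow> smooth_on S (\<lambda>x. c * f x)"
  by (intro smooth_on_mult smooth_on_const)

lemma smooth_on_diff:
  fixes f g :: "'a::real_normed_vector \<Rightarrow> real"
  assumes "open S" "smooth_on S f" "smooth_on S g"
  shows "smooth_on S (\<lambda>x. f x - g x)"
  using smooth_on_add[OF assms(1,2) smooth_on_cmult[OF assms(1,3), of "-1"]] by simp

lemma smooth_on_sum:
  "open S \<Longrightarrow> (\<And>i. i \<in> I \<Longrightarrow> smooth_on S (f i)) \<Longrightarrow> smooth_on S (\<lambda>x. \<Sum>i\<in>I. f i x)"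
  by (simp add: smooth_on_def Ck_on_sum)

lemma smooth_on_compose:
  fixes f :: "'a::real_normed_vector \<Rightarrow> 'b::euclidean_space"
  shows "open S \<Longrightarrow> open T \<Longrightarrow> smooth_on S f \<Longrightarrow> smooth_on T g \<Longrightarrow> f ` S \<subseteq> T \<Longrightarrow>
    smooth_on S (\<lambda>x. g (f x))"
  by (simp add: smooth_on_def Ck_on_compose)

lemma smooth_on_imp_continuous_on: "smooth_on S f \<Longrightarrow> continuous_on S f"
  by (metis smooth_on_def Ck_on_imp_continuous_on)

lemma smooth_on_has_derivative:
  "smooth_on S f \<Longrightarrow> x \<in> S \<Longrightarrow> (f has_derivative frechet_derivative f (at x)) (at x)"
  by (metis smooth_on_def Ck_on_Suc_has_derivative)

lemma smooth_on_frechet_derivative: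
  "smooth_on S f \<Longrightarrow> smooth_on S (\<lambda>x. frechet_derivative f (at x) v)"
  by (metis smooth_on_def Ck_on.simps(2))

lemma smooth_on_partial: "smooth_on S f \<Longrightarrow> smooth_on S (partial i f)"
  unfolding partial_def[abs_def] by (rule smooth_on_frechet_derivative)

lemma smooth_on_norm2:
  fixes c :: "'a::euclidean_space"
  assumes "open S"
  shows "smooth_on S (\<lambda>x. (norm (x - c))\<^sup>2)"
proof -
  have "smooth_on S (\<lambda>x. x - c)"
    using smooth_on_add[OF assms smooth_on_bounded_linear[OF bounded_linear_ident assms] smooth_on_const[OF assms], of "-c"]
    by simp
  then have "smooth_on S (\<lambda>x. (x - c) \<bullet> i)" for i
    by (rule smooth_on_bounded_linear_comp[OF bounded_linear_inner_left assms])
  then have "smooth_on S (\<lambda>x. \<Sum>i\<in>Basis. ((x - c) \<bullet> i) * ((x - c) \<bullet> i))"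
    by (intro smooth_on_sum smooth_on_mult assms)
  moreover have "(\<Sum>i\<in>Basis. ((x - c) \<bullet> i) * ((x - c) \<bullet> i)) = (norm (x - c))\<^sup>2" for x
    unfolding power2_norm_eq_inner by (rule euclidean_inner[symmetric])
  ultimately show ?thesis by simp
qed

subsection \<open>A flat function\<close>

text \<open>The function exp(-1/x), extended by 0, is \<open>flat 0\<close>. The index
  \<open>k\<close> makes the family closed under differentiation, up to linear combinations.\<close>

definition flat :: "nat \<Rightarrow> real \<Rightarrow> real" where
  "flat k x = (if x \<le> 0 then 0 else exp (- 1 / x) / x ^ k)"

lemma flat_tendsto_0: "(flat k \<longlongrightarrow> 0) (at 0)"
proof -
  have "((\<lambda>x::real. (inverse x) ^ k / exp (inverse x)) \<longlongrightarrow> 0) (at_right 0)"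
    by (rule filterlim_compose[OF tendsto_power_div_exp_0 filterlim_inverse_at_top_right])
  then have "(flat k \<longlongrightarrow> 0) (at_right 0)"
  proof (rule Lim_transform_eventually)
    show "\<forall>\<^sub>F x in at_right 0. inverse x ^ k / exp (inverse x) = flat k x"
      unfolding eventually_at_filter flat_def
      by (auto simp: exp_minus field_simps)
  qed
  moreover have "(flat k \<longlongrightarrow> 0) (at_left 0)"
    by (rule tendsto_eventually) (auto simp: flat_def eventually_at_filter)
  ultimately show ?thesis by (simp add: filterlim_at_split)
qed

text \<open>Only the origin needs an argument: there the difference quotient of
  \<open>flat k\<close> is \<open>flat (k + 1)\<close>, which tends to 0 because the exponential
  beats every power.\<close>

lemma flat_deriv: "(flat k has_real_derivative (flat (k + 2) x - real k * flat (k + 1) x)) (at x)"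
proof -
  consider "x < 0" | "x = 0" | "x > 0" by linarith
  then show ?thesis
  proof cases
    case 1
    have "((\<lambda>_. 0) has_real_derivative 0) (at x)" by simp
    then have "(flat k has_real_derivative 0) (at x)"
      by (rule has_field_derivative_transform_within_open[where S="{..<0}"]) (use 1 in \<open>auto simp: flat_def\<close>)
    then show ?thesis using 1 by (simp add: flat_def)
  next
    case 2
    have "((\<lambda>h. (flat k (0 + h) - flat k 0) / h) \<longlongrightarrow> 0) (at 0)"
      by (rule Lim_transform_eventually[OF flat_tendsto_0[of "Suc k"]])
        (auto simp: flat_def eventually_at_filter)
    then show ?thesis using 2 by (simp add: DERIV_def flat_def)
  next
    case 3
    have eq: "exp (- 1 / x) * (1 / x\<^sup>2) / x ^ k - exp (- 1 / x) * (real k * x ^ (k - 1)) / (x ^ k * x ^ k)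
       = exp (- 1 / x) / x ^ (k + 2) - real k * (exp (- 1 / x) / x ^ (k+1))"
      using 3 by (cases k) (auto simp: field_simps power2_eq_square)
    have "((\<lambda>x. exp (- 1 / x) / x ^ k) has_real_derivative
        (exp (- 1 / x) * (1 / x\<^sup>2) / x ^ k - exp (- 1 / x) * (real k * x ^ (k - 1)) / (x ^ k * x ^ k))) (at x)"
      using 3 by (auto intro!: derivative_eq_intros simp: power2_eq_square diff_divide_distrib)
    then have "(flat k has_real_derivative exp (- 1 / x) / x ^ (k + 2) - real k * (exp (- 1 / x) / x ^ (k+1))) (at x)"
      unfolding eq
      by (rule has_field_derivative_transform_within_open[where S="{0<..}"]) (use 3 in \<open>auto simp: flat_def\<close>)
    then show ?thesis using 3 by (simp add: flat_def)
  qed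
qed

text \<open>Induction on the order of differentiability with \<open>k\<close> free, since a
  derivative raises the index.\<close>

lemma flat_smooth: "smooth_on UNIV (flat k)"
proof -
  have "Ck_on j UNIV (flat k)" for j
  proof (induction j arbitrary: k)
    case 0
    have "isCont (flat k) x" for x using flat_deriv by (rule DERIV_isCont)
    then show ?case by (simp add: continuous_at_imp_continuous_on)
  next
    case (Suc j)
    show ?case
    proof (rule Ck_on_Suc_derivI[where f' = "\<lambda>x v. (flat (k + 2) x + (- real k) * flat (k + 1) x) * v"])
      show "(flat k has_derivative (\<lambda>v. (flat (k + 2) x + (- real k) * flat (k + 1) x) * v)) (at x)" for x
        using flat_deriv[of k x] by (simp add: has_field_derivative_def)
      show "Ck_on j UNIV (\<lambda>x. (flat (k + 2) x + (- real k) * flat (k + 1) x) * v)" for v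
        using Ck_on_bounded_linear_comp[OF bounded_linear_mult_left[of v] open_UNIV
            Ck_on_add[OF open_UNIV Suc[of "k+2"] Ck_on_bounded_linear_comp[OF bounded_linear_mult_right[of "- real k"] open_UNIV Suc[of "k+1"]]]]
        by simp
    qed auto
  qed
  then show ?thesis by (simp add: smooth_on_def)
qed

lemma flat_nonneg: "flat k x \<ge> 0"
  by (simp add: flat_def)

lemma flat_mono: "x \<le> y \<Longrightarrow> flat 0 x \<le> flat 0 y"
  by (auto simp: flat_def frac_le)

lemma flat_pos: "x > 0 \<Longrightarrow> flat k x > 0"
  by (simp add: flat_def)

lemma flat_zero: "x \<le> 0 \<Longrightarrow> flat k x = 0"
  by (simp add: flat_def)

lemma flat_less: "0 < x \<Longrightarrow> y < x \<Longrightarrow> flat 0 y < flat 0 x"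
  by (auto simp: flat_def frac_less2)

lemma flat_le_1: "flat 0 x \<le> 1"
  by (simp add: flat_def)

text \<open>The expression is the second derivative of \<open>flat 0\<close>, obtained from
  \<open>flat_deriv\<close> twice; 1/2 is the inflection point of exp(-1/x), so
  \<open>flat 0\<close> is convex up to there.\<close>

lemma flat_second_deriv_nonneg:
  assumes "x \<le> 1/2" shows "flat 4 x - 2 * flat 3 x \<ge> 0"
proof (cases "x \<le> 0")
  case False
  then have "flat 4 x - 2 * flat 3 x = exp (- 1 / x) / x ^ 4 * (1 - 2 * x)"
    by (simp add: flat_def field_simps eval_nat_numeral)
  then show ?thesis using False assms by simp
qed (simp add: flat_def)

section \<open>Decomposition of the diffusion matrix\<close>

text \<open>Gaussian elimination by induction on the index set: the Schur complement of the pivot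
  \<open>a p p\<close> is factored by the induction hypothesis, and the row of \<open>p\<close>
  divided by the root of the pivot is added. Positive pivots keep all entries continuous.\<close>

lemma cholesky_continuous:
  fixes a :: "'i \<Rightarrow> 'i \<Rightarrow> 'x::topological_space \<Rightarrow> real"
  assumes "finite I"
    and "\<And>i j. i \<in> I \<Longrightarrow> j \<in> I \<Longrightarrow> continuous_on K (a i j)"
    and "\<And>x i j. x \<in> K \<Longrightarrow> i \<in> I \<Longrightarrow> j \<in> I \<Longrightarrow> a i j x = a j i x"
    and "\<And>x \<xi>. x \<in> K \<Longrightarrow> \<exists>i\<in>I. \<xi> i \<noteq> 0 \<Longrightarrow> (\<Sum>i\<in>I. \<Sum>j\<in>I. a i j x * \<xi> i * \<xi> j) > 0"
  shows "\<exists>c. (\<forall>k\<in>I. \<forall>i\<in>I. continuous_on K (c k i)) \<and>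
    (\<forall>x\<in>K. \<forall>i\<in>I. \<forall>j\<in>I. a i j x = (\<Sum>k\<in>I. c k i x * c k j x))"
  using assms
proof (induction I arbitrary: a rule: finite_induct)
  case (insert p I)
  have pos: "a p p x > 0" if "x \<in> K" for x
  proof -
    have "(\<Sum>i\<in>insert p I. \<Sum>j\<in>insert p I. a i j x * of_bool (i = p) * of_bool (j = p)) > 0"
      by (rule insert.prems(3)[OF that]) auto
    also have "(\<Sum>i\<in>insert p I. \<Sum>j\<in>insert p I. a i j x * of_bool (i = p) * of_bool (j = p)) =
        (\<Sum>i\<in>insert p I. if i = p then (\<Sum>j\<in>insert p I. if j = p then a i j x else 0) else 0)"
      by (intro sum.cong refl) (auto intro!: sum.cong)
    also have "\<dots> = a p p x"
      using insert.hyps by (subst sum.delta) (auto simp: sum.delta simp del: sum.insert)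
    finally show ?thesis .
  qed
  define b where "b i j x = a i j x - a p i x * a p j x / a p p x" for i j x
  have "\<exists>c. (\<forall>k\<in>I. \<forall>i\<in>I. continuous_on K (c k i)) \<and>
    (\<forall>x\<in>K. \<forall>i\<in>I. \<forall>j\<in>I. b i j x = (\<Sum>k\<in>I. c k i x * c k j x))"
  proof (rule insert.IH)
    show "continuous_on K (b i j)" if "i \<in> I" "j \<in> I" for i j
      unfolding b_def using pos that
      by (intro continuous_intros insert.prems(1)) force+
    show "b i j x = b j i x" if "x \<in> K" "i \<in> I" "j \<in> I" for i j x
      unfolding b_def using insert.prems(2)[of x i j] that by auto
    fix x and \<xi> :: "'i \<Rightarrow> real" assume x: "x \<in> K" and nz: "\<exists>i\<in>I. \<xi> i \<noteq> 0"
    define s where "s = (\<Sum>j\<in>I. a p j x * \<xi> j)"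
    \<comment> \<open>This \<open>p\<close>-coordinate minimises the quadratic form when the others
      are given, and the minimum is the form of the Schur complement, which therefore inherits
      positivity.\<close>
    define \<eta> where "\<eta> = \<xi>(p := - s / a p p x)"
    have \<eta>: "\<eta> p = - s / a p p x" "\<And>j. j \<in> I \<Longrightarrow> \<eta> j = \<xi> j"
      using insert.hyps by (auto simp: \<eta>_def)
    have "0 < (\<Sum>i\<in>insert p I. \<Sum>j\<in>insert p I. a i j x * \<eta> i * \<eta> j)"
      by (rule insert.prems(3)[OF x]) (use nz \<eta> in force)
    also have "\<dots> = a p p x * \<eta> p * \<eta> p + (\<Sum>j\<in>I. a p j x * \<eta> p * \<xi> j) +
        ((\<Sum>i\<in>I. a i p x * \<xi> i * \<eta> p) + (\<Sum>i\<in>I. \<Sum>j\<in>I. a i j x * \<xi> i * \<xi> j))"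
      using insert.hyps by (simp add: \<eta>(2) sum.distrib)
    also have "(\<Sum>i\<in>I. a i p x * \<xi> i * \<eta> p) = s * \<eta> p"
      unfolding s_def sum_distrib_right
      by (rule sum.cong) (use insert.prems(2)[OF x] in auto)
    also have "(\<Sum>j\<in>I. a p j x * \<eta> p * \<xi> j) = s * \<eta> p"
      unfolding s_def sum_distrib_right by (rule sum.cong) auto
    also have "(\<Sum>i\<in>I. \<Sum>j\<in>I. a i j x * \<xi> i * \<xi> j) = (\<Sum>i\<in>I. \<Sum>j\<in>I. b i j x * \<xi> i * \<xi> j) + s * s / a p p x"
    proof -
      have "s * s / a p p x = (\<Sum>i\<in>I. \<Sum>j\<in>I. a p i x * a p j x / a p p x * \<xi> i * \<xi> j)"
        unfolding s_def sum_product sum_divide_distrib by (intro sum.cong) auto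
      then show ?thesis by (simp add: b_def sum.distrib[symmetric] algebra_simps)
    qed
    also have "a p p x * \<eta> p * \<eta> p + s * \<eta> p + (s * \<eta> p + ((\<Sum>i\<in>I. \<Sum>j\<in>I. b i j x * \<xi> i * \<xi> j) + s * s / a p p x))
      = (\<Sum>i\<in>I. \<Sum>j\<in>I. b i j x * \<xi> i * \<xi> j)"
      using pos[OF x] by (simp add: \<eta>(1) field_simps)
    finally show "0 < (\<Sum>i\<in>I. \<Sum>j\<in>I. b i j x * \<xi> i * \<xi> j)" .
  qed
  then obtain c where c: "\<And>k i. k \<in> I \<Longrightarrow> i \<in> I \<Longrightarrow> continuous_on K (c k i)"
    "\<And>x i j. x \<in> K \<Longrightarrow> i \<in> I \<Longrightarrow> j \<in> I \<Longrightarrow> b i j x = (\<Sum>k\<in>I. c k i x * c k j x)"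
    by blast
  define d where "d k i x = (if k = p then a p i x / sqrt (a p p x) else if i = p then 0 else c k i x)" for k i x
  show ?case
  proof (intro exI[of _ d] conjI ballI)
    fix k i assume ki: "k \<in> insert p I" "i \<in> insert p I"
    show "continuous_on K (d k i)"
    proof (cases "k = p")
      case True
      have "continuous_on K (\<lambda>x. a p i x / sqrt (a p p x))"
        using pos ki by (intro continuous_intros insert.prems(1)) force+
      then show ?thesis using True by (simp add: d_def[abs_def])
    next
      case False
      then show ?thesis using ki c(1)[of k i] by (cases "i = p") (auto simp: d_def[abs_def])
    qed
  next
    fix x i j assume x: "x \<in> K" and i: "i \<in> insert p I" and j: "j \<in> insert p I"
    have pp: "d p i x * d p j x = a p i x * a p j x / a p p x"
      using pos[OF x] by (simp add: d_def)
    have "(\<Sum>k\<in>insert p I. d k i x * d k j x) = d p i x * d p j x + (\<Sum>k\<in>I. d k i x * d k j x)"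
      using insert.hyps by simp
    also have "(\<Sum>k\<in>I. d k i x * d k j x) = (if i = p \<or> j = p then 0 else b i j x)"
    proof (cases "i = p \<or> j = p")
      case True then show ?thesis using insert.hyps by (auto simp: d_def intro!: sum.neutral)
    next
      case False
      then have "(\<Sum>k\<in>I. d k i x * d k j x) = (\<Sum>k\<in>I. c k i x * c k j x)"
        using insert.hyps by (intro sum.cong) (auto simp: d_def)
      then show ?thesis using False i j c(2)[OF x] by auto
    qed
    finally have "(\<Sum>k\<in>insert p I. d k i x * d k j x) =
        a p i x * a p j x / a p p x + (if i = p \<or> j = p then 0 else b i j x)"
      unfolding pp .
    moreover have "a p i x = a i p x"
      using insert.prems(2)[OF x _ i, of p] by simp
    ultimately show "a i j x = (\<Sum>k\<in>insert p I. d k i x * d k j x)"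
      using pos[OF x] by (cases "i = p"; cases "j = p") (simp_all add: b_def)
  qed
qed auto

lemma elliptic_lower_bound:
  fixes a :: "'e::euclidean_space \<Rightarrow> 'e \<Rightarrow> 'x::topological_space \<Rightarrow> real"
  assumes "compact K"
    and cont: "\<And>i j. i \<in> Basis \<Longrightarrow> j \<in> Basis \<Longrightarrow> continuous_on K (a i j)"
    and pos: "\<And>x \<xi>. x \<in> K \<Longrightarrow> \<xi> \<noteq> 0 \<Longrightarrow> (\<Sum>i\<in>Basis. \<Sum>j\<in>Basis. a i j x * (\<xi> \<bullet> i) * (\<xi> \<bullet> j)) > 0"
  shows "\<exists>\<kappa>>0. \<forall>x\<in>K. \<forall>\<xi>. (\<Sum>i\<in>Basis. \<Sum>j\<in>Basis. a i j x * (\<xi> \<bullet> i) * (\<xi> \<bullet> j)) \<ge> \<kappa> * (norm \<xi>)\<^sup>2"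
proof (cases "K = {}")
  case False
  let ?q = "\<lambda>z. \<Sum>i\<in>Basis. \<Sum>j\<in>Basis. a i j (fst z) * (snd z \<bullet> i) * (snd z \<bullet> j)"
  have "continuous_on (K \<times> sphere 0 1) (\<lambda>z. a i j (fst z))" if "i \<in> Basis" "j \<in> Basis" for i j
    by (rule continuous_on_compose2[OF cont[OF that]]) (auto intro: continuous_intros)
  then have q: "continuous_on (K \<times> sphere 0 1) ?q" by (intro continuous_intros)
  obtain e :: 'e where "e \<in> Basis" using nonempty_Basis by blast
  then have "K \<times> sphere (0::'e) 1 \<noteq> {}" using False by auto
  with compact_Times[OF assms(1) compact_sphere]
  have "\<exists>z\<in>K \<times> sphere 0 1. \<forall>w\<in>K \<times> sphere 0 1. ?q z \<le> ?q w"
    using q by (rule continuous_attains_inf)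
  then obtain z where z: "z \<in> K \<times> sphere 0 1" "\<And>w. w \<in> K \<times> sphere 0 1 \<Longrightarrow> ?q z \<le> ?q w"
    by blast
  show ?thesis
  proof (intro exI[of _ "?q z"] conjI ballI allI)
    show "?q z > 0" using z(1) by (intro pos) (auto simp: mem_Times_iff)
    fix x :: 'x and \<xi> :: 'e assume x: "x \<in> K"
    show "?q z * (norm \<xi>)\<^sup>2 \<le> (\<Sum>i\<in>Basis. \<Sum>j\<in>Basis. a i j x * (\<xi> \<bullet> i) * (\<xi> \<bullet> j))"
    proof (cases "\<xi> = 0")
      case False
      have "?q z \<le> ?q (x, sgn \<xi>)" using x False by (intro z) (auto simp: norm_sgn)
      also have "\<dots> = (\<Sum>i\<in>Basis. \<Sum>j\<in>Basis. a i j x * (\<xi> \<bullet> i) * (\<xi> \<bullet> j)) / (norm \<xi>)\<^sup>2"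
        unfolding sum_divide_distrib by (intro sum.cong) (auto simp: sgn_div_norm power2_eq_square field_simps)
      finally show ?thesis using False by (simp add: field_simps)
    qed auto
  qed
qed (auto intro: exI[of _ 1])

text \<open>Half of the ellipticity constant is split off as a multiple of the identity, so the rest
  is still positive definite and factors continuously into the vector fields \<open>c k\<close>. The
  two summands are coupled differently: by reflection and in parallel.\<close>

lemma elliptic_decomposition:
  fixes a :: "'e::euclidean_space \<Rightarrow> 'e \<Rightarrow> 'x::topological_space \<Rightarrow> real"
  assumes "compact K"
    and cont: "\<And>i j. i \<in> Basis \<Longrightarrow> j \<in> Basis \<Longrightarrow> continuous_on K (a i j)"
    and sym: "\<And>x i j. x \<in> K \<Longrightarrow> i \<in> Basis \<Longrightarrow> j \<in> Basis \<Longrightarrow> a i j x = a j i x"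
    and pos: "\<And>x \<xi>. x \<in> K \<Longrightarrow> \<xi> \<noteq> 0 \<Longrightarrow> (\<Sum>i\<in>Basis. \<Sum>j\<in>Basis. a i j x * (\<xi> \<bullet> i) * (\<xi> \<bullet> j)) > 0"
  obtains \<kappa> and c :: "'e \<Rightarrow> 'x \<Rightarrow> 'e" where "\<kappa> > 0"
    "\<And>k. k \<in> Basis \<Longrightarrow> continuous_on K (c k)"
    "\<And>x i j. x \<in> K \<Longrightarrow> i \<in> Basis \<Longrightarrow> j \<in> Basis \<Longrightarrow>
       a i j x = (if i = j then \<kappa> else 0) + (\<Sum>k\<in>Basis. (c k x \<bullet> i) * (c k x \<bullet> j))"
proof -
  obtain \<mu> where \<mu>: "\<mu> > 0" "\<And>x \<xi>. x \<in> K \<Longrightarrow>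
      (\<Sum>i\<in>Basis. \<Sum>j\<in>Basis. a i j x * (\<xi> \<bullet> i) * (\<xi> \<bullet> j)) \<ge> \<mu> * (norm (\<xi>::'e))\<^sup>2"
    using elliptic_lower_bound[of K a] assms by blast
  define \<kappa> where "\<kappa> = \<mu> / 2"
  define b where "b i j x = a i j x - (if i = j then \<kappa> else 0)" for i j x
  have "\<exists>c :: 'e \<Rightarrow> 'e \<Rightarrow> 'x \<Rightarrow> real. (\<forall>k\<in>Basis. \<forall>i\<in>Basis. continuous_on K (c k i)) \<and>
    (\<forall>x\<in>K. \<forall>i\<in>Basis. \<forall>j\<in>Basis. b i j x = (\<Sum>k\<in>Basis. c k i x * c k j x))"
  proof (rule cholesky_continuous)
    show "continuous_on K (b i j)" if "i \<in> Basis" "j \<in> Basis" for i j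
      unfolding b_def using that by (intro continuous_intros cont)
    show "b i j x = b j i x" if "x \<in> K" "i \<in> Basis" "j \<in> Basis" for x i j
      unfolding b_def using sym[OF that] by auto
    fix x :: 'x and \<xi> :: "'e \<Rightarrow> real" assume x: "x \<in> K" and nz: "\<exists>i\<in>Basis. \<xi> i \<noteq> 0"
    define v where "v = (\<Sum>i\<in>Basis. \<xi> i *\<^sub>R i)"
    have v: "v \<bullet> i = \<xi> i" if "i \<in> Basis" for i
      unfolding v_def using that by simp
    have "v \<noteq> 0" using nz v by force
    have "(\<Sum>i\<in>Basis. \<Sum>j\<in>Basis. b i j x * \<xi> i * \<xi> j) =
      (\<Sum>i\<in>Basis. \<Sum>j\<in>Basis. a i j x * (v \<bullet> i) * (v \<bullet> j)) - (\<Sum>i\<in>Basis. \<Sum>j\<in>Basis. (if i = j then \<kappa> else 0) * (v \<bullet> i) * (v \<bullet> j))"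
      by (simp add: b_def v sum_subtractf[symmetric] algebra_simps)
    also have "(\<Sum>i\<in>Basis. \<Sum>j\<in>Basis. (if i = j then \<kappa> else 0) * (v \<bullet> i) * (v \<bullet> j)) = (\<Sum>i\<in>Basis. \<kappa> * (v \<bullet> i) * (v \<bullet> i))"
      by (intro sum.cong refl) (simp add: if_distrib[of "\<lambda>t. t * _"] sum.delta cong: if_cong)
    also have "\<dots> = \<kappa> * (norm v)\<^sup>2"
      by (simp add: power2_norm_eq_inner euclidean_inner[of v v] sum_distrib_left mult.assoc)
    finally have eq: "(\<Sum>i\<in>Basis. \<Sum>j\<in>Basis. b i j x * \<xi> i * \<xi> j) =
       (\<Sum>i\<in>Basis. \<Sum>j\<in>Basis. a i j x * (v \<bullet> i) * (v \<bullet> j)) - \<kappa> * (norm v)\<^sup>2" .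
    have "\<mu> * (norm v)\<^sup>2 - \<kappa> * (norm v)\<^sup>2 > 0"
      using \<open>v \<noteq> 0\<close> \<mu>(1) by (simp add: \<kappa>_def)
    then show "0 < (\<Sum>i\<in>Basis. \<Sum>j\<in>Basis. b i j x * \<xi> i * \<xi> j)"
      using \<mu>(2)[OF x, of v] eq by linarith
  qed auto
  then obtain c :: "'e \<Rightarrow> 'e \<Rightarrow> 'x \<Rightarrow> real" where c: "\<And>k i. k \<in> Basis \<Longrightarrow> i \<in> Basis \<Longrightarrow> continuous_on K (c k i)"
    "\<And>x i j. x \<in> K \<Longrightarrow> i \<in> Basis \<Longrightarrow> j \<in> Basis \<Longrightarrow> b i j x = (\<Sum>k\<in>Basis. c k i x * c k j x)"
    by blast
  show thesis
  proof (rule that[of \<kappa> "\<lambda>k x. \<Sum>i\<in>Basis. c k i x *\<^sub>R i"])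
    show "\<kappa> > 0" using \<mu> by (simp add: \<kappa>_def)
    show "continuous_on K (\<lambda>x. \<Sum>i\<in>Basis. c k i x *\<^sub>R i)" if "k \<in> Basis" for k
      using c(1)[OF that] by (intro continuous_intros)
    show "a i j x = (if i = j then \<kappa> else 0) +
        (\<Sum>k\<in>Basis. ((\<Sum>i\<in>Basis. c k i x *\<^sub>R i) \<bullet> i) * ((\<Sum>i\<in>Basis. c k i x *\<^sub>R i) \<bullet> j))"
      if "x \<in> K" "i \<in> Basis" "j \<in> Basis" for x i j
      using c(2)[OF that] that by (simp add: b_def)
  qed
qed

section \<open>Estimates for solutions of elliptic equations in a ball\<close>

lemma open_real_zero: "open S \<Longrightarrow> (0::real) \<in> S \<Longrightarrow> \<exists>d>0. \<forall>t. \<bar>t\<bar> < d \<longrightarrow> t \<in> S"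
proof -
  assume "open S" "(0::real) \<in> S"
  then obtain d where "d > 0" "ball 0 d \<subseteq> S" by (rule openE)
  then show ?thesis by (intro exI[of _ d]) (auto simp: subset_eq dist_real_def)
qed

text \<open>If \<open>s\<close> were positive, \<open>f'\<close> would be positive just to the right
  of its zero at 0, and \<open>f\<close> would increase there. Nothing is asked of the derivative of
  \<open>f'\<close> away from 0.\<close>

lemma second_derivative_test:
  fixes f f' :: "real \<Rightarrow> real"
  assumes "d > 0" "\<And>t. \<bar>t\<bar> < d \<Longrightarrow> (f has_real_derivative f' t) (at t)"
    and "(f' has_real_derivative s) (at 0)" and mx: "\<And>t. \<bar>t\<bar> < d \<Longrightarrow> f t \<le> f 0"
  shows "f' 0 = 0" "s \<le> 0"
proof -
  show z: "f' 0 = 0"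
    by (rule DERIV_local_max[of f "f' 0" 0 d]) (use assms in auto)
  show "s \<le> 0"
  proof (rule ccontr)
    assume "\<not> s \<le> 0"
    then obtain e where e: "e > 0" "\<And>h. 0 < h \<Longrightarrow> h < e \<Longrightarrow> f' 0 < f' h"
      using DERIV_pos_inc_right[OF assms(3)] by auto
    define h where "h = min d e / 2"
    have h: "0 < h" "h < d" "h < e" using assms(1) e(1) by (auto simp: h_def min_def)
    have "f 0 < f h"
    proof (rule DERIV_pos_imp_increasing_open[OF h(1)])
      show "\<exists>y. (f has_real_derivative y) (at x) \<and> 0 < y" if "0 < x" "x < h" for x
        using that h assms(2)[of x] e(2)[of x] z by auto
      show "continuous_on {0..h} f"
      proof (intro continuous_at_imp_continuous_on ballI)
        fix x assume "x \<in> {0..h}"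
        then show "isCont f x" using h assms(2)[of x] by (auto intro: DERIV_isCont)
      qed
    qed
    with mx[of h] h show False by auto
  qed
qed

text \<open>The Hessian as a quadratic form: these are the numbers that the one-dimensional second
  derivative test delivers along lines.\<close>

definition hess :: "('e::euclidean_space \<Rightarrow> real) \<Rightarrow> 'e \<Rightarrow> 'e \<Rightarrow> real" where
  "hess F y v = (\<Sum>i\<in>Basis. \<Sum>j\<in>Basis. (v \<bullet> i) * (v \<bullet> j) * partial i (partial j F) y)"

definition ell :: "('e::euclidean_space \<Rightarrow> 'e \<Rightarrow> 'e \<Rightarrow> real) \<Rightarrow> ('e \<Rightarrow> 'e \<Rightarrow> real) \<Rightarrow> ('e \<Rightarrow> real) \<Rightarrow> 'e \<Rightarrow> real" where
  "ell a b F y = 1/2 * (\<Sum>i\<in>Basis. \<Sum>j\<in>Basis. a i j y * partial i (partial j F) y) + (\<Sum>k\<in>Basis. b k y * partial k F y)"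

lemma frechet_derivative_partial:
  fixes F :: "'e::euclidean_space \<Rightarrow> real"
  assumes "smooth_on D F" "y \<in> D"
  shows "frechet_derivative F (at y) v = (\<Sum>j\<in>Basis. (v \<bullet> j) * partial j F y)"
proof -
  have lin: "linear (frechet_derivative F (at y))"
    using smooth_on_has_derivative[OF assms] by (rule has_derivative_linear)
  have "frechet_derivative F (at y) (\<Sum>j\<in>Basis. (v \<bullet> j) *\<^sub>R j) = (\<Sum>j\<in>Basis. (v \<bullet> j) * partial j F y)"
    by (simp add: linear_sum[OF lin] linear_scale[OF lin] partial_def)
  then show ?thesis by (simp add: euclidean_representation)
qed

section \<open>Derivatives along lines\<close>

lemma line_derivative:
  assumes "smooth_on D F" "y + t *\<^sub>R v \<in> D"
  shows "((\<lambda>t. F (y + t *\<^sub>R v)) has_real_derivative frechet_derivative F (at (y + t *\<^sub>R v)) v) (at t)"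
proof -
  have "(F has_derivative frechet_derivative F (at (y + t *\<^sub>R v))) (at (y + t *\<^sub>R v))"
    using assms by (rule smooth_on_has_derivative)
  moreover have "((\<lambda>t. y + t *\<^sub>R v) has_derivative (\<lambda>h. h *\<^sub>R v)) (at t)"
    by (auto intro!: derivative_eq_intros)
  ultimately have "((\<lambda>t. F (y + t *\<^sub>R v)) has_derivative (\<lambda>h. frechet_derivative F (at (y + t *\<^sub>R v)) (h *\<^sub>R v))) (at t)"
    using diff_chain_at[unfolded o_def] by blast
  moreover have "(\<lambda>h. frechet_derivative F (at (y + t *\<^sub>R v)) (h *\<^sub>R v)) = (*) (frechet_derivative F (at (y + t *\<^sub>R v)) v)"
    using has_derivative_linear[OF smooth_on_has_derivative[OF assms]]
    by (auto simp: linear_scale mult.commute)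
  ultimately show ?thesis by (simp add: has_field_derivative_def)
qed

lemma line_second_derivative:
  fixes F :: "'e::euclidean_space \<Rightarrow> real"
  assumes "smooth_on D F" "open D" "y \<in> D"
  shows "((\<lambda>t. frechet_derivative F (at (y + t *\<^sub>R v)) v) has_real_derivative hess F y v) (at 0)"
proof -
  have "((\<lambda>t. \<Sum>j\<in>Basis. (v \<bullet> j) * partial j F (y + t *\<^sub>R v)) has_real_derivative
      (\<Sum>j\<in>Basis. (v \<bullet> j) * frechet_derivative (partial j F) (at (y + 0 *\<^sub>R v)) v)) (at 0)"
    using assms by (intro DERIV_sum DERIV_cmult line_derivative[OF smooth_on_partial[OF assms(1)]]) auto
  moreover have "(\<Sum>j\<in>Basis. (v \<bullet> j) * frechet_derivative (partial j F) (at (y + 0 *\<^sub>R v)) v) = hess F y v"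
    using frechet_derivative_partial[OF smooth_on_partial[OF assms(1)] assms(3)]
    unfolding hess_def sum_distrib_left
    by (subst sum.swap) (simp add: sum_distrib_left algebra_simps)
  moreover have "open ((\<lambda>t. y + t *\<^sub>R v) -` D)"
    by (intro open_vimage assms continuous_intros)
  ultimately show ?thesis
    using has_field_derivative_transform_within_open[of "\<lambda>t. \<Sum>j\<in>Basis. (v \<bullet> j) * partial j F (y + t *\<^sub>R v)" "hess F y v" 0 "(\<lambda>t. y + t *\<^sub>R v) -` D" "\<lambda>t. frechet_derivative F (at (y + t *\<^sub>R v)) v"]
      frechet_derivative_partial[OF assms(1)] assms(3) by auto
qed

lemma sum_Basis_norm: "(\<Sum>i\<in>Basis. (v \<bullet> i) * (v \<bullet> i)) = (norm (v::'e::euclidean_space))\<^sup>2"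
  unfolding power2_norm_eq_inner by (rule euclidean_inner[symmetric])

text \<open>The vectors on the left are the mirror images of the basis in the hyperplane orthogonal
  to \<open>e\<close>, hence again orthonormal, and the sum is the trace of the Hessian.\<close>

lemma sum_hess_reflection:
  fixes e :: "'e::euclidean_space"
  assumes "norm e = 1"
  shows "(\<Sum>i\<in>Basis. hess F y (i - (2 * (e \<bullet> i)) *\<^sub>R e)) = (\<Sum>i\<in>Basis. hess F y i)"
proof -
  have del: "(\<Sum>i\<in>Basis. (i \<bullet> k) * (i \<bullet> l)) = (if k = l then 1 else 0)" if "k \<in> Basis" "l \<in> Basis" for k l :: 'e
  proof -
    have "(\<Sum>i\<in>Basis. (i \<bullet> k) * (i \<bullet> l)) = (\<Sum>i\<in>Basis. if i = k then (if i = l then 1 else 0) else 0)"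
      using that by (intro sum.cong) (auto simp: inner_Basis)
    then show ?thesis using that by (simp add: sum.delta)
  qed
  have refl: "(\<Sum>i\<in>Basis. ((i - (2 * (e \<bullet> i)) *\<^sub>R e) \<bullet> k) * ((i - (2 * (e \<bullet> i)) *\<^sub>R e) \<bullet> l)) = (\<Sum>i\<in>Basis. (i \<bullet> k) * (i \<bullet> l))"
    if "k \<in> Basis" "l \<in> Basis" for k l :: 'e
  proof -
    have e1: "(\<Sum>i\<in>Basis. (e \<bullet> i) * (e \<bullet> i)) = 1" using assms by (simp add: sum_Basis_norm)
    have e2: "(\<Sum>i\<in>Basis. (e \<bullet> i) * (i \<bullet> k)) = e \<bullet> k" for k :: 'e
      by (subst euclidean_inner[of e k]) (simp add: inner_commute)
    have "(\<Sum>i\<in>Basis. ((i - (2 * (e \<bullet> i)) *\<^sub>R e) \<bullet> k) * ((i - (2 * (e \<bullet> i)) *\<^sub>R e) \<bullet> l)) =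
      (\<Sum>i\<in>Basis. (i \<bullet> k) * (i \<bullet> l)) - 2 * (e \<bullet> l) * (\<Sum>i\<in>Basis. (e \<bullet> i) * (i \<bullet> k)) - 2 * (e \<bullet> k) * (\<Sum>i\<in>Basis. (e \<bullet> i) * (i \<bullet> l))
       + 4 * (e \<bullet> k) * (e \<bullet> l) * (\<Sum>i\<in>Basis. (e \<bullet> i) * (e \<bullet> i))"
      unfolding sum_distrib_left sum_subtractf[symmetric] sum.distrib[symmetric]
      by (intro sum.cong refl) (simp add: inner_diff_left algebra_simps)
    then show ?thesis unfolding e1 e2 by simp
  qed
  have swap: "(\<Sum>i\<in>Basis. hess F y (g i)) = (\<Sum>k\<in>Basis. \<Sum>l\<in>Basis. (\<Sum>i\<in>Basis. (g i \<bullet> k) * (g i \<bullet> l)) * partial k (partial l F) y)" for g :: "'e \<Rightarrow> 'e"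
    unfolding hess_def sum_distrib_right by (subst sum.swap) (intro sum.cong refl sum.swap)
  show ?thesis unfolding swap by (intro sum.cong HOL.refl) (simp only: refl)
qed

text \<open>Every constant here bounds coefficients on the ball and none refers to a solution, so
  whatever is derived from them holds uniformly over all solutions with values in [0, 1].\<close>

locale elliptic_ball =
  fixes D :: "'e::euclidean_space set" and y0 :: 'e and R :: real
    and a :: "'e \<Rightarrow> 'e \<Rightarrow> 'e \<Rightarrow> real" and b :: "'e \<Rightarrow> 'e \<Rightarrow> real"
    and \<kappa> :: real and c :: "'e \<Rightarrow> 'e \<Rightarrow> 'e" and Bb Cc :: real
  assumes D: "open D" "cball y0 R \<subseteq> D" and R: "R > 0" and \<kappa>: "\<kappa> > 0"
    and c_cont: "\<And>k. k \<in> Basis \<Longrightarrow> continuous_on (cball y0 R) (c k)"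
    and a_eq: "\<And>x i j. x \<in> cball y0 R \<Longrightarrow> i \<in> Basis \<Longrightarrow> j \<in> Basis \<Longrightarrow>
       a i j x = (if i = j then \<kappa> else 0) + (\<Sum>k\<in>Basis. (c k x \<bullet> i) * (c k x \<bullet> j))"
    and Bb: "\<And>x. x \<in> cball y0 R \<Longrightarrow> norm (\<Sum>k\<in>Basis. b k x *\<^sub>R k) \<le> Bb"
    and Cc: "\<And>x. x \<in> cball y0 R \<Longrightarrow> (\<Sum>k\<in>Basis. (norm (c k x))\<^sup>2) \<le> Cc"
begin

definition "bv x = (\<Sum>k\<in>Basis. b k x *\<^sub>R k)"

definition "sol v \<longleftrightarrow> smooth_on D v \<and> (\<forall>y\<in>cball y0 R. ell a b v y = 0 \<and> 0 \<le> v y \<and> v y \<le> 1)"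

lemma ell_eq:
  assumes "smooth_on D v" "y \<in> cball y0 R"
  shows "ell a b v y = 1/2 * (\<kappa> * (\<Sum>i\<in>Basis. hess v y i) + (\<Sum>k\<in>Basis. hess v y (c k y)))
    + frechet_derivative v (at y) (bv y)"
proof -
  let ?H = "\<lambda>i j. partial i (partial j v) y"
  have "(\<Sum>i\<in>Basis. \<Sum>j\<in>Basis. a i j y * ?H i j) =
    (\<Sum>i\<in>Basis. \<Sum>j\<in>Basis. (if i = j then \<kappa> * ?H i j else 0)) +
    (\<Sum>i\<in>Basis. \<Sum>j\<in>Basis. \<Sum>k\<in>Basis. (c k y \<bullet> i) * (c k y \<bullet> j) * ?H i j)"
    unfolding sum.distrib[symmetric]
    by (intro sum.cong refl) (use a_eq[OF assms(2)] in \<open>simp add: sum_distrib_right distrib_right\<close>)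
  also have "(\<Sum>i\<in>Basis. \<Sum>j\<in>Basis. (if i = j then \<kappa> * ?H i j else 0)) = \<kappa> * (\<Sum>i\<in>Basis. ?H i i)"
    by (simp add: sum_distrib_left)
  also have "(\<Sum>i\<in>Basis. ?H i i) = (\<Sum>i\<in>Basis. hess v y i)"
  proof (intro sum.cong refl)
    fix i :: 'e assume i: "i \<in> Basis"
    have "hess v y i = (\<Sum>k\<in>Basis. \<Sum>l\<in>Basis. if k = i then (if l = i then ?H k l else 0) else 0)"
      unfolding hess_def using i by (intro sum.cong refl) (auto simp: inner_Basis)
    also have "\<dots> = (\<Sum>k\<in>Basis. if k = i then ?H k i else 0)"
      using i by (intro sum.cong refl) auto
    finally show "?H i i = hess v y i" using i by simp
  qed
  also have "(\<Sum>i\<in>Basis. \<Sum>j\<in>Basis. \<Sum>k\<in>Basis. (c k y \<bullet> i) * (c k y \<bullet> j) * ?H i j) = (\<Sum>k\<in>Basis. hess v y (c k y))"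
    unfolding hess_def by (subst (2) sum.swap, subst sum.swap) (intro sum.cong refl sum.swap)
  finally have "(\<Sum>i\<in>Basis. \<Sum>j\<in>Basis. a i j y * ?H i j) = \<kappa> * (\<Sum>i\<in>Basis. hess v y i) + (\<Sum>k\<in>Basis. hess v y (c k y))" .
  moreover have "y \<in> D" using D assms(2) by auto
  then have "frechet_derivative v (at y) (bv y) = (\<Sum>k\<in>Basis. b k y * partial k v y)"
    by (simp add: frechet_derivative_partial[OF assms(1)] bv_def)
  ultimately show ?thesis by (simp add: ell_def)
qed

lemma bv_bound: "x \<in> cball y0 R \<Longrightarrow> norm (bv x) \<le> Bb"
  unfolding bv_def by (rule Bb)

lemma Bb_nonneg: "0 \<le> Bb"
  using bv_bound[of y0] norm_ge_zero[of "bv y0"] R by (simp del: norm_ge_zero)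

lemma Cc_nonneg: "0 \<le> Cc"
  using Cc[of y0] R sum_nonneg[of Basis "\<lambda>k. (norm (c k y0))\<^sup>2"] by fastforce

lemma solD:
  assumes "sol v"
  shows "smooth_on D v" "\<And>y. y \<in> cball y0 R \<Longrightarrow> 0 \<le> v y" "\<And>y. y \<in> cball y0 R \<Longrightarrow> v y \<le> 1"
   "\<And>y. y \<in> cball y0 R \<Longrightarrow> \<kappa> * (\<Sum>i\<in>Basis. hess v y i) + (\<Sum>k\<in>Basis. hess v y (c k y))
       = - 2 * frechet_derivative v (at y) (bv y)"
proof -
  show v: "smooth_on D v" "\<And>y. y \<in> cball y0 R \<Longrightarrow> 0 \<le> v y" "\<And>y. y \<in> cball y0 R \<Longrightarrow> v y \<le> 1"
    using assms unfolding sol_def by auto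
  have half: "1 / 2 * s + t = 0 \<Longrightarrow> s = - 2 * t" for s t :: real by simp
  fix y assume y: "y \<in> cball y0 R"
  then have "ell a b v y = 0" using assms unfolding sol_def by auto
  then show "\<kappa> * (\<Sum>i\<in>Basis. hess v y i) + (\<Sum>k\<in>Basis. hess v y (c k y)) = - 2 * frechet_derivative v (at y) (bv y)"
    unfolding ell_eq[OF v(1) y] by (rule half)
qed

lemma half_cball: "x1 \<in> cball y0 (R/2) \<Longrightarrow> x \<in> cball x1 (R/2) \<Longrightarrow> x \<in> cball y0 R"
  using dist_triangle[of y0 x x1] by auto

text \<open>Uniform continuity on the compact ball. The tolerance \<open>\<kappa> / 2\<close> is
  such that moving along the slightly different fields \<open>c k\<close> costs a quarter of what
  the reflected part gains.\<close>

lemma c_close: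
  "\<exists>\<eta>>0. \<forall>x\<in>cball y0 R. \<forall>y\<in>cball y0 R. norm (x - y) < \<eta> \<longrightarrow> (\<Sum>k\<in>Basis. (norm (c k x - c k y))\<^sup>2) \<le> \<kappa> / 2"
proof -
  define n where "n = real DIM('e)"
  have n: "n \<ge> 1" by (simp add: n_def DIM_positive Suc_leI)
  define \<epsilon> where "\<epsilon> = sqrt (\<kappa> / (2 * n))"
  have \<epsilon>: "\<epsilon> > 0" "n * \<epsilon>\<^sup>2 = \<kappa> / 2" using n \<kappa> by (auto simp: \<epsilon>_def)
  have "\<exists>\<eta>>0. \<forall>x\<in>cball y0 R. \<forall>y\<in>cball y0 R. norm (x - y) < \<eta> \<longrightarrow> norm (c k x - c k y) < \<epsilon>" if "k \<in> Basis" for k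
    using compact_uniformly_continuous[OF c_cont[OF that] compact_cball] \<epsilon>(1)
    unfolding uniformly_continuous_on_def dist_norm by metis
  then obtain \<eta> where \<eta>: "\<And>k. k \<in> Basis \<Longrightarrow> \<eta> k > 0"
    "\<And>k x y. k \<in> Basis \<Longrightarrow> x \<in> cball y0 R \<Longrightarrow> y \<in> cball y0 R \<Longrightarrow> norm (x - y) < \<eta> k \<Longrightarrow> norm (c k x - c k y) < \<epsilon>"
    by metis
  show ?thesis
  proof (intro exI[of _ "Min (\<eta> ` Basis)"] conjI ballI impI)
    show "0 < Min (\<eta> ` Basis)" using \<eta>(1) by (subst Min_gr_iff) auto
    fix x y assume xy: "x \<in> cball y0 R" "y \<in> cball y0 R" "norm (x - y) < Min (\<eta> ` Basis)"
    have "(norm (c k x - c k y))\<^sup>2 \<le> \<epsilon>\<^sup>2" if "k \<in> Basis" for k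
    proof -
      have "norm (x - y) < \<eta> k" using xy(3) that by (subst (asm) Min_gr_iff) auto
      then show ?thesis using \<eta>(2)[OF that xy(1,2)] by (intro power_mono) auto
    qed
    then have "(\<Sum>k\<in>Basis. (norm (c k x - c k y))\<^sup>2) \<le> n * \<epsilon>\<^sup>2"
      using sum_bounded_above[of Basis "\<lambda>k. (norm (c k x - c k y))\<^sup>2" "\<epsilon>\<^sup>2"] by (simp add: n_def)
    then show "(\<Sum>k\<in>Basis. (norm (c k x - c k y))\<^sup>2) \<le> \<kappa> / 2" using \<epsilon>(2) by simp
  qed
qed

end

section \<open>Doubling of variables, barrier and weak Harnack inequality\<close>

lemma norm2_line_derivative:
  fixes z w :: "'e::euclidean_space"
  shows "((\<lambda>t. (norm (z + t *\<^sub>R w))\<^sup>2) has_real_derivative 2 * ((z + t *\<^sub>R w) \<bullet> w)) (at t)"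
proof -
  have "(norm (z + t *\<^sub>R w))\<^sup>2 = z \<bullet> z + 2 * t * (z \<bullet> w) + t\<^sup>2 * (w \<bullet> w)" for t
    unfolding power2_norm_eq_inner by (simp add: inner_add_left inner_add_right inner_commute power2_eq_square algebra_simps)
  then have *: "(\<lambda>t. (norm (z + t *\<^sub>R w))\<^sup>2) = (\<lambda>t. z \<bullet> z + 2 * t * (z \<bullet> w) + t\<^sup>2 * (w \<bullet> w))" by blast
  show ?thesis unfolding * by (auto intro!: derivative_eq_intros simp: inner_add_left algebra_simps)
qed

lemma inner_line_derivative:
  fixes z w :: "'e::euclidean_space"
  shows "((\<lambda>t. (z + t *\<^sub>R w) \<bullet> w) has_real_derivative w \<bullet> w) (at t)"
  unfolding inner_add_left inner_scaleR_left by (auto intro!: derivative_eq_intros)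

text \<open>The squared norm is a polynomial along a line, so the right-hand form is easy to
  differentiate away from 0.\<close>

lemma sqrt_norm_powr: "sqrt (norm x) = ((norm x)\<^sup>2) powr (1/4)"
proof (cases "x = 0")
  case False
  then have "((norm x)\<^sup>2) powr (1/4) = (norm x powr 2) powr (1/4)" by (simp add: powr_numeral)
  also have "\<dots> = norm x powr (1/2)" by (subst powr_powr) simp
  finally show ?thesis by (simp add: powr_half_sqrt)
qed simp

context elliptic_ball
begin

text \<open>Doubling of variables: the two points of the test function move along reflected directions in
  the uniformly elliptic part of the operator, and along the almost equal directions \<^term>\<open>c k x\<close>,
  \<^term>\<open>c k y\<close> in the remaining part, so that the concave modulus of continuity contributes
  a large negative second derivative.\<close>

lemma doubling_max_inequality:
  fixes M K r :: real
  assumes v: "smooth_on D v" and x1: "x1 \<in> cball y0 (R/2)"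
    and x: "x \<in> ball x1 (R/2)" and y: "y \<in> ball x1 (R/2)" and xy: "x \<noteq> y"
    and mx: "\<And>x' y'. x' \<in> ball x1 (R/2) \<Longrightarrow> y' \<in> ball x1 (R/2) \<Longrightarrow>
      v x' - v y' - M * sqrt (norm (x' - y')) - K * ((norm (x' - x1))\<^sup>2 + (norm (y' - x1))\<^sup>2) \<le>
      v x - v y - M * sqrt (norm (x - y)) - K * ((norm (x - x1))\<^sup>2 + (norm (y - x1))\<^sup>2)"
  defines "z \<equiv> x - y" and "P \<equiv> ((norm (x - y))\<^sup>2) powr (- 3/4)"
  shows "frechet_derivative v (at x) p - frechet_derivative v (at y) q - M * (1/2 * P * (z \<bullet> (p - q)))
      - K * (2 * ((x - x1) \<bullet> p) + 2 * ((y - x1) \<bullet> q)) = 0"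
    and "hess v x p - hess v y q
      - M * (1/2 * P * (norm (p - q))\<^sup>2 - 3/4 * P * (z \<bullet> (p - q))\<^sup>2 / (norm z)\<^sup>2)
      - K * (2 * (norm p)\<^sup>2 + 2 * (norm q)\<^sup>2) \<le> 0"
proof -
  define w where "w = p - q"
  let ?X = "\<lambda>t. x + t *\<^sub>R p" and ?Y = "\<lambda>t. y + t *\<^sub>R q" and ?Z = "\<lambda>t::real. z + t *\<^sub>R w"
  \<comment> \<open>Times at which both moving points stay in the ball and do not meet; the square
    root of their distance is not differentiable where they meet.\<close>
  define S where "S = ?X -` ball x1 (R/2) \<inter> ?Y -` ball x1 (R/2) \<inter> ?Z -` (- {0})"
  have "open S" unfolding S_def by (intro open_Int open_vimage continuous_intros) auto
  moreover have "0 \<in> S" using x y xy by (simp add: S_def z_def)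
  ultimately obtain d where d: "d > 0" "\<And>t. \<bar>t\<bar> < d \<Longrightarrow> t \<in> S"
    using open_real_zero by metis
  have inD: "ball x1 (R/2) \<subseteq> D" using half_cball[OF x1] D(2) by auto
  define f where "f t = v (?X t) - v (?Y t) - M * ((norm (?Z t))\<^sup>2) powr (1/4)
     - K * ((norm ((x - x1) + t *\<^sub>R p))\<^sup>2 + (norm ((y - x1) + t *\<^sub>R q))\<^sup>2)" for t
  define f' where "f' t = frechet_derivative v (at (?X t)) p - frechet_derivative v (at (?Y t)) q
     - M * (1/2 * ((norm (?Z t))\<^sup>2) powr (-3/4) * (?Z t \<bullet> w))
     - K * (2 * (((x - x1) + t *\<^sub>R p) \<bullet> p) + 2 * (((y - x1) + t *\<^sub>R q) \<bullet> q))" for t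
  have Z: "?X t - ?Y t = ?Z t" "?X t - x1 = (x - x1) + t *\<^sub>R p" "?Y t - x1 = (y - x1) + t *\<^sub>R q" for t
    by (simp_all add: z_def w_def algebra_simps)
  have "(f has_real_derivative f' t) (at t)" if "\<bar>t\<bar> < d" for t
  proof -
    have tS: "?X t \<in> D" "?Y t \<in> D" "?Z t \<noteq> 0" using d(2)[OF that] inD by (auto simp: S_def)
    have "((\<lambda>t. ((norm (?Z t))\<^sup>2) powr (1/4)) has_real_derivative
       1/4 * ((norm (?Z t))\<^sup>2) powr (1/4 - 1) * (2 * (?Z t \<bullet> w))) (at t)"
      using tS by (intro has_real_derivative_powr[THEN DERIV_chain2] norm2_line_derivative) auto
    then have "((\<lambda>t. ((norm (?Z t))\<^sup>2) powr (1/4)) has_real_derivative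
       1/2 * ((norm (?Z t))\<^sup>2) powr (-3/4) * (?Z t \<bullet> w)) (at t)" by (simp add: mult.commute)
    then show ?thesis unfolding f_def[abs_def] f'_def
      by (intro DERIV_diff DERIV_cmult DERIV_add line_derivative[OF v] norm2_line_derivative tS)
  qed
  moreover have "(f' has_real_derivative (hess v x p - hess v y q
      - M * (1/2 * P * (norm w)\<^sup>2 - 3/4 * P * (z \<bullet> w)\<^sup>2 / (norm z)\<^sup>2)
      - K * (2 * (norm p)\<^sup>2 + 2 * (norm q)\<^sup>2))) (at 0)"
  proof -
    have z0: "norm z > 0" using xy by (simp add: z_def)
    have "((\<lambda>t. ((norm (?Z t))\<^sup>2) powr (-3/4)) has_real_derivative
       (-3/4) * ((norm (?Z 0))\<^sup>2) powr (-3/4 - 1) * (2 * (?Z 0 \<bullet> w))) (at 0)"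
      using z0 by (intro has_real_derivative_powr[THEN DERIV_chain2] norm2_line_derivative) auto
    moreover have "((norm (?Z 0))\<^sup>2) powr (-3/4 - 1) = P / (norm z)\<^sup>2"
      using z0 by (subst powr_diff) (simp add: P_def z_def)
    ultimately have 1: "((\<lambda>t. ((norm (?Z t))\<^sup>2) powr (-3/4)) has_real_derivative
       (-3/4) * (P / (norm z)\<^sup>2) * (2 * (z \<bullet> w))) (at 0)" by (simp add: mult.commute)
    have 2: "((\<lambda>t. 1/2 * ((norm (?Z t))\<^sup>2) powr (-3/4) * (?Z t \<bullet> w)) has_real_derivative
       1/2 * P * (norm w)\<^sup>2 - 3/4 * P * (z \<bullet> w)\<^sup>2 / (norm z)\<^sup>2) (at 0)"
      using DERIV_mult[OF DERIV_cmult[OF 1, of "1/2"] inner_line_derivative[of z w 0]]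
      by (rule DERIV_cong) (simp add: P_def z_def[symmetric] power2_norm_eq_inner[symmetric], simp add: power2_eq_square algebra_simps)
    have xyD: "x \<in> D" "y \<in> D" using x y inD by auto
    show ?thesis unfolding f'_def[abs_def] power2_norm_eq_inner[of p] power2_norm_eq_inner[of q]
      by (intro DERIV_diff DERIV_cmult DERIV_add line_second_derivative[OF v D(1)] 2 inner_line_derivative xyD)
  qed
  moreover have "f t \<le> f 0" if "\<bar>t\<bar> < d" for t
    using mx[of "?X t" "?Y t"] d(2)[OF that] unfolding f_def sqrt_norm_powr Z S_def
    by (simp add: z_def)
  ultimately have "f' 0 = 0" "hess v x p - hess v y q
      - M * (1/2 * P * (norm w)\<^sup>2 - 3/4 * P * (z \<bullet> w)\<^sup>2 / (norm z)\<^sup>2)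
      - K * (2 * (norm p)\<^sup>2 + 2 * (norm q)\<^sup>2) \<le> 0"
    using second_derivative_test[OF d(1), of f f'] by blast+
  then show "frechet_derivative v (at x) p - frechet_derivative v (at y) q - M * (1/2 * P * (z \<bullet> (p - q)))
      - K * (2 * ((x - x1) \<bullet> p) + 2 * ((y - x1) \<bullet> q)) = 0"
    "hess v x p - hess v y q
      - M * (1/2 * P * (norm (p - q))\<^sup>2 - 3/4 * P * (z \<bullet> (p - q))\<^sup>2 / (norm z)\<^sup>2)
      - K * (2 * (norm p)\<^sup>2 + 2 * (norm q)\<^sup>2) \<le> 0"
    by (simp_all add: f'_def w_def P_def z_def[symmetric])
qed

text \<open>If the estimate failed, the doubled function \<open>\<Phi>\<close> would have a positive
  maximum. Subtracting the equations at its two points, the concave square root contributes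
  \<open>- \<kappa> * M * P\<close>; the fields \<open>c k\<close> and the drift give back at most
  half of this, and the penalty a constant \<open>C1\<close> not depending on \<open>M\<close>. For
  large \<open>M\<close> this is impossible.\<close>

lemma equicontinuous:
  obtains M K where "M \<ge> 0" "K \<ge> 0"
    "\<And>v x1 x. sol v \<Longrightarrow> x1 \<in> cball y0 (R/2) \<Longrightarrow> x \<in> cball x1 (R/2) \<Longrightarrow>
      v x1 - v x \<le> M * sqrt (norm (x - x1)) + K * (norm (x - x1))\<^sup>2"
proof -
  \<comment> \<open>The penalty is 2 on the sphere of radius \<open>R/2\<close>, beyond the
    oscillation of a solution, so a positive maximum is attained at interior points.\<close>
  define K where "K = 8 / R\<^sup>2"
  define n where "n = real DIM('e)"
  \<comment> \<open>All terms produced by the penalty: its gradient against the drift, then its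
    second derivatives in the basis directions and along the \<open>c k\<close>.\<close>
  define C1 where "C1 = 4 * K * Bb * R + 4 * K * (\<kappa> * n + Cc)"
  obtain \<eta> where \<eta>: "\<eta> > 0" "\<And>x y. x \<in> cball y0 R \<Longrightarrow> y \<in> cball y0 R \<Longrightarrow> norm (x - y) < \<eta> \<Longrightarrow>
      (\<Sum>k\<in>Basis. (norm (c k x - c k y))\<^sup>2) \<le> \<kappa> / 2" using c_close by blast
  \<comment> \<open>In order, the summands give \<open>r \<le> 1\<close> and thus
    \<open>P \<ge> 1\<close>; \<open>r < \<eta>\<close>, so that the fields \<open>c k\<close> are
    close; \<open>2 * Bb * r \<le> \<kappa> / 4\<close>, which absorbs the drift; and the final
    contradiction with \<open>C1\<close>.\<close>
  define M where "M = 1 + 1 / \<eta> + 8 * Bb / \<kappa> + 2 * C1 / \<kappa>"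
  have K: "K > 0" "K * (R/2)\<^sup>2 = 2" using R by (auto simp: K_def power2_eq_square)
  have C1: "C1 \<ge> 0" unfolding C1_def n_def using K Bb_nonneg R \<kappa> Cc_nonneg by simp
  have terms: "1 / \<eta> > 0" "8 * Bb / \<kappa> \<ge> 0" "2 * C1 / \<kappa> \<ge> 0" using \<eta> Bb_nonneg \<kappa> C1 by auto
  have M: "M > 1" "M > 1 / \<eta>" "M \<ge> 8 * Bb / \<kappa>" "M > 2 * C1 / \<kappa>"
    using terms unfolding M_def by linarith+
  have "v x1 - v x \<le> M * sqrt (norm (x - x1)) + K * (norm (x - x1))\<^sup>2"
    if sol: "sol v" and x1: "x1 \<in> cball y0 (R/2)" and x: "x \<in> cball x1 (R/2)" for v x1 x
  proof (rule ccontr)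
    assume contr: "\<not> ?thesis"
    note v = solD(1)[OF sol]
    have v01: "0 \<le> v u" "v u \<le> 1" if "u \<in> cball x1 (R/2)" for u
      using solD(2,3)[OF sol half_cball[OF x1 that]] by auto
    define \<Phi> where "\<Phi> = (\<lambda>(x', y'). v x' - v y' - M * sqrt (norm (x' - y')) - K * ((norm (x' - x1))\<^sup>2 + (norm (y' - x1))\<^sup>2))"
    let ?S = "cball x1 (R/2)"
    have vc: "continuous_on ?S v"
      using smooth_on_imp_continuous_on[OF v] D(2) half_cball[OF x1] by (blast intro: continuous_on_subset)
    have "continuous_on (?S \<times> ?S) \<Phi>"
      unfolding \<Phi>_def case_prod_unfold
      by (intro continuous_intros continuous_on_compose2[OF vc]) auto
    moreover have "compact (?S \<times> ?S)" by (intro compact_Times compact_cball)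
    moreover have x1S: "x1 \<in> ?S" using R by simp
    ultimately obtain xy where xy: "xy \<in> ?S \<times> ?S" "\<And>uw. uw \<in> ?S \<times> ?S \<Longrightarrow> \<Phi> uw \<le> \<Phi> xy"
      using continuous_attains_sup[of "?S \<times> ?S" \<Phi>] by blast
    obtain p q where pq: "xy = (p, q)" by (cases xy)
    have pS: "p \<in> ?S" and qS: "q \<in> ?S" using xy(1) pq by auto
    have "0 < \<Phi> (x1, x)" using contr by (simp add: \<Phi>_def norm_minus_commute)
    also have "\<dots> \<le> \<Phi> (p, q)" using xy(2)[of "(x1, x)"] x x1S pq by simp
    finally have pos: "0 < \<Phi> (p, q)" .
    define r where "r = norm (p - q)"
    have pos': "M * sqrt r + K * ((norm (p - x1))\<^sup>2 + (norm (q - x1))\<^sup>2) < v p - v q"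
      using pos by (simp add: \<Phi>_def r_def)
    have le1: "v p - v q \<le> 1" using v01(1)[OF qS] v01(2)[OF pS] by simp
    have nn: "M * sqrt r \<ge> 0" "K * (norm (p - x1))\<^sup>2 \<ge> 0" "K * (norm (q - x1))\<^sup>2 \<ge> 0"
      using M(1) K(1) by (auto simp: r_def)
    have inner: "norm (u - x1) < R/2" if "K * (norm (u - x1))\<^sup>2 < 1" for u
    proof (rule ccontr)
      assume "\<not> ?thesis"
      then have "(R/2)\<^sup>2 \<le> (norm (u - x1))\<^sup>2" using R by (intro power_mono) auto
      then have "K * (R/2)\<^sup>2 \<le> K * (norm (u - x1))\<^sup>2" using K(1) by (intro mult_left_mono) auto
      then show False using that K(2) by linarith
    qed
    have "K * (norm (p - x1))\<^sup>2 < 1" "K * (norm (q - x1))\<^sup>2 < 1"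
      using pos' le1 nn unfolding distrib_left by linarith+
    then have pB: "p \<in> ball x1 (R/2)" and qB: "q \<in> ball x1 (R/2)"
      using inner by (auto simp: dist_norm norm_minus_commute)
    have Mr: "M * sqrt r < 1" using pos' le1 nn unfolding distrib_left by linarith
    have pnq: "p \<noteq> q" using pos' nn by auto
    then have r0: "r > 0" by (simp add: r_def)
    have "sqrt r < 1 / M" using Mr M(1) by (simp add: field_simps)
    then have "(sqrt r)\<^sup>2 < (1 / M)\<^sup>2" using r0 by (intro power_strict_mono) auto
    then have rM2: "r < 1 / (M * M)" using r0 by (simp add: power2_eq_square)
    also have "1 / (M * M) \<le> 1 / M" using M(1) by (simp add: field_simps)
    finally have rM: "r < 1 / M" .
    then have r1: "r \<le> 1" using M(1) by (smt (verit) divide_le_eq_1)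
    have "1 / M < \<eta>" using M(1,2) \<eta>(1) by (simp add: field_simps)
    then have r\<eta>: "r < \<eta>" using rM by simp
    have "2 * Bb * r \<le> 2 * Bb * (1 / M)" using rM Bb_nonneg by (intro mult_left_mono) auto
    also have "\<dots> \<le> \<kappa> / 4" using M(1,3) \<kappa> by (simp add: field_simps)
    finally have rB: "2 * Bb * r \<le> \<kappa> / 4" .
    define P where "P = (r\<^sup>2) powr (- 3/4)"
    have P1: "P \<ge> 1"
    proof -
      have "1 powr (-3/4) \<le> (r\<^sup>2) powr (-3/4)" using r0 r1 by (intro powr_mono2') (auto simp: power_le_one)
      then show ?thesis by (simp add: P_def)
    qed
    define z where "z = p - q"
    have nz: "norm z = r" by (simp add: z_def r_def)
    note ineq = doubling_max_inequality[OF v x1 pB qB pnq, of M K, folded z_def, unfolded nz, folded P_def]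
    have mx: "v x' - v y' - M * sqrt (norm (x' - y')) - K * ((norm (x' - x1))\<^sup>2 + (norm (y' - x1))\<^sup>2)
      \<le> v p - v q - M * sqrt r - K * ((norm (p - x1))\<^sup>2 + (norm (q - x1))\<^sup>2)"
      if "x' \<in> ball x1 (R/2)" "y' \<in> ball x1 (R/2)" for x' y'
      using xy(2)[of "(x', y')"] that pq by (simp add: \<Phi>_def r_def)
    have first: "frechet_derivative v (at p) s - frechet_derivative v (at q) t - M * (1/2 * P * (z \<bullet> (s - t)))
      - K * (2 * ((p - x1) \<bullet> s) + 2 * ((q - x1) \<bullet> t)) = 0" for s t
      by (rule ineq(1)) (rule mx)
    have second: "hess v p s - hess v q t \<le>
      M * (1/2 * P * (norm (s - t))\<^sup>2 - 3/4 * P * (z \<bullet> (s - t))\<^sup>2 / r\<^sup>2)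
      + K * (2 * (norm s)\<^sup>2 + 2 * (norm t)\<^sup>2)" for s t
      using ineq(2)[OF mx, of s t] by simp
    define e where "e = z /\<^sub>R r"
    have ne: "norm e = 1" using r0 nz by (simp add: e_def)
    have ze: "z = r *\<^sub>R e" using r0 by (simp add: e_def)
    have e2: "(\<Sum>i\<in>Basis. (e \<bullet> i)\<^sup>2) = 1" using sum_Basis_norm[of e] ne by (simp add: power2_eq_square)
    \<comment> \<open>Under reflection the separation changes by a multiple of \<open>e\<close>,
      hence along \<open>z\<close> itself, the only direction in which the square root of the norm
      is concave.\<close>
    have refl: "hess v p i - hess v q (i - (2 * (e \<bullet> i)) *\<^sub>R e) \<le> - (M * P) * (e \<bullet> i)\<^sup>2 + 4 * K" if i: "i \<in> Basis" for i
    proof -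
      have n1: "(norm (i - (2 * (e \<bullet> i)) *\<^sub>R e))\<^sup>2 = 1"
        using i ne unfolding power2_norm_eq_inner
        by (simp add: inner_diff_left inner_diff_right inner_commute norm_eq_1[symmetric] power2_eq_square algebra_simps)
      have w: "i - (i - (2 * (e \<bullet> i)) *\<^sub>R e) = (2 * (e \<bullet> i)) *\<^sub>R e" by simp
      have "z \<bullet> e = r" using ne by (simp add: ze norm_eq_1)
      then have "1/2 * P * (norm ((2 * (e \<bullet> i)) *\<^sub>R e))\<^sup>2 - 3/4 * P * (z \<bullet> ((2 * (e \<bullet> i)) *\<^sub>R e))\<^sup>2 / r\<^sup>2
         = - P * (e \<bullet> i)\<^sup>2"
        using ne r0 by (simp add: power_mult_distrib field_simps)
      then have "hess v p i - hess v q (i - (2 * (e \<bullet> i)) *\<^sub>R e) \<le> M * (- P * (e \<bullet> i)\<^sup>2) + K * (2 * (norm i)\<^sup>2 + 2 * 1)"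
        using second[of i "i - (2 * (e \<bullet> i)) *\<^sub>R e"] unfolding w n1 by simp
      then show ?thesis using i by simp
    qed
    have "(\<Sum>i\<in>Basis. hess v p i) - (\<Sum>i\<in>Basis. hess v q i) = (\<Sum>i\<in>Basis. hess v p i - hess v q (i - (2 * (e \<bullet> i)) *\<^sub>R e))"
      using sum_hess_reflection[OF ne, of v q] by (simp add: sum_subtractf)
    also have "\<dots> \<le> (\<Sum>i\<in>Basis. - (M * P) * (e \<bullet> i)\<^sup>2 + 4 * K)" by (intro sum_mono refl)
    also have "\<dots> = - (M * P) * (\<Sum>i\<in>Basis. (e \<bullet> i)\<^sup>2) + 4 * K * n"
      unfolding sum.distrib sum_distrib_left[symmetric] by (simp add: n_def)
    finally have sum1: "(\<Sum>i\<in>Basis. hess v p i) - (\<Sum>i\<in>Basis. hess v q i) \<le> - (M * P) + 4 * K * n"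
      unfolding e2 by simp
    have pK: "p \<in> cball y0 R" and qK: "q \<in> cball y0 R" using half_cball[OF x1] pS qS by auto
    have "hess v p (c k p) - hess v q (c k q) \<le> M * (1/2 * P * (norm (c k p - c k q))\<^sup>2)
        + 2 * K * ((norm (c k p))\<^sup>2 + (norm (c k q))\<^sup>2)" for k
    proof -
      have "M * (3/4 * P * (z \<bullet> (c k p - c k q))\<^sup>2 / r\<^sup>2) \<ge> 0" using M(1) P1 by simp
      then show ?thesis using second[of "c k p" "c k q"] by (simp add: algebra_simps)
    qed
    then have "(\<Sum>k\<in>Basis. hess v p (c k p) - hess v q (c k q)) \<le> (\<Sum>k\<in>Basis. M * (1/2 * P * (norm (c k p - c k q))\<^sup>2)
        + 2 * K * ((norm (c k p))\<^sup>2 + (norm (c k q))\<^sup>2))" by (intro sum_mono)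
    also have "\<dots> = M * (1/2 * P * (\<Sum>k\<in>Basis. (norm (c k p - c k q))\<^sup>2)) + 2 * K * ((\<Sum>k\<in>Basis. (norm (c k p))\<^sup>2) + (\<Sum>k\<in>Basis. (norm (c k q))\<^sup>2))"
      by (simp only: sum.distrib sum_distrib_left[symmetric])
    also have "\<dots> \<le> M * (1/2 * P * (\<kappa> / 2)) + 2 * K * (Cc + Cc)"
      using M(1) P1 K(1) \<eta>(2)[OF pK qK] r\<eta> Cc[OF pK] Cc[OF qK]
      by (intro add_mono mult_left_mono) (auto simp: r_def)
    finally have sum2: "(\<Sum>k\<in>Basis. hess v p (c k p)) - (\<Sum>k\<in>Basis. hess v q (c k q)) \<le> M * P * \<kappa> / 4 + 4 * K * Cc"
      by (simp add: sum_subtractf)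
    have lin0: "frechet_derivative v (at u) 0 = 0" if "u \<in> cball y0 R" for u
      using frechet_derivative_partial[OF v, of u 0] that D(2) by auto
    \<comment> \<open>Moving one point while the other rests gives the gradient at each point
      separately.\<close>
    have gp: "frechet_derivative v (at p) (bv p) = M * (1/2 * P * (z \<bullet> bv p)) + 2 * K * ((p - x1) \<bullet> bv p)"
      using first[of "bv p" 0] lin0[OF qK] by simp
    have gq: "frechet_derivative v (at q) (bv q) = M * (1/2 * P * (z \<bullet> bv q)) - 2 * K * ((q - x1) \<bullet> bv q)"
      using first[of 0 "bv q"] lin0[OF pK] by (simp add: algebra_simps)
    have cs: "u \<bullet> w \<le> l * Bb" "- (u \<bullet> w) \<le> l * Bb" if "norm u \<le> l" "norm w \<le> Bb" for u w :: 'e and l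
    proof -
      have "\<bar>u \<bullet> w\<bar> \<le> norm u * norm w" by (rule Cauchy_Schwarz_ineq2)
      also have "\<dots> \<le> l * Bb" using that order_trans[OF norm_ge_zero that(1)] by (intro mult_mono) auto
      finally show "u \<bullet> w \<le> l * Bb" "- (u \<bullet> w) \<le> l * Bb" by linarith+
    qed
    have zb: "z \<bullet> bv p - z \<bullet> bv q \<le> 2 * (r * Bb)"
      using cs(1)[of z r "bv p"] cs(2)[of z r "bv q"] nz bv_bound[OF pK] bv_bound[OF qK] by simp
    have xb: "(p - x1) \<bullet> bv p + (q - x1) \<bullet> bv q \<le> R * Bb"
    proof -
      have "norm (p - x1) \<le> R/2" "norm (q - x1) \<le> R/2" using pS qS by (auto simp: dist_norm norm_minus_commute)
      from cs(1)[OF this(1) bv_bound[OF pK]] cs(1)[OF this(2) bv_bound[OF qK]] show ?thesis by simp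
    qed
    have "2 * (frechet_derivative v (at p) (bv p) - frechet_derivative v (at q) (bv q)) =
        M * P * (z \<bullet> bv p - z \<bullet> bv q) + 4 * K * ((p - x1) \<bullet> bv p + (q - x1) \<bullet> bv q)"
      unfolding gp gq by (simp add: algebra_simps)
    also have "\<dots> \<le> M * P * (2 * (r * Bb)) + 4 * K * (R * Bb)"
      using zb xb M(1) P1 K(1) by (intro add_mono mult_left_mono) auto
    also have "M * P * (2 * (r * Bb)) \<le> M * P * (\<kappa> / 4)"
      using rB M(1) P1 by (intro mult_left_mono) (auto simp: mult.commute mult.left_commute)
    finally have drift: "2 * (frechet_derivative v (at p) (bv p) - frechet_derivative v (at q) (bv q)) \<le> M * P * \<kappa> / 4 + 4 * K * (R * Bb)"
      by simp
    have "\<kappa> * ((\<Sum>i\<in>Basis. hess v p i) - (\<Sum>i\<in>Basis. hess v q i)) \<le> \<kappa> * (- (M * P) + 4 * K * n)"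
      using sum1 \<kappa> by (intro mult_left_mono) auto
    then have "- 2 * (frechet_derivative v (at p) (bv p) - frechet_derivative v (at q) (bv q))
       \<le> \<kappa> * (- (M * P) + 4 * K * n) + (M * P * \<kappa> / 4 + 4 * K * Cc)"
      using sum2 solD(4)[OF sol pK] solD(4)[OF sol qK] by (simp add: algebra_simps)
    with drift have "M * P * \<kappa> / 2 \<le> C1"
      unfolding C1_def by (simp add: algebra_simps)
    moreover have "M * \<kappa> / 2 \<le> M * P * \<kappa> / 2" using M(1) P1 \<kappa> by simp
    moreover have "C1 < M * \<kappa> / 2" using M(4) \<kappa> by (simp add: field_simps)
    ultimately show False by linarith
  qed
  then show thesis using that[of M K] M(1) K(1) by simp
qed

text \<open>Hopf's barrier. On the annulus between radii \<open>r\<close> and \<open>R/2\<close> the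
  Gaussian \<open>w\<close> is a strict subsolution once \<alpha> is large, so
  \<open>\<theta> * w - v\<close> has no positive interior maximum, and it is nonpositive on both
  boundary spheres. \<gamma> is the value of \<open>w\<close> at distance
  \<open>R/4\<close>.\<close>

lemma barrier:
  assumes "0 < r" "r < R/2"
  obtains \<gamma> where "\<gamma> > 0"
    "\<And>v x1 x \<theta>. sol v \<Longrightarrow> x1 \<in> cball y0 (R/2) \<Longrightarrow> \<theta> > 0 \<Longrightarrow> (\<And>y. y \<in> cball x1 r \<Longrightarrow> \<theta> \<le> v y) \<Longrightarrow>
      x \<in> cball x1 (R/4) \<Longrightarrow> \<theta> * \<gamma> \<le> v x"
proof -
  define n where "n = real DIM('e)"
  define C where "C = \<kappa> * n + Cc + R * Bb"
  have C: "C \<ge> 0" unfolding C_def n_def using \<kappa> Cc_nonneg R Bb_nonneg by simp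
  \<comment> \<open>Then \<open>\<alpha> * \<kappa> * r\<^sup>2 = C + 1\<close>. The squared
    gradient of the exponent, quadratic in \<alpha>, thus exceeds the terms linear in \<alpha> that
    \<open>C\<close> collects from the trace, the \<open>c k\<close> and the drift.\<close>
  define \<alpha> where "\<alpha> = (C + 1) / (\<kappa> * r\<^sup>2)"
  have \<alpha>: "\<alpha> > 0" using C \<kappa> assms by (simp add: \<alpha>_def)
  have \<alpha>r: "2 * \<alpha> * \<kappa> * s > C" if "s \<ge> r\<^sup>2" for s
  proof -
    have "C < \<alpha> * \<kappa> * r\<^sup>2" using \<kappa> assms by (simp add: \<alpha>_def)
    also have "\<dots> \<le> 2 * \<alpha> * \<kappa> * s" using that \<alpha> \<kappa> zero_le_power2[of r]
      by (intro mult_mono) (auto)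
    finally show ?thesis .
  qed
  define w where "w s = exp (- \<alpha> * s) - exp (- \<alpha> * (R/2)\<^sup>2)" for s
  define \<gamma> where "\<gamma> = w ((R/4)\<^sup>2)"
  have \<gamma>: "\<gamma> > 0" using \<alpha> R by (simp add: \<gamma>_def w_def power2_eq_square field_simps)
  have w_anti: "w t \<le> w s" if "s \<le> t" for s t using that \<alpha> by (simp add: w_def)
  have w_le1: "w s \<le> 1" if "s \<ge> 0" for s
  proof -
    have "exp (- \<alpha> * s) \<le> 1" using that \<alpha> by simp
    then show ?thesis unfolding w_def by (smt (verit) exp_ge_zero)
  qed
  have "\<theta> * \<gamma> \<le> v x"
    if sol: "sol v" and x1: "x1 \<in> cball y0 (R/2)" and \<theta>: "\<theta> > 0"
      and ge: "\<And>y. y \<in> cball x1 r \<Longrightarrow> \<theta> \<le> v y" and x: "x \<in> cball x1 (R/4)" for v x1 x \<theta>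
  proof (cases "x \<in> cball x1 r")
    case True
    have "\<theta> * \<gamma> \<le> \<theta> * 1" using w_le1[of "(R/4)\<^sup>2"] \<theta> by (intro mult_left_mono) (auto simp: \<gamma>_def)
    then show ?thesis using ge[OF True] by simp
  next
    case False
    note v = solD(1)[OF sol]
    let ?A = "cball x1 (R/2) - ball x1 r"
    have AK: "y \<in> cball y0 R" if "y \<in> ?A" for y using half_cball[OF x1] that by blast
    have AD: "y \<in> D" if "y \<in> ?A" for y using AK[OF that] D(2) by blast
    define F where "F y = \<theta> * w ((norm (y - x1))\<^sup>2) - v y" for y
    have xA: "x \<in> ?A" using False x R by auto
    have "continuous_on ?A F" unfolding F_def w_def
      by (intro continuous_intros continuous_on_subset[OF smooth_on_imp_continuous_on[OF v]]) (use AD in auto)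
    moreover have "compact ?A" by (intro compact_diff compact_cball open_ball)
    ultimately obtain y where y: "y \<in> ?A" "\<And>u. u \<in> ?A \<Longrightarrow> F u \<le> F y"
      using continuous_attains_sup[of ?A F] xA by blast
    define z where "z = y - x1"
    have "F y \<le> 0"
    proof (rule ccontr)
      assume neg: "\<not> F y \<le> 0"
      have v0: "0 \<le> v y" using solD(2)[OF sol AK[OF y(1)]] .
      \<comment> \<open>A positive maximum is off the boundary: on the inner sphere
        \<open>v \<ge> \<theta>\<close> while \<open>w \<le> 1\<close>, on the outer one
        \<open>w\<close> vanishes while \<open>v \<ge> 0\<close>.\<close>
      have nr: "norm z \<noteq> r"
      proof
        assume "norm z = r"
        then have "\<theta> \<le> v y" using ge[of y] by (simp add: z_def dist_norm norm_minus_commute)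
        moreover have "\<theta> * w ((norm z)\<^sup>2) \<le> \<theta> * 1" using w_le1 \<theta> by (intro mult_left_mono) auto
        ultimately show False using neg by (simp add: F_def z_def)
      qed
      have nR: "norm z \<noteq> R/2"
      proof
        assume "norm z = R/2"
        then have "w ((norm z)\<^sup>2) = 0" by (simp only: w_def diff_self)
        then show False using neg v0 by (simp add: F_def z_def)
      qed
      have zr: "r < norm z" "norm z < R/2"
        using y(1) nr nR by (auto simp: z_def dist_norm norm_minus_commute)
      define E where "E = exp (- \<alpha> * (norm z)\<^sup>2)"
      have E: "E > 0" by (simp add: E_def)
      have dir: "frechet_derivative v (at y) p = - 2 * \<alpha> * \<theta> * E * (z \<bullet> p)"
        "hess v y p \<ge> \<theta> * E * (4 * \<alpha>\<^sup>2 * (z \<bullet> p)\<^sup>2 - 2 * \<alpha> * (norm p)\<^sup>2)" for p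
      proof -
        let ?Y = "\<lambda>t. y + t *\<^sub>R p" and ?Z = "\<lambda>t::real. z + t *\<^sub>R p"
        let ?I = "ball x1 (R/2) - cball x1 r"
        have "open (?Y -` ?I)" by (intro open_vimage open_Diff continuous_intros) auto
        moreover have "0 \<in> ?Y -` ?I" using zr by (auto simp: z_def dist_norm norm_minus_commute)
        ultimately obtain d where d: "d > 0" "\<And>t. \<bar>t\<bar> < d \<Longrightarrow> t \<in> ?Y -` ?I"
          using open_real_zero by metis
        have IA: "?I \<subseteq> ?A" by auto
        define f where "f t = \<theta> * (exp (- \<alpha> * (norm (?Z t))\<^sup>2) - exp (- \<alpha> * (R/2)\<^sup>2)) - v (?Y t)" for t
        define f' where "f' t = \<theta> * (exp (- \<alpha> * (norm (?Z t))\<^sup>2) * (- \<alpha> * (2 * (?Z t \<bullet> p)))) - frechet_derivative v (at (?Y t)) p" for t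
        have fF: "f t = F (?Y t)" for t by (simp add: f_def F_def w_def z_def algebra_simps)
        have ex: "((\<lambda>t. exp (- \<alpha> * (norm (?Z t))\<^sup>2)) has_real_derivative exp (- \<alpha> * (norm (?Z t))\<^sup>2) * (- \<alpha> * (2 * (?Z t \<bullet> p)))) (at t)" for t
          by (intro DERIV_exp[THEN DERIV_chain2] DERIV_cmult norm2_line_derivative)
        have "(f has_real_derivative f' t) (at t)" if "\<bar>t\<bar> < d" for t
        proof -
          have "?Y t \<in> D" using d(2)[OF that] AD IA by blast
          from DERIV_diff[OF DERIV_cmult[OF DERIV_diff[OF ex DERIV_const]] line_derivative[OF v this]]
          show ?thesis unfolding f_def[abs_def] f'_def by simp
        qed
        moreover have "(f' has_real_derivative (\<theta> * (E * (4 * \<alpha>\<^sup>2 * (z \<bullet> p)\<^sup>2 - 2 * \<alpha> * (norm p)\<^sup>2)) - hess v y p)) (at 0)"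
        proof -
          have "((\<lambda>t. exp (- \<alpha> * (norm (?Z t))\<^sup>2) * (- \<alpha> * (2 * (?Z t \<bullet> p)))) has_real_derivative
            (E * (4 * \<alpha>\<^sup>2 * (z \<bullet> p)\<^sup>2 - 2 * \<alpha> * (norm p)\<^sup>2))) (at 0)"
            by (rule DERIV_cong[OF DERIV_mult[OF ex[of 0] DERIV_cmult[OF DERIV_cmult[OF inner_line_derivative]]]])
              (simp add: E_def power2_norm_eq_inner[of p] power2_eq_square[of "z \<bullet> p"] power2_eq_square[of \<alpha>] algebra_simps)
          then show ?thesis unfolding f'_def[abs_def]
            by (intro DERIV_diff DERIV_cmult line_second_derivative[OF v D(1) AD[OF y(1)]])
        qed
        moreover have "f t \<le> f 0" if "\<bar>t\<bar> < d" for t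
          using y(2)[of "?Y t"] d(2)[OF that] IA unfolding fF by auto
        ultimately have "f' 0 = 0" "\<theta> * (E * (4 * \<alpha>\<^sup>2 * (z \<bullet> p)\<^sup>2 - 2 * \<alpha> * (norm p)\<^sup>2)) - hess v y p \<le> 0"
          using second_derivative_test[OF d(1), of f f'] by blast+
        then show "frechet_derivative v (at y) p = - 2 * \<alpha> * \<theta> * E * (z \<bullet> p)"
          "hess v y p \<ge> \<theta> * E * (4 * \<alpha>\<^sup>2 * (z \<bullet> p)\<^sup>2 - 2 * \<alpha> * (norm p)\<^sup>2)"
          by (simp_all add: f'_def E_def algebra_simps)
      qed
      have yK: "y \<in> cball y0 R" using AK[OF y(1)] .
      have zi: "(\<Sum>i\<in>Basis. (z \<bullet> i)\<^sup>2) = (norm z)\<^sup>2" using sum_Basis_norm[of z] by (simp add: power2_eq_square)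
      have "(\<Sum>i\<in>Basis. \<theta> * E * (4 * \<alpha>\<^sup>2 * (z \<bullet> i)\<^sup>2 - 2 * \<alpha> * (norm i)\<^sup>2)) \<le> (\<Sum>i\<in>Basis. hess v y i)"
        by (intro sum_mono dir)
      also have "(\<Sum>i\<in>Basis. \<theta> * E * (4 * \<alpha>\<^sup>2 * (z \<bullet> i)\<^sup>2 - 2 * \<alpha> * (norm i)\<^sup>2)) = \<theta> * E * (4 * \<alpha>\<^sup>2 * (norm z)\<^sup>2 - 2 * \<alpha> * n)"
        unfolding zi[symmetric] by (simp add: sum_distrib_left[symmetric] sum_subtractf n_def)
      finally have s1: "\<theta> * E * (4 * \<alpha>\<^sup>2 * (norm z)\<^sup>2 - 2 * \<alpha> * n) \<le> (\<Sum>i\<in>Basis. hess v y i)" .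
      have "(\<Sum>k\<in>Basis. \<theta> * E * (- 2 * \<alpha> * (norm (c k y))\<^sup>2)) \<le> (\<Sum>k\<in>Basis. hess v y (c k y))"
      proof (intro sum_mono)
        fix k
        have "\<theta> * E * (- 2 * \<alpha> * (norm (c k y))\<^sup>2) \<le> \<theta> * E * (4 * \<alpha>\<^sup>2 * (z \<bullet> c k y)\<^sup>2 - 2 * \<alpha> * (norm (c k y))\<^sup>2)"
          using \<theta> E by (intro mult_left_mono) auto
        then show "\<theta> * E * (- 2 * \<alpha> * (norm (c k y))\<^sup>2) \<le> hess v y (c k y)" using dir(2)[of "c k y"] by linarith
      qed
      then have "\<theta> * E * (- 2 * \<alpha> * (\<Sum>k\<in>Basis. (norm (c k y))\<^sup>2)) \<le> (\<Sum>k\<in>Basis. hess v y (c k y))"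
        by (simp add: sum_distrib_left)
      moreover have "\<theta> * E * (- 2 * \<alpha> * Cc) \<le> \<theta> * E * (- 2 * \<alpha> * (\<Sum>k\<in>Basis. (norm (c k y))\<^sup>2))"
        using \<theta> E \<alpha> Cc[OF yK] by (intro mult_left_mono mult_left_mono_neg) auto
      ultimately have s2: "\<theta> * E * (- 2 * \<alpha> * Cc) \<le> (\<Sum>k\<in>Basis. hess v y (c k y))" by linarith
      have "\<bar>z \<bullet> bv y\<bar> \<le> norm z * norm (bv y)" by (rule Cauchy_Schwarz_ineq2)
      also have "\<dots> \<le> (R/2) * Bb" using zr bv_bound[OF yK] R by (intro mult_mono) auto
      finally have zb: "z \<bullet> bv y \<le> R * Bb / 2" by simp
      have s3: "- 2 * frechet_derivative v (at y) (bv y) \<le> \<theta> * E * (2 * \<alpha> * (R * Bb))"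
      proof -
        have "(4 * \<alpha> * \<theta> * E) * (z \<bullet> bv y) \<le> (4 * \<alpha> * \<theta> * E) * (R * Bb / 2)"
          using zb \<alpha> \<theta> E by (intro mult_left_mono) auto
        then show ?thesis unfolding dir(1) by (simp add: algebra_simps)
      qed
      have "\<kappa> * (\<theta> * E * (4 * \<alpha>\<^sup>2 * (norm z)\<^sup>2 - 2 * \<alpha> * n)) \<le> \<kappa> * (\<Sum>i\<in>Basis. hess v y i)"
        using s1 \<kappa> by (intro mult_left_mono) auto
      then have "\<kappa> * (\<theta> * E * (4 * \<alpha>\<^sup>2 * (norm z)\<^sup>2 - 2 * \<alpha> * n)) + \<theta> * E * (- 2 * \<alpha> * Cc) \<le> \<theta> * E * (2 * \<alpha> * (R * Bb))"
        using s2 s3 solD(4)[OF sol yK] by linarith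
      then have "(2 * \<theta> * E * \<alpha>) * (2 * \<alpha> * \<kappa> * (norm z)\<^sup>2) \<le> (2 * \<theta> * E * \<alpha>) * C"
        unfolding C_def by (simp add: algebra_simps power2_eq_square)
      then have "2 * \<alpha> * \<kappa> * (norm z)\<^sup>2 \<le> C" using \<theta> E \<alpha> by (simp add: mult_le_cancel_left)
      moreover have "(norm z)\<^sup>2 \<ge> r\<^sup>2" using zr assms by (intro power_mono) auto
      ultimately show False using \<alpha>r by fastforce
    qed
    then have "F x \<le> 0" using y(2)[OF xA] by simp
    then have "\<theta> * w ((norm (x - x1))\<^sup>2) \<le> v x" by (simp add: F_def)
    moreover have "\<gamma> \<le> w ((norm (x - x1))\<^sup>2)" unfolding \<gamma>_def
      using x R by (intro w_anti power_mono) (auto simp: dist_norm norm_minus_commute)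
    then have "\<theta> * \<gamma> \<le> \<theta> * w ((norm (x - x1))\<^sup>2)" using \<theta> by (intro mult_left_mono) auto
    ultimately show ?thesis by linarith
  qed
  then show thesis using that[of \<gamma>] \<gamma> by blast
qed

text \<open>A value above \<delta> at \<open>x'\<close> stays above \<open>\<delta> / 2\<close> on a
  ball whose radius depends only on the common modulus of continuity, and the barrier carries it to
  \<open>x\<close>. Points within \<open>R/8\<close> of the centre are within \<open>R/4\<close> of
  each other, the reach of the barrier.\<close>

lemma weak_harnack:
  assumes "\<delta> > 0"
  obtains \<epsilon> where "\<epsilon> > 0"
    "\<And>v x x'. sol v \<Longrightarrow> x \<in> ball y0 (R/8) \<Longrightarrow> x' \<in> ball y0 (R/8) \<Longrightarrow> v x \<le> \<epsilon> \<Longrightarrow> v x' \<le> \<delta>"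
proof -
  obtain M K where MK: "M \<ge> 0" "K \<ge> 0" "\<And>v x1 x. sol v \<Longrightarrow> x1 \<in> cball y0 (R/2) \<Longrightarrow> x \<in> cball x1 (R/2) \<Longrightarrow>
      v x1 - v x \<le> M * sqrt (norm (x - x1)) + K * (norm (x - x1))\<^sup>2"
    by (rule equicontinuous) blast
  have "((\<lambda>r. M * sqrt r + K * r\<^sup>2) \<longlongrightarrow> M * sqrt 0 + K * 0\<^sup>2) (at_right 0)"
    by (intro tendsto_intros)
  then have "\<forall>\<^sub>F r in at_right 0. M * sqrt r + K * r\<^sup>2 < \<delta> / 2"
    using assms by (intro order_tendstoD(2)) auto
  moreover have "\<forall>\<^sub>F r in at_right 0. 0 < r \<and> r < R/2"
    using R unfolding eventually_at_right_field by (intro exI[of _ "R/2"]) auto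
  ultimately have "\<forall>\<^sub>F r in at_right 0. M * sqrt r + K * r\<^sup>2 < \<delta> / 2 \<and> 0 < r \<and> r < R/2"
    by (rule eventually_conj)
  then have "\<exists>r. M * sqrt r + K * r\<^sup>2 < \<delta> / 2 \<and> 0 < r \<and> r < R/2"
    by (rule eventually_happens'[OF trivial_limit_at_right_real])
  then obtain r where r: "M * sqrt r + K * r\<^sup>2 < \<delta> / 2" "0 < r" "r < R/2"
    by blast
  obtain \<gamma> where \<gamma>: "\<gamma> > 0" "\<And>v x1 x \<theta>. sol v \<Longrightarrow> x1 \<in> cball y0 (R/2) \<Longrightarrow> \<theta> > 0 \<Longrightarrow>
      (\<And>y. y \<in> cball x1 r \<Longrightarrow> \<theta> \<le> v y) \<Longrightarrow> x \<in> cball x1 (R/4) \<Longrightarrow> \<theta> * \<gamma> \<le> v x"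
    using barrier[OF r(2,3)] by metis
  have "v x' \<le> \<delta>" if sol: "sol v" and x: "x \<in> ball y0 (R/8)" and x': "x' \<in> ball y0 (R/8)" and le: "v x \<le> \<delta> / 4 * \<gamma>" for v x x'
  proof (rule ccontr)
    assume gt: "\<not> v x' \<le> \<delta>"
    have x1: "x' \<in> cball y0 (R/2)" using x' R by auto
    have "\<delta> / 2 \<le> v y" if y: "y \<in> cball x' r" for y
    proof -
      have n: "norm (y - x') \<le> r" using y by (simp add: dist_norm norm_minus_commute)
      have "M * sqrt (norm (y - x')) + K * (norm (y - x'))\<^sup>2 \<le> M * sqrt r + K * r\<^sup>2"
        using n MK(1,2) by (intro add_mono mult_left_mono power_mono) auto
      then show ?thesis using MK(3)[OF sol x1, of y] n r gt by (simp add: dist_norm norm_minus_commute)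
    qed
    moreover have "x \<in> cball x' (R/4)" using dist_triangle2[of x' x y0] x x' by (auto simp: dist_commute)
    ultimately have "\<delta> / 2 * \<gamma> \<le> v x" using assms by (intro \<gamma>(2)[OF sol x1]) auto
    moreover have "\<delta> / 4 * \<gamma> < \<delta> / 2 * \<gamma>" using \<gamma>(1) assms by simp
    ultimately show False using le by linarith
  qed
  then show thesis using that[of "\<delta> / 4 * \<gamma>"] \<gamma>(1) assms by simp
qed

end

text \<open>Compactness of the ball supplies the decomposition and the bounds \<open>Bb\<close> and
  \<open>Cc\<close>. What matters later is that \<epsilon> is fixed before the solution.\<close>

lemma local_weak_harnack:
  fixes a :: "'e::euclidean_space \<Rightarrow> 'e \<Rightarrow> 'e \<Rightarrow> real"
  assumes "open D" "cball y0 R \<subseteq> D" "R > 0"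
    and a: "\<And>i j. i \<in> Basis \<Longrightarrow> j \<in> Basis \<Longrightarrow> continuous_on D (a i j)"
    and b: "\<And>k. k \<in> Basis \<Longrightarrow> continuous_on D (b k)"
    and sym: "\<And>x i j. x \<in> D \<Longrightarrow> i \<in> Basis \<Longrightarrow> j \<in> Basis \<Longrightarrow> a i j x = a j i x"
    and pos: "\<And>x \<xi>. x \<in> D \<Longrightarrow> \<xi> \<noteq> 0 \<Longrightarrow> (\<Sum>i\<in>Basis. \<Sum>j\<in>Basis. a i j x * (\<xi> \<bullet> i) * (\<xi> \<bullet> j)) > 0"
    and "\<delta> > 0"
  obtains \<epsilon> where "\<epsilon> > 0"
    "\<And>v x x'. smooth_on D v \<Longrightarrow> (\<And>y. y \<in> D \<Longrightarrow> ell a b v y = 0 \<and> 0 \<le> v y \<and> v y \<le> 1) \<Longrightarrow>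
      x \<in> ball y0 (R/8) \<Longrightarrow> x' \<in> ball y0 (R/8) \<Longrightarrow> v x \<le> \<epsilon> \<Longrightarrow> v x' \<le> \<delta>"
proof -
  note sub = subsetD[OF assms(2)]
  obtain \<kappa> and c :: "'e \<Rightarrow> 'e \<Rightarrow> 'e" where \<kappa>: "\<kappa> > 0" and c: "\<And>k. k \<in> Basis \<Longrightarrow> continuous_on (cball y0 R) (c k)"
    "\<And>x i j. x \<in> cball y0 R \<Longrightarrow> i \<in> Basis \<Longrightarrow> j \<in> Basis \<Longrightarrow>
       a i j x = (if i = j then \<kappa> else 0) + (\<Sum>k\<in>Basis. (c k x \<bullet> i) * (c k x \<bullet> j))"
  proof (rule elliptic_decomposition[OF compact_cball[of y0 R] continuous_on_subset[OF a assms(2)] sym[OF sub] pos[OF sub]])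
    fix \<kappa> :: real and c :: "'e \<Rightarrow> 'e \<Rightarrow> 'e"
    assume A: "\<kappa> > 0" "\<And>k. k \<in> Basis \<Longrightarrow> continuous_on (cball y0 R) (c k)"
      "\<And>x i j. x \<in> cball y0 R \<Longrightarrow> i \<in> Basis \<Longrightarrow> j \<in> Basis \<Longrightarrow>
         a i j x = (if i = j then \<kappa> else 0) + (\<Sum>k\<in>Basis. (c k x \<bullet> i) * (c k x \<bullet> j))"
    show thesis by (rule that[OF A])
  qed
  have bdd: "\<exists>C. \<forall>x\<in>cball y0 R. norm (f x) \<le> C" if "continuous_on (cball y0 R) f" for f :: "'e \<Rightarrow> 'x::real_normed_vector"
    using compact_imp_bounded[OF compact_continuous_image[OF that compact_cball]] unfolding bounded_iff by auto
  have "continuous_on (cball y0 R) (\<lambda>x. \<Sum>k\<in>Basis. b k x *\<^sub>R k)"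
    by (intro continuous_intros continuous_on_subset[OF b assms(2)])
  from bdd[OF this] obtain Bb where Bb: "\<And>x. x \<in> cball y0 R \<Longrightarrow> norm (\<Sum>k\<in>Basis. b k x *\<^sub>R k) \<le> Bb" by blast
  have "continuous_on (cball y0 R) (\<lambda>x. \<Sum>k\<in>Basis. (norm (c k x))\<^sup>2)"
    by (intro continuous_intros c)
  from bdd[OF this] obtain Cc where "\<And>x. x \<in> cball y0 R \<Longrightarrow> norm (\<Sum>k\<in>Basis. (norm (c k x))\<^sup>2) \<le> Cc"
    by blast
  then have Cc: "\<And>x. x \<in> cball y0 R \<Longrightarrow> (\<Sum>k\<in>Basis. (norm (c k x))\<^sup>2) \<le> Cc"
    by (fastforce simp: abs_le_iff)
  interpret elliptic_ball D y0 R a b \<kappa> c Bb Cc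
    by unfold_locales (use assms \<kappa> c Bb Cc in auto)
  show thesis
  proof (rule weak_harnack[OF assms(8)])
    fix \<epsilon> :: real
    assume \<epsilon>: "\<epsilon> > 0" "\<And>v x x'. sol v \<Longrightarrow> x \<in> ball y0 (R/8) \<Longrightarrow> x' \<in> ball y0 (R/8) \<Longrightarrow> v x \<le> \<epsilon> \<Longrightarrow> v x' \<le> \<delta>"
    show thesis
    proof (rule that[OF \<epsilon>(1)])
      fix v x x' assume v: "smooth_on D v" "\<And>y. y \<in> D \<Longrightarrow> ell a b v y = 0 \<and> 0 \<le> v y \<and> v y \<le> 1"
        and x: "x \<in> ball y0 (R/8)" "x' \<in> ball y0 (R/8)" "v x \<le> \<epsilon>"
      have "sol v" unfolding sol_def using v(1) v(2)[OF sub] by blast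
      then show "v x' \<le> \<delta>" using \<epsilon>(2) x by blast
    qed
  qed
qed

section \<open>Charts and sections of the covering\<close>

lemma frechet_derivative_cong_open:
  assumes "open S" "x \<in> S" "\<And>y. y \<in> S \<Longrightarrow> F y = G y"
  shows "frechet_derivative F (at x) = frechet_derivative G (at x)"
proof -
  have "(F has_derivative D) (at x) \<longleftrightarrow> (G has_derivative D) (at x)" for D
    using has_derivative_transform_within_open[of F D x UNIV S G] has_derivative_transform_within_open[of G D x UNIV S F] assms
    by auto
  then show ?thesis by (simp add: frechet_derivative_def)
qed

lemma partial_cong_open:
  assumes "open S" "x \<in> S" "\<And>y. y \<in> S \<Longrightarrow> F y = G y"
  shows "partial i F x = partial i G x"
  unfolding partial_def using frechet_derivative_cong_open[OF assms] by simp

lemma ell_cong_open: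
  assumes "open S" "y \<in> S" "\<And>z. z \<in> S \<Longrightarrow> F z = G z"
  shows "ell a b F y = ell a b G y"
proof -
  have "partial j F z = partial j G z" if "z \<in> S" for j z
    using partial_cong_open[OF assms(1) that] assms(3) by blast
  then have "partial i (partial j F) y = partial i (partial j G) y" for i j
    using partial_cong_open[OF assms(1,2)] by blast
  moreover have "partial k F y = partial k G y" for k
    using partial_cong_open[OF assms(1,2)] assms(3) by blast
  ultimately show ?thesis by (simp add: ell_def)
qed

text \<open>The additive constant is included because solutions are repeatedly rescaled into [0, 1]
  by affine maps.\<close>

lemma ell_lincomb:
  assumes "open D" "smooth_on D F" "smooth_on D G" "y \<in> D"
  shows "ell a b (\<lambda>z. \<alpha> * F z + \<beta> * G z + \<gamma>) y = \<alpha> * ell a b F y + \<beta> * ell a b G y"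
proof -
  have 1: "partial i (\<lambda>z. \<alpha> * F z + \<beta> * G z + \<gamma>) z = \<alpha> * partial i F z + \<beta> * partial i G z"
    if sm: "smooth_on D F" "smooth_on D G" and z: "z \<in> D" for F G :: "'a \<Rightarrow> real" and \<gamma> i z
  proof -
    have "((\<lambda>z. \<alpha> * F z + \<beta> * G z + \<gamma>) has_derivative
        (\<lambda>v. \<alpha> * frechet_derivative F (at z) v + \<beta> * frechet_derivative G (at z) v + 0)) (at z)"
      using smooth_on_has_derivative[OF sm(1) z] smooth_on_has_derivative[OF sm(2) z]
      by (intro has_derivative_add has_derivative_mult_right has_derivative_const)
    then show ?thesis unfolding partial_def by (simp add: frechet_derivative_at[symmetric])
  qed
  have 2: "partial i (partial j (\<lambda>z. \<alpha> * F z + \<beta> * G z + \<gamma>)) y = \<alpha> * partial i (partial j F) y + \<beta> * partial i (partial j G) y" for i j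
  proof -
    have "partial i (partial j (\<lambda>z. \<alpha> * F z + \<beta> * G z + \<gamma>)) y = partial i (\<lambda>z. \<alpha> * partial j F z + \<beta> * partial j G z + 0) y"
      by (rule partial_cong_open[OF assms(1,4)]) (simp add: 1[OF assms(2,3)])
    then show ?thesis
      using 1[OF smooth_on_partial[OF assms(2)] smooth_on_partial[OF assms(3)] assms(4), where \<gamma> = 0] by simp
  qed
  show ?thesis unfolding ell_def 1[OF assms(2-4)] 2
    by (simp add: algebra_simps sum.distrib sum_distrib_left)
qed

section \<open>Charts, extension by zero and cutoffs\<close>

lemma chart_inv:
  assumes "is_chart (U, \<phi>)"
  shows "open U" "open (\<phi> ` U)" "continuous_on U \<phi>" "continuous_on (\<phi> ` U) (inv_into U \<phi>)"
    "inj_on \<phi> U" "\<And>p. p \<in> U \<Longrightarrow> inv_into U \<phi> (\<phi> p) = p"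
    "\<And>y. y \<in> \<phi> ` U \<Longrightarrow> inv_into U \<phi> y \<in> U" "\<And>y. y \<in> \<phi> ` U \<Longrightarrow> \<phi> (inv_into U \<phi> y) = y"
proof -
  obtain \<psi> where h: "open U" "open (\<phi> ` U)" "homeomorphism U (\<phi> ` U) \<phi> \<psi>"
    using assms by (auto simp: is_chart_def)
  then show "open U" "open (\<phi> ` U)" "continuous_on U \<phi>" by (auto simp: homeomorphism_def)
  show inj: "inj_on \<phi> U" using h(3) by (metis homeomorphism_def inj_on_inverseI)
  have "inv_into U \<phi> y = \<psi> y" if "y \<in> \<phi> ` U" for y
    using that inj h(3) by (auto simp: homeomorphism_def)
  then show "continuous_on (\<phi> ` U) (inv_into U \<phi>)" using h(3) by (simp add: homeomorphism_def)
  show "\<And>p. p \<in> U \<Longrightarrow> inv_into U \<phi> (\<phi> p) = p" using inj by simp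
  show "\<And>y. y \<in> \<phi> ` U \<Longrightarrow> inv_into U \<phi> y \<in> U" by (rule inv_into_into)
  show "\<And>y. y \<in> \<phi> ` U \<Longrightarrow> \<phi> (inv_into U \<phi> y) = y" by (rule f_inv_into_f)
qed

lemma chart_image_open:
  assumes c: "is_chart (U, \<phi>)" and "open T" "T \<subseteq> U"
  shows "open (\<phi> ` T)"
proof -
  have "\<phi> ` T = \<phi> ` U \<inter> inv_into U \<phi> -` T"
    using assms(3) chart_inv(6-8)[OF c] by force
  moreover have "open (\<phi> ` U \<inter> inv_into U \<phi> -` T)"
    using continuous_open_preimage[OF chart_inv(4)[OF c] chart_inv(2)[OF c] assms(2)] by simp
  ultimately show ?thesis by simp
qed

lemma chart_vimage_open:
  assumes c: "is_chart (U, \<phi>)" and "open S"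
  shows "open (U \<inter> \<phi> -` S)"
  using continuous_open_preimage[OF chart_inv(3)[OF c] chart_inv(1)[OF c] assms(2)] by simp

lemma atlas_chart:
  assumes "smooth_atlas B" shows "(U, \<phi>) \<in> B \<Longrightarrow> is_chart (U, \<phi>)"
    and "\<exists>U \<phi>. (U, \<phi>) \<in> B \<and> p \<in> U"
    and "(U, \<phi>) \<in> B \<Longrightarrow> (V, \<psi>) \<in> B \<Longrightarrow> smooth_on (\<phi> ` (U \<inter> V)) (\<psi> \<circ> inv_into U \<phi>)"
proof -
  show "(U, \<phi>) \<in> B \<Longrightarrow> is_chart (U, \<phi>)" using assms by (auto simp: smooth_atlas_def)
  have "p \<in> (\<Union>(U, \<phi>)\<in>B. U)" using assms by (simp add: smooth_atlas_def)
  then show "\<exists>U \<phi>. (U, \<phi>) \<in> B \<and> p \<in> U" by auto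
  show "(U, \<phi>) \<in> B \<Longrightarrow> (V, \<psi>) \<in> B \<Longrightarrow> smooth_on (\<phi> ` (U \<inter> V)) (\<psi> \<circ> inv_into U \<phi>)"
    using assms unfolding smooth_atlas_def by blast
qed

lemma smooth_funD: "smooth_fun B f \<Longrightarrow> (U, \<phi>) \<in> B \<Longrightarrow> smooth_on (\<phi> ` U) (f \<circ> inv_into U \<phi>)"
  unfolding smooth_fun_def by blast

text \<open>The transition maps carry smoothness from one chart around a point to every other chart
  there.\<close>

lemma smooth_fun_localI:
  assumes B: "smooth_atlas B"
    and loc: "\<And>p. \<exists>U \<phi> S. (U, \<phi>) \<in> B \<and> p \<in> U \<and> open S \<and> \<phi> p \<in> S \<and> S \<subseteq> \<phi> ` U \<and> smooth_on S (f \<circ> inv_into U \<phi>)"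
  shows "smooth_fun B f"
proof -
  have "smooth_on (\<psi> ` V) (f \<circ> inv_into V \<psi>)" if V: "(V, \<psi>) \<in> B" for V \<psi>
  proof (rule smooth_on_local)
    fix y assume y: "y \<in> \<psi> ` V"
    note cV = atlas_chart(1)[OF B V]
    define q where "q = inv_into V \<psi> y"
    have q: "q \<in> V" "\<psi> q = y" using chart_inv(7,8)[OF cV y] by (auto simp: q_def)
    obtain U \<phi> S where U: "(U, \<phi>) \<in> B" "q \<in> U" "open S" "\<phi> q \<in> S" "S \<subseteq> \<phi> ` U" "smooth_on S (f \<circ> inv_into U \<phi>)"
      using loc by blast
    note cU = atlas_chart(1)[OF B U(1)]
    let ?T = "\<psi> ` (V \<inter> (U \<inter> \<phi> -` S))"
    have T: "open ?T" by (intro chart_image_open[OF cV] open_Int chart_inv(1)[OF cV] chart_vimage_open[OF cU U(3)]) auto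
    have "smooth_on ?T (\<lambda>z. (f \<circ> inv_into U \<phi>) ((\<phi> \<circ> inv_into V \<psi>) z))"
    proof (rule smooth_on_compose[OF T U(3) _ U(6)])
      show "smooth_on ?T (\<phi> \<circ> inv_into V \<psi>)"
        by (rule smooth_on_subset[OF atlas_chart(3)[OF B V U(1)]]) auto
      show "(\<phi> \<circ> inv_into V \<psi>) ` ?T \<subseteq> S" using chart_inv(6)[OF cV] by auto
    qed
    then have "smooth_on ?T (f \<circ> inv_into V \<psi>)"
      by (rule smooth_on_cong[OF _ _ T]) (use chart_inv(6)[OF cV] chart_inv(6)[OF cU] in auto)
    moreover have "y \<in> ?T" using q U by auto
    ultimately show "\<exists>T. open T \<and> y \<in> T \<and> smooth_on T (f \<circ> inv_into V \<psi>)" using T by blast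
  qed
  then show ?thesis unfolding smooth_fun_def by blast
qed

definition chart_ext :: "'m set \<Rightarrow> ('m \<Rightarrow> 'e) \<Rightarrow> 'e set \<Rightarrow> ('e \<Rightarrow> real) \<Rightarrow> 'm \<Rightarrow> real" where
  "chart_ext U \<phi> D G q = (if q \<in> U \<and> \<phi> q \<in> D then G (\<phi> q) else 0)"

text \<open>In a Hausdorff space the compact set carrying the function is closed, so its complement
  and the chart domain are open sets on which the extension is respectively zero and a smooth
  function of the coordinates; together they cover the manifold.\<close>

lemma chart_ext_test_fun:
  assumes B: "smooth_atlas B" and U: "(U, \<phi>) \<in> B" and D: "open D" "D \<subseteq> \<phi> ` U"
    and G: "smooth_on D G" and K: "compact K" "K \<subseteq> D" "\<And>y. y \<in> D \<Longrightarrow> y \<notin> K \<Longrightarrow> G y = 0"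
  shows "test_fun B (chart_ext U \<phi> D G)"
    and "\<And>y. y \<in> D \<Longrightarrow> chart_ext U \<phi> D G (inv_into U \<phi> y) = G y"
    and "closed (inv_into U \<phi> ` K)"
    and "\<And>q. q \<notin> inv_into U \<phi> ` K \<Longrightarrow> chart_ext U \<phi> D G q = 0"
proof -
  note c = atlas_chart(1)[OF B U]
  let ?g = "chart_ext U \<phi> D G"
  have "compact (inv_into U \<phi> ` K)"
    using continuous_on_subset[OF chart_inv(4)[OF c]] K D by (intro compact_continuous_image) auto
  then show cl: "closed (inv_into U \<phi> ` K)" by (rule compact_imp_closed)
  show eq: "?g (inv_into U \<phi> y) = G y" if "y \<in> D" for y
    using that D chart_inv(7,8)[OF c, of y] by (auto simp: chart_ext_def)
  show zero: "?g q = 0" if "q \<notin> inv_into U \<phi> ` K" for q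
  proof (cases "q \<in> U \<and> \<phi> q \<in> D")
    case True
    then have "\<phi> q \<notin> K" using that chart_inv(6)[OF c, of q] by (metis imageI)
    then show ?thesis using True K(3) by (simp add: chart_ext_def)
  qed (auto simp: chart_ext_def)
  have "smooth_fun B ?g"
  proof (rule smooth_fun_localI[OF B])
    fix p
    show "\<exists>U \<phi> S. (U, \<phi>) \<in> B \<and> p \<in> U \<and> open S \<and> \<phi> p \<in> S \<and> S \<subseteq> \<phi> ` U \<and> smooth_on S (?g \<circ> inv_into U \<phi>)"
    proof (cases "p \<in> U \<and> \<phi> p \<in> D")
      case True
      have "smooth_on D (?g \<circ> inv_into U \<phi>)"
        by (rule smooth_on_cong[OF G _ D(1)]) (simp add: eq)
      then show ?thesis using True U D by blast
    next
      case False
      then have p: "p \<notin> inv_into U \<phi> ` K" using K(2) D(2) chart_inv(7,8)[OF c] by (auto simp: subset_iff)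
      obtain V \<psi> where V: "(V, \<psi>) \<in> B" "p \<in> V" using atlas_chart(2)[OF B] by blast
      note cV = atlas_chart(1)[OF B V(1)]
      let ?S = "\<psi> ` (V \<inter> - (inv_into U \<phi> ` K))"
      have S: "open ?S" by (rule chart_image_open[OF cV]) (use cl chart_inv(1)[OF cV] in auto)
      have "smooth_on ?S (?g \<circ> inv_into V \<psi>)"
        by (rule smooth_on_cong[OF smooth_on_const[OF S, of 0] _ S]) (use zero chart_inv(6)[OF cV] in auto)
      moreover have "\<psi> p \<in> ?S" using p V by auto
      ultimately show ?thesis using V S by blast
    qed
  qed
  moreover have "closure {q. ?g q \<noteq> 0} \<subseteq> inv_into U \<phi> ` K"
    using zero by (intro closure_minimal[OF _ cl]) blast
  then have "compact (closure {q. ?g q \<noteq> 0})"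
    using \<open>compact (inv_into U \<phi> ` K)\<close> closed_closure compact_Int_closed by (metis inf.absorb2)
  ultimately show "test_fun B ?g" by (simp add: test_fun_def)
qed

text \<open>The reverse of the usual cutoff: zero on the inner ball and at least 1 outside the outer
  one. It serves as a penalty to be subtracted.\<close>

definition bump :: "real \<Rightarrow> real \<Rightarrow> 'e::euclidean_space \<Rightarrow> 'e \<Rightarrow> real" where
  "bump r s c y = flat 0 ((norm (y - c))\<^sup>2 - r\<^sup>2) / flat 0 (s\<^sup>2 - r\<^sup>2)"

lemma bump:
  assumes "0 < r" "r < s"
  shows "smooth_on UNIV (bump r s c)" "\<And>y. norm (y - c) \<le> r \<Longrightarrow> bump r s c y = 0"
    "\<And>y. norm (y - c) \<ge> s \<Longrightarrow> bump r s c y \<ge> 1" "\<And>y. bump r s c y \<ge> 0"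
proof -
  have sr: "s\<^sup>2 - r\<^sup>2 > 0" using assms by (simp add: power_strict_mono)
  have "smooth_on UNIV (\<lambda>y. flat 0 ((norm (y - c))\<^sup>2 - r\<^sup>2))"
    by (rule smooth_on_compose[OF open_UNIV open_UNIV _ flat_smooth])
      (auto intro!: smooth_on_diff smooth_on_norm2 smooth_on_const)
  from smooth_on_cmult[OF open_UNIV this, of "1 / flat 0 (s\<^sup>2 - r\<^sup>2)"]
  show "smooth_on UNIV (bump r s c)" by (simp add: bump_def[abs_def])
  show "bump r s c y = 0" if "norm (y - c) \<le> r" for y
    using that by (simp add: bump_def flat_zero power_mono)
  show "bump r s c y \<ge> 1" if "norm (y - c) \<ge> s" for y
  proof -
    have "flat 0 (s\<^sup>2 - r\<^sup>2) \<le> flat 0 ((norm (y - c))\<^sup>2 - r\<^sup>2)"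
      using that assms by (intro flat_mono) (simp add: power_mono)
    then show ?thesis using flat_pos[OF sr, of 0] by (simp add: bump_def)
  qed
  show "bump r s c y \<ge> 0" for y using flat_nonneg by (simp add: bump_def)
qed

lemma elliptic_operator_chart:
  fixes B :: "('m::topological_space, 'e::euclidean_space) chart set"
  assumes "elliptic_diffusion_operator B L" "(U, \<phi>) \<in> B"
  obtains a :: "'e \<Rightarrow> 'e \<Rightarrow> 'e \<Rightarrow> real" and b :: "'e \<Rightarrow> 'e \<Rightarrow> real" where "\<And>i j. i \<in> Basis \<Longrightarrow> j \<in> Basis \<Longrightarrow> smooth_on (\<phi> ` U) (a i j)"
    "\<And>k. k \<in> Basis \<Longrightarrow> smooth_on (\<phi> ` U) (b k)"
    "\<And>y i j. y \<in> \<phi> ` U \<Longrightarrow> i \<in> Basis \<Longrightarrow> j \<in> Basis \<Longrightarrow> a i j y = a j i y"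
    "\<And>y \<xi>. y \<in> \<phi> ` U \<Longrightarrow> \<xi> \<noteq> 0 \<Longrightarrow> (\<Sum>i\<in>Basis. \<Sum>j\<in>Basis. a i j y * (\<xi> \<bullet> i) * (\<xi> \<bullet> j)) > 0"
    "\<And>f p. smooth_fun B f \<Longrightarrow> p \<in> U \<Longrightarrow> L f p = ell a b (f \<circ> inv_into U \<phi>) (\<phi> p)"
proof -
  have "\<exists>(a :: 'e \<Rightarrow> 'e \<Rightarrow> 'e \<Rightarrow> real) (b :: 'e \<Rightarrow> 'e \<Rightarrow> real). (\<forall>i\<in>Basis. \<forall>j\<in>Basis. smooth_on (\<phi> ` U) (a i j)) \<and>
        (\<forall>k\<in>Basis. smooth_on (\<phi> ` U) (b k)) \<and>
        (\<forall>y\<in>\<phi> ` U. \<forall>i\<in>Basis. \<forall>j\<in>Basis. a i j y = a j i y) \<and>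
        (\<forall>y\<in>\<phi> ` U. \<forall>\<xi>. \<xi> \<noteq> 0 \<longrightarrow> (\<Sum>i\<in>Basis. \<Sum>j\<in>Basis. a i j y * (\<xi> \<bullet> i) * (\<xi> \<bullet> j)) > 0) \<and>
        (\<forall>f. smooth_fun B f \<longrightarrow> (\<forall>x\<in>U. L f x = ell a b (f \<circ> inv_into U \<phi>) (\<phi> x)))"
    using bspec[OF assms(1)[unfolded elliptic_diffusion_operator_def] assms(2)] unfolding ell_def
    by (simp only: prod.case)
  then obtain a :: "'e \<Rightarrow> 'e \<Rightarrow> 'e \<Rightarrow> real" and b :: "'e \<Rightarrow> 'e \<Rightarrow> real" where ab:
      "\<forall>i\<in>Basis. \<forall>j\<in>Basis. smooth_on (\<phi> ` U) (a i j)" "\<forall>k\<in>Basis. smooth_on (\<phi> ` U) (b k)"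
      "\<forall>y\<in>\<phi> ` U. \<forall>i\<in>Basis. \<forall>j\<in>Basis. a i j y = a j i y"
      "\<forall>y\<in>\<phi> ` U. \<forall>\<xi>. \<xi> \<noteq> 0 \<longrightarrow> (\<Sum>i\<in>Basis. \<Sum>j\<in>Basis. a i j y * (\<xi> \<bullet> i) * (\<xi> \<bullet> j)) > 0"
      "\<forall>f. smooth_fun B f \<longrightarrow> (\<forall>x\<in>U. L f x = ell a b (f \<circ> inv_into U \<phi>) (\<phi> x))"
    by (elim exE conjE)
  show thesis
    by (rule that[of a b, OF ab[rule_format]])
qed

lemma elliptic_operator_local:
  assumes B: "smooth_atlas B" and L: "elliptic_diffusion_operator B L" and f: "smooth_fun B f" and g: "smooth_fun B g"
    and W: "open W" "p \<in> W" "\<And>q. q \<in> W \<Longrightarrow> f q = g q"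
  shows "L f p = L g p"
proof -
  obtain U \<phi> where U: "(U, \<phi>) \<in> B" "p \<in> U" using atlas_chart(2)[OF B] by blast
  note c = atlas_chart(1)[OF B U(1)]
  show ?thesis
  proof (rule elliptic_operator_chart[OF L U(1)])
    fix a b assume ab: "\<And>f p. smooth_fun B f \<Longrightarrow> p \<in> U \<Longrightarrow> L f p = ell a b (f \<circ> inv_into U \<phi>) (\<phi> p)"
    have "ell a b (f \<circ> inv_into U \<phi>) (\<phi> p) = ell a b (g \<circ> inv_into U \<phi>) (\<phi> p)"
    proof (rule ell_cong_open)
      show "open (\<phi> ` (U \<inter> W))" by (rule chart_image_open[OF c]) (use chart_inv(1)[OF c] W in auto)
      show "\<phi> p \<in> \<phi> ` (U \<inter> W)" using U W by auto
    qed (use W(3) chart_inv(6)[OF c] in auto)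
    then show ?thesis using ab[OF f U(2)] ab[OF g U(2)] by simp
  qed
qed

lemma elliptic_operator_continuous:
  assumes B: "smooth_atlas B" and L: "elliptic_diffusion_operator B L" and f: "smooth_fun B f"
  shows "continuous_on UNIV (L f)"
proof (rule continuous_at_imp_continuous_on, rule ballI)
  fix p :: 'a
  obtain U \<phi> where U: "(U, \<phi>) \<in> B" "p \<in> U" using atlas_chart(2)[OF B] by blast
  note c = atlas_chart(1)[OF B U(1)]
  show "isCont (L f) p"
  proof (rule elliptic_operator_chart[OF L U(1)])
    fix a b assume ab: "\<And>i j. i \<in> Basis \<Longrightarrow> j \<in> Basis \<Longrightarrow> smooth_on (\<phi> ` U) (a i j)"
      "\<And>k. k \<in> Basis \<Longrightarrow> smooth_on (\<phi> ` U) (b k)"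
      "\<And>f p. smooth_fun B f \<Longrightarrow> p \<in> U \<Longrightarrow> L f p = ell a b (f \<circ> inv_into U \<phi>) (\<phi> p)"
    have "continuous_on (\<phi> ` U) (ell a b (f \<circ> inv_into U \<phi>))"
      unfolding ell_def[abs_def]
      by (intro continuous_intros smooth_on_imp_continuous_on smooth_on_partial smooth_funD[OF f U(1)] ab)
    then have "continuous_on U (\<lambda>p. ell a b (f \<circ> inv_into U \<phi>) (\<phi> p))"
      by (rule continuous_on_compose2[OF _ chart_inv(3)[OF c]]) auto
    then have "continuous_on U (L f)"
      by (rule continuous_on_eq) (simp add: ab(3)[OF f])
    then show "isCont (L f) p" using chart_inv(1)[OF c] U(2) continuous_on_eq_continuous_at by blast
  qed
qed

section \<open>The covering in lifted coordinates\<close>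

locale normal_cover =
  fixes A :: "('m::{t2_space,second_countable_topology}, 'e::euclidean_space) chart set"
    and B :: "('n::{t2_space,second_countable_topology}, 'e) chart set"
    and \<pi> :: "'m \<Rightarrow> 'n"
    and L\<^sub>0 :: "('n \<Rightarrow> real) \<Rightarrow> 'n \<Rightarrow> real"
  assumes A: "smooth_atlas A" and B: "smooth_atlas B"
    and cover: "normal_covering A B \<pi>" and L0: "elliptic_diffusion_operator B L\<^sub>0"
begin

abbreviation "L \<equiv> pullback_operator B \<pi> L\<^sub>0"

text \<open>A chart of the base around \<open>\<pi> x\<close> and a lift \<sigma> of it through
  \<open>x\<close>. The coefficients \<open>a\<close> and \<open>b\<close> are those of the base
  operator, so functions on the cover, in particular all translates of a given one, satisfy
  equations with the same coefficients in these coordinates.\<close>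

definition section_chart where
  "section_chart x U \<phi> D R \<sigma> a b \<longleftrightarrow>
    (U, \<phi>) \<in> B \<and> \<pi> x \<in> U \<and> open D \<and> D \<subseteq> \<phi> ` U \<and> cball (\<phi> (\<pi> x)) R \<subseteq> D \<and> R > 0 \<and>
    (\<forall>i\<in>Basis. \<forall>j\<in>Basis. smooth_on D (a i j)) \<and> (\<forall>k\<in>Basis. smooth_on D (b k)) \<and>
    (\<forall>y\<in>D. \<forall>i\<in>Basis. \<forall>j\<in>Basis. a i j y = a j i y) \<and>
    (\<forall>y\<in>D. \<forall>\<xi>. \<xi> \<noteq> 0 \<longrightarrow> (\<Sum>i\<in>Basis. \<Sum>j\<in>Basis. a i j y * (\<xi> \<bullet> i) * (\<xi> \<bullet> j)) > 0) \<and>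
    (\<forall>f p. smooth_fun B f \<longrightarrow> p \<in> U \<longrightarrow> L\<^sub>0 f p = ell a b (f \<circ> inv_into U \<phi>) (\<phi> p)) \<and>
    (\<forall>y\<in>D. \<pi> (\<sigma> y) = inv_into U \<phi> y) \<and> \<sigma> (\<phi> (\<pi> x)) = x \<and>
    (\<forall>S. open S \<longrightarrow> S \<subseteq> D \<longrightarrow> open (\<sigma> ` S)) \<and>
    (\<forall>f. smooth_fun A f \<longrightarrow> smooth_on D (f \<circ> \<sigma>) \<and> (\<forall>y\<in>D. L f (\<sigma> y) = ell a b (f \<circ> \<sigma>) y))"

lemma local_section:
  obtains W where "x \<in> W" "open W" "open (\<pi> ` W)" "inj_on \<pi> W" "continuous_on W \<pi>" "continuous_on (\<pi> ` W) (inv_into W \<pi>)"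
    "smooth_map_on A B W \<pi>" "smooth_map_on B A (\<pi> ` W) (inv_into W \<pi>)"
proof -
  have "local_diffeo A B \<pi>" using cover by (simp add: normal_covering_def smooth_covering_def)
  then obtain W where "x \<in> W" "inj_on \<pi> W" "smooth_map_on A B W \<pi>" "smooth_map_on B A (\<pi> ` W) (inv_into W \<pi>)"
    unfolding local_diffeo_def by blast
  then show thesis by (intro that[of W]) (auto simp: smooth_map_on_def)
qed

lemma ex_section_chart:
  "\<exists>U \<phi> D R \<sigma> a b. section_chart x U \<phi> D R \<sigma> a b"
proof -
  obtain W where W: "x \<in> W" "open W" "open (\<pi> ` W)" "inj_on \<pi> W" "continuous_on W \<pi>"
    "continuous_on (\<pi> ` W) (inv_into W \<pi>)" "smooth_map_on A B W \<pi>" "smooth_map_on B A (\<pi> ` W) (inv_into W \<pi>)"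
    by (rule local_section)
  define s where "s = inv_into W \<pi>"
  have s: "s (\<pi> w) = w" if "w \<in> W" for w using W(4) that by (simp add: s_def)
  have sW: "s p \<in> W" "\<pi> (s p) = p" if "p \<in> \<pi> ` W" for p
    using that by (auto simp: s_def inv_into_into f_inv_into_f)
  obtain U \<phi> where U: "(U, \<phi>) \<in> B" "\<pi> x \<in> U" using atlas_chart(2)[OF B] by blast
  note c = atlas_chart(1)[OF B U(1)]
  obtain a b where ab: "\<And>i j. i \<in> Basis \<Longrightarrow> j \<in> Basis \<Longrightarrow> smooth_on (\<phi> ` U) (a i j)"
    "\<And>k. k \<in> Basis \<Longrightarrow> smooth_on (\<phi> ` U) (b k)"
    "\<And>y i j. y \<in> \<phi> ` U \<Longrightarrow> i \<in> Basis \<Longrightarrow> j \<in> Basis \<Longrightarrow> a i j y = a j i y"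
    "\<And>y \<xi>. y \<in> \<phi> ` U \<Longrightarrow> \<xi> \<noteq> 0 \<Longrightarrow> (\<Sum>i\<in>Basis. \<Sum>j\<in>Basis. a i j y * (\<xi> \<bullet> i) * (\<xi> \<bullet> j)) > 0"
    "\<And>f p. smooth_fun B f \<Longrightarrow> p \<in> U \<Longrightarrow> L\<^sub>0 f p = ell a b (f \<circ> inv_into U \<phi>) (\<phi> p)"
  proof (rule elliptic_operator_chart[OF L0 U(1)])
    fix a b
    assume "\<And>i j. i \<in> Basis \<Longrightarrow> j \<in> Basis \<Longrightarrow> smooth_on (\<phi> ` U) (a i j)"
      "\<And>k. k \<in> Basis \<Longrightarrow> smooth_on (\<phi> ` U) (b k)"
      "\<And>y i j. y \<in> \<phi> ` U \<Longrightarrow> i \<in> Basis \<Longrightarrow> j \<in> Basis \<Longrightarrow> a i j y = a j i y"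
      "\<And>y \<xi>. y \<in> \<phi> ` U \<Longrightarrow> \<xi> \<noteq> 0 \<Longrightarrow> (\<Sum>i\<in>Basis. \<Sum>j\<in>Basis. a i j y * (\<xi> \<bullet> i) * (\<xi> \<bullet> j)) > 0"
      "\<And>f p. smooth_fun B f \<Longrightarrow> p \<in> U \<Longrightarrow> L\<^sub>0 f p = ell a b (f \<circ> inv_into U \<phi>) (\<phi> p)"
    then show thesis by (rule that)
  qed
  define D where "D = \<phi> ` (U \<inter> \<pi> ` W)"
  define \<sigma> where "\<sigma> = s \<circ> inv_into U \<phi>"
  have D: "open D" "D \<subseteq> \<phi> ` U"
    unfolding D_def using chart_image_open[OF c, of "U \<inter> \<pi> ` W"] chart_inv(1)[OF c] W(3) by auto
  have Dq: "inv_into U \<phi> y \<in> U" "inv_into U \<phi> y \<in> \<pi> ` W" "\<phi> (inv_into U \<phi> y) = y" if "y \<in> D" for y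
    using that chart_inv(6)[OF c] by (auto simp: D_def)
  have y0: "\<phi> (\<pi> x) \<in> D" using U W by (auto simp: D_def)
  obtain R where R: "R > 0" "cball (\<phi> (\<pi> x)) R \<subseteq> D" using D(1) y0 open_contains_cball by blast
  have \<sigma>: "\<sigma> y \<in> W" "\<pi> (\<sigma> y) = inv_into U \<phi> y" if "y \<in> D" for y
    using sW Dq[OF that] by (auto simp: \<sigma>_def)
  have \<sigma>_inv: "\<sigma> (\<phi> (\<pi> w)) = w" if "w \<in> W" "\<pi> w \<in> U" for w
    using that s chart_inv(6)[OF c] by (simp add: \<sigma>_def)
  have im: "\<sigma> ` S = W \<inter> \<pi> -` (U \<inter> \<phi> -` S)" if "S \<subseteq> D" for S
  proof (intro equalityI subsetI)
    fix w assume "w \<in> \<sigma> ` S"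
    then obtain y where "y \<in> S" "w = \<sigma> y" by blast
    then show "w \<in> W \<inter> \<pi> -` (U \<inter> \<phi> -` S)"
      using \<sigma>[of y] Dq[of y] that by auto
  next
    fix w assume "w \<in> W \<inter> \<pi> -` (U \<inter> \<phi> -` S)"
    then show "w \<in> \<sigma> ` S" using \<sigma>_inv[of w] by (auto intro!: image_eqI[of _ _ "\<phi> (\<pi> w)"])
  qed
  have op: "open (\<sigma> ` S)" if "open S" "S \<subseteq> D" for S
    unfolding im[OF that(2)]
    by (rule continuous_open_preimage[OF W(5,2) chart_vimage_open[OF c that(1)]])
  have sm: "smooth_on D (f \<circ> \<sigma>)" if f: "smooth_fun A f" for f
  proof (rule smooth_on_local)
    fix y assume y: "y \<in> D"
    obtain V \<psi> where V: "(V, \<psi>) \<in> A" "\<sigma> y \<in> V" using atlas_chart(2)[OF A] by blast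
    note cV = atlas_chart(1)[OF A V(1)]
    let ?T = "\<phi> ` (U \<inter> \<pi> ` W \<inter> s -` V)"
    have smT: "smooth_on ?T (\<psi> \<circ> s \<circ> inv_into U \<phi>)"
      using W(8) V(1) U(1) unfolding smooth_map_on_def s_def by blast
    have "open (\<pi> ` W \<inter> s -` V)"
      using continuous_open_preimage[OF W(6,3) chart_inv(1)[OF cV]] by (simp add: s_def)
    then have T: "open ?T"
      using chart_image_open[OF c, of "U \<inter> (\<pi> ` W \<inter> s -` V)"] chart_inv(1)[OF c] by (auto simp: Int_assoc)
    have "smooth_on ?T (\<lambda>z. (f \<circ> inv_into V \<psi>) ((\<psi> \<circ> s \<circ> inv_into U \<phi>) z))"
      by (rule smooth_on_compose[OF T chart_inv(2)[OF cV] smT smooth_funD[OF f V(1)]])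
        (use chart_inv(6)[OF c] in auto)
    then have "smooth_on ?T (f \<circ> \<sigma>)"
      by (rule smooth_on_cong[OF _ _ T]) (use chart_inv(6)[OF c] chart_inv(6)[OF cV] in \<open>auto simp: \<sigma>_def\<close>)
    moreover have "y \<in> ?T" using Dq[OF y] V(2) by (auto simp: \<sigma>_def intro!: image_eqI[of _ _ "inv_into U \<phi> y"])
    ultimately show "\<exists>T. open T \<and> y \<in> T \<and> smooth_on T (f \<circ> \<sigma>)" using T by blast
  qed
  have pb: "L f (\<sigma> y) = ell a b (f \<circ> \<sigma>) y" if f: "smooth_fun A f" and y: "y \<in> D" for f y
  proof -
    let ?P = "\<lambda>r g. smooth_fun B g \<and> (\<forall>\<^sub>F z in nhds (\<sigma> y). f z = g (\<pi> z)) \<and> r = L\<^sub>0 g (\<pi> (\<sigma> y))"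
    have val: "r = ell a b (f \<circ> \<sigma>) y" if "?P r g" for r g
    proof -
      obtain S where S: "open S" "\<sigma> y \<in> S" "\<And>z. z \<in> S \<Longrightarrow> f z = g (\<pi> z)"
        using \<open>?P r g\<close> unfolding eventually_nhds by blast
      have "open (\<pi> ` W \<inter> s -` S)"
        using continuous_open_preimage[OF W(6,3) S(1)] by (simp add: s_def)
      then have T: "open (\<phi> ` (U \<inter> (\<pi> ` W \<inter> s -` S)))"
        using chart_image_open[OF c, of "U \<inter> (\<pi> ` W \<inter> s -` S)"] chart_inv(1)[OF c] by auto
      have "r = L\<^sub>0 g (inv_into U \<phi> y)" using \<open>?P r g\<close> \<sigma>(2)[OF y] by simp
      also have "\<dots> = ell a b (g \<circ> inv_into U \<phi>) y" using ab(5)[of g "inv_into U \<phi> y"] \<open>?P r g\<close> Dq[OF y] by simp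
      also have "\<dots> = ell a b (f \<circ> \<sigma>) y"
      proof (rule ell_cong_open[OF T])
        show "y \<in> \<phi> ` (U \<inter> (\<pi> ` W \<inter> s -` S))"
          using Dq[OF y] S(2) by (auto simp: \<sigma>_def intro!: image_eqI[of _ _ "inv_into U \<phi> y"])
        show "(g \<circ> inv_into U \<phi>) z = (f \<circ> \<sigma>) z" if "z \<in> \<phi> ` (U \<inter> (\<pi> ` W \<inter> s -` S))" for z
          using that S(3) chart_inv(6)[OF c] sW(2) by (auto simp: \<sigma>_def)
      qed
      finally show ?thesis .
    qed
    obtain \<rho> where \<rho>: "\<rho> > 0" "cball y \<rho> \<subseteq> D" using D(1) y open_contains_cball by blast
    \<comment> \<open>A genuine cutoff, 1 up to radius \<open>\<rho>/3\<close> and 0 from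
      \<open>\<rho>/2\<close> on, obtained from the reversed one by flattening its complement and
      normalising.\<close>
    define \<eta> where "\<eta> z = flat 0 (1 - bump (\<rho>/3) (\<rho>/2) y z) / flat 0 1" for z
    have bm: "smooth_on UNIV (bump (\<rho>/3) (\<rho>/2) y)" "\<And>z. norm (z - y) \<le> \<rho>/3 \<Longrightarrow> bump (\<rho>/3) (\<rho>/2) y z = 0"
      "\<And>z. norm (z - y) \<ge> \<rho>/2 \<Longrightarrow> bump (\<rho>/3) (\<rho>/2) y z \<ge> 1"
      using bump(1-3)[of "\<rho>/3" "\<rho>/2", where c = y] \<rho>(1) by auto
    have "smooth_on UNIV (\<lambda>z. flat 0 (1 - bump (\<rho>/3) (\<rho>/2) y z))"
      by (rule smooth_on_compose[OF open_UNIV open_UNIV smooth_on_diff[OF open_UNIV smooth_on_const[OF open_UNIV] bm(1)] flat_smooth]) auto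
    from smooth_on_cmult[OF open_UNIV this, of "1 / flat 0 1"]
    have \<eta>_smooth: "smooth_on UNIV \<eta>" by (simp add: \<eta>_def[abs_def])
    have \<eta>1: "\<eta> z = 1" if "norm (z - y) \<le> \<rho>/3" for z
      using bm(2)[OF that] flat_pos[of 1 0] by (simp add: \<eta>_def)
    have \<eta>0: "\<eta> z = 0" if "norm (z - y) \<ge> \<rho>/2" for z
      using bm(3)[OF that] by (simp add: \<eta>_def flat_zero)
    define G where "G z = (f \<circ> \<sigma>) z * \<eta> z" for z
    have G: "smooth_on D G" unfolding G_def
      by (intro smooth_on_mult D(1) sm[OF f] smooth_on_subset[OF \<eta>_smooth]) auto
    note ext = chart_ext_test_fun[OF B U(1) D G compact_cball[of y "\<rho>/2"]]
    have zero: "G z = 0" if "z \<notin> cball y (\<rho>/2)" for z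
      using \<eta>0[of z] that by (simp add: G_def dist_norm norm_minus_commute)
    have sub: "cball y (\<rho>/2) \<subseteq> D" using \<rho> by (auto simp: subset_iff)
    define g where "g = chart_ext U \<phi> D G"
    have g: "smooth_fun B g" using ext(1)[OF sub zero] by (simp add: test_fun_def g_def)
    have "\<forall>\<^sub>F z in nhds (\<sigma> y). f z = g (\<pi> z)"
      unfolding eventually_nhds
    proof (intro exI[of _ "\<sigma> ` ball y (\<rho>/3)"] conjI ballI)
      have b3: "ball y (\<rho>/3) \<subseteq> D" using \<rho> by (auto simp: subset_iff)
      then show "open (\<sigma> ` ball y (\<rho>/3))" by (intro op) auto
      show "\<sigma> y \<in> \<sigma> ` ball y (\<rho>/3)" using \<rho> by auto
      fix z assume "z \<in> \<sigma> ` ball y (\<rho>/3)"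
      then obtain y' where y': "z = \<sigma> y'" "y' \<in> ball y (\<rho>/3)" by blast
      then have "y' \<in> D" using b3 by blast
      then have "g (\<pi> z) = G y'" using ext(2)[OF sub zero] \<sigma>(2) y' by (simp add: g_def)
      then show "f z = g (\<pi> z)" using \<eta>1[of y'] y' by (simp add: G_def dist_norm norm_minus_commute)
    qed
    then have "?P (L\<^sub>0 g (\<pi> (\<sigma> y))) g" using g by simp
    note Pg = this
    show ?thesis unfolding pullback_operator_def
    proof (rule the_equality)
      show "\<exists>g. ?P (ell a b (f \<circ> \<sigma>) y) g" using Pg val[OF Pg] by (intro exI[of _ g]) simp
      show "\<And>r. \<exists>g. ?P r g \<Longrightarrow> r = ell a b (f \<circ> \<sigma>) y" by (elim exE) (rule val)
    qed
  qed
  have "section_chart x U \<phi> D R \<sigma> a b"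
    unfolding section_chart_def
  proof (intro conjI ballI allI impI)
    show "smooth_on D (a i j)" if "i \<in> Basis" "j \<in> Basis" for i j
      by (rule smooth_on_subset[OF ab(1)[OF that] D(2)])
    show "smooth_on D (b k)" if "k \<in> Basis" for k
      by (rule smooth_on_subset[OF ab(2)[OF that] D(2)])
    show "a i j y = a j i y" if "y \<in> D" "i \<in> Basis" "j \<in> Basis" for y i j
      by (rule ab(3)) (use that D(2) in auto)
    show "(\<Sum>i\<in>Basis. \<Sum>j\<in>Basis. a i j y * (\<xi> \<bullet> i) * (\<xi> \<bullet> j)) > 0" if "y \<in> D" "\<xi> \<noteq> 0" for y \<xi>
      by (rule ab(4)) (use that D(2) in auto)
  qed (fact U D R ab(5) \<sigma>(2) \<sigma>_inv[OF W(1) U(2)] op sm pb)+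
  then show ?thesis by blast
qed

lemma section_chartD:
  assumes "section_chart x U \<phi> D R \<sigma> a b"
  shows "(U, \<phi>) \<in> B" "\<pi> x \<in> U" "open D" "D \<subseteq> \<phi> ` U" "cball (\<phi> (\<pi> x)) R \<subseteq> D" "R > 0"
    "\<And>i j. i \<in> Basis \<Longrightarrow> j \<in> Basis \<Longrightarrow> smooth_on D (a i j)" "\<And>k. k \<in> Basis \<Longrightarrow> smooth_on D (b k)"
    "\<And>y i j. y \<in> D \<Longrightarrow> i \<in> Basis \<Longrightarrow> j \<in> Basis \<Longrightarrow> a i j y = a j i y"
    "\<And>y \<xi>. y \<in> D \<Longrightarrow> \<xi> \<noteq> 0 \<Longrightarrow> (\<Sum>i\<in>Basis. \<Sum>j\<in>Basis. a i j y * (\<xi> \<bullet> i) * (\<xi> \<bullet> j)) > 0"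
    "\<And>f p. smooth_fun B f \<Longrightarrow> p \<in> U \<Longrightarrow> L\<^sub>0 f p = ell a b (f \<circ> inv_into U \<phi>) (\<phi> p)"
    "\<And>y. y \<in> D \<Longrightarrow> \<pi> (\<sigma> y) = inv_into U \<phi> y" "\<sigma> (\<phi> (\<pi> x)) = x"
    "\<And>S. open S \<Longrightarrow> S \<subseteq> D \<Longrightarrow> open (\<sigma> ` S)"
    "\<And>f. smooth_fun A f \<Longrightarrow> smooth_on D (f \<circ> \<sigma>)"
    "\<And>f y. smooth_fun A f \<Longrightarrow> y \<in> D \<Longrightarrow> L f (\<sigma> y) = ell a b (f \<circ> \<sigma>) y"
    "\<phi> (\<pi> x) \<in> D"
  using assms unfolding section_chart_def by (auto simp: subset_iff)

end

section \<open>The upper FC-central series\<close>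

text \<open>Moves the conjugacy class from the quotient group to cosets of conjugates in
  \<open>G\<close>, the form in which its finiteness is exploited.\<close>

lemma (in group) FC_succ_iff:
  assumes "H \<lhd> G"
  shows "g \<in> FC_succ G H \<longleftrightarrow> g \<in> carrier G \<and> finite {H #> (x \<otimes> g \<otimes> inv x) | x. x \<in> carrier G}"
proof -
  interpret normal H G by fact
  have "{X \<otimes>\<^bsub>G Mod H\<^esub> (H #> g) \<otimes>\<^bsub>G Mod H\<^esub> inv\<^bsub>G Mod H\<^esub> X | X. X \<in> carrier (G Mod H)}
      = {H #> (x \<otimes> g \<otimes> inv x) | x. x \<in> carrier G}" if g: "g \<in> carrier G"
  proof -
    have "(H #> x) \<otimes>\<^bsub>G Mod H\<^esub> (H #> g) \<otimes>\<^bsub>G Mod H\<^esub> inv\<^bsub>G Mod H\<^esub> (H #> x) = H #> (x \<otimes> g \<otimes> inv x)"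
      if x: "x \<in> carrier G" for x
    proof -
      have "H #> x \<in> carrier (G Mod H)" using x by (auto simp: FactGroup_def RCOSETS_def)
      then have "inv\<^bsub>G Mod H\<^esub> (H #> x) = H #> inv x"
        using inv_FactGroup rcos_inv x by simp
      then show ?thesis using x g by (simp add: rcos_sum FactGroup_def)
    qed
    moreover have "carrier (G Mod H) = (\<lambda>x. H #> x) ` carrier G"
      by (auto simp: FactGroup_def RCOSETS_def)
    ultimately show ?thesis by (simp add: Setcompr_eq_image image_image)
  qed
  moreover have "g \<in> carrier G \<Longrightarrow> H #> g \<in> carrier (G Mod H)"
    by (auto simp: FactGroup_def RCOSETS_def)
  ultimately show ?thesis unfolding FC_succ_def FC_center_def by auto
qed

text \<open>Modulo \<open>H\<close>, the class of a product lies in the product of the classes, that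
  of an inverse consists of the inverses, and a conjugate has no larger class, so finiteness is
  inherited.\<close>

lemma (in group) FC_succ_normal:
  assumes "H \<lhd> G"
  shows "FC_succ G H \<lhd> G"
proof -
  interpret normal H G by fact
  let ?C = "\<lambda>g. {H #> (x \<otimes> g \<otimes> inv x) | x. x \<in> carrier G}"
  note iff = FC_succ_iff[OF assms]
  have conj: "?C (y \<otimes> g \<otimes> inv y) \<subseteq> ?C g" if "y \<in> carrier G" "g \<in> carrier G" for y g
  proof clarify
    fix x assume x: "x \<in> carrier G"
    have "x \<otimes> (y \<otimes> g \<otimes> inv y) \<otimes> inv x = (x \<otimes> y) \<otimes> g \<otimes> inv (x \<otimes> y)"
      using x that by (simp add: m_assoc inv_mult_group)
    then show "\<exists>z. H #> (x \<otimes> (y \<otimes> g \<otimes> inv y) \<otimes> inv x) = H #> (z \<otimes> g \<otimes> inv z) \<and> z \<in> carrier G"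
      using x that by (intro exI[of _ "x \<otimes> y"]) simp
  qed
  have one: "?C \<one> \<subseteq> {H #> \<one>}" by auto
  have mult: "?C (g \<otimes> h) \<subseteq> (\<lambda>(X, Y). X <#> Y) ` (?C g \<times> ?C h)" if gh: "g \<in> carrier G" "h \<in> carrier G" for g h
  proof clarify
    fix x assume x: "x \<in> carrier G"
    have "x \<otimes> (g \<otimes> h) \<otimes> inv x = (x \<otimes> g \<otimes> inv x) \<otimes> (x \<otimes> h \<otimes> inv x)"
      using x gh by (simp add: m_assoc inv_solve_left)
    then have "H #> (x \<otimes> (g \<otimes> h) \<otimes> inv x) = (H #> (x \<otimes> g \<otimes> inv x)) <#> (H #> (x \<otimes> h \<otimes> inv x))"
      using x gh by (simp add: rcos_sum)
    then show "H #> (x \<otimes> (g \<otimes> h) \<otimes> inv x) \<in> (\<lambda>(X, Y). X <#> Y) ` (?C g \<times> ?C h)"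
      using x by (auto intro!: image_eqI)
  qed
  have invs: "?C (inv g) \<subseteq> (\<lambda>X. set_inv X) ` ?C g" if g: "g \<in> carrier G" for g
  proof clarify
    fix x assume x: "x \<in> carrier G"
    have "x \<otimes> inv g \<otimes> inv x = inv (x \<otimes> g \<otimes> inv x)"
      using x g by (simp add: m_assoc inv_mult_group)
    then have "H #> (x \<otimes> inv g \<otimes> inv x) = set_inv (H #> (x \<otimes> g \<otimes> inv x))"
      using x g by (simp add: rcos_inv)
    then show "H #> (x \<otimes> inv g \<otimes> inv x) \<in> (\<lambda>X. set_inv X) ` ?C g" using x by auto
  qed
  show ?thesis
  proof (rule normal_invI)
    show "subgroup (FC_succ G H) G"
    proof (rule subgroup.intro)
      show "FC_succ G H \<subseteq> carrier G" by (auto simp: FC_succ_def)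
      show "\<one> \<in> FC_succ G H" using finite_subset[OF one] by (simp add: iff)
      show "g \<otimes> h \<in> FC_succ G H" if "g \<in> FC_succ G H" "h \<in> FC_succ G H" for g h
        using that finite_subset[OF mult[of g h]] by (simp add: iff)
      show "inv g \<in> FC_succ G H" if "g \<in> FC_succ G H" for g
        using that finite_subset[OF invs[of g]] by (simp add: iff)
    qed
    show "x \<otimes> h \<otimes> inv x \<in> FC_succ G H" if "x \<in> carrier G" "h \<in> FC_succ G H" for x h
      using that finite_subset[OF conj[of x h]] by (simp add: iff)
  qed
qed

text \<open>A coset of \<open>K\<close> is recovered from the \<open>H\<close>-coset of the same
  element by multiplying with \<open>K\<close>, so the class modulo \<open>K\<close> is an image of
  the class modulo \<open>H\<close>.\<close>

lemma (in group) FC_succ_mono: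
  assumes "H \<lhd> G" "K \<lhd> G" "H \<subseteq> K"
  shows "FC_succ G H \<subseteq> FC_succ G K"
proof
  fix g assume g: "g \<in> FC_succ G H"
  have K: "subgroup K G" using assms(2) by (simp add: normal_imp_subgroup)
  have "K #> y = (\<Union>z\<in>H #> y. K #> z)" if y: "y \<in> carrier G" for y
  proof -
    have "K #> z = K #> y" if "z \<in> H #> y" for z
      using that assms(3) y by (intro repr_independence[OF _ y K, symmetric]) (auto simp: r_coset_def)
    moreover have "H #> y \<noteq> {}"
      using rcos_self[OF y normal_imp_subgroup[OF assms(1)]] by blast
    ultimately have "(\<Union>z\<in>H #> y. K #> z) = K #> y" by (intro SUP_eq_const)
    then show ?thesis by (rule sym)
  qed
  note K_eq = this
  have gG: "g \<in> carrier G" using g by (simp add: FC_succ_def)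
  have "{K #> (x \<otimes> g \<otimes> inv x) | x. x \<in> carrier G} \<subseteq>
      (\<lambda>C. \<Union>z\<in>C. K #> z) ` {H #> (x \<otimes> g \<otimes> inv x) | x. x \<in> carrier G}"
  proof clarify
    fix x assume x: "x \<in> carrier G"
    show "K #> (x \<otimes> g \<otimes> inv x) \<in> (\<lambda>C. \<Union>z\<in>C. K #> z) ` {H #> (x \<otimes> g \<otimes> inv x) | x. x \<in> carrier G}"
      by (rule image_eqI[where x = "H #> (x \<otimes> g \<otimes> inv x)"]) (use x gG K_eq[of "x \<otimes> g \<otimes> inv x"] in auto)
  qed
  moreover have "finite {H #> (x \<otimes> g \<otimes> inv x) | x. x \<in> carrier G}"
    using g unfolding FC_succ_iff[OF assms(1)] by blast
  ultimately have "finite {K #> (x \<otimes> g \<otimes> inv x) | x. x \<in> carrier G}"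
    by (rule finite_subset[OF _ finite_imageI])
  then show "g \<in> FC_succ G K"
    unfolding FC_succ_iff[OF assms(2)] using gG by blast
qed

text \<open>Two elements of the union lie in one member because the members form a chain; this gives
  closure under products. The empty set is tolerated because it is the bottom of the iteration to
  which this is applied.\<close>

lemma (in group) normal_Union_chain:
  assumes "Complete_Partial_Order.chain (\<subseteq>) M" "\<And>H. H \<in> M \<Longrightarrow> H = {} \<or> H \<lhd> G" "\<Union>M \<noteq> {}"
  shows "\<Union>M \<lhd> G"
proof -
  have N: "H \<lhd> G" if "H \<in> M" "x \<in> H" for H x using assms(2) that by auto
  note NS = normal_imp_subgroup[OF N]
  show ?thesis
  proof (rule normal_invI)
    show "subgroup (\<Union>M) G"
    proof (rule subgroup.intro)
      show "\<Union>M \<subseteq> carrier G" using subgroup.subset[OF NS] by blast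
      obtain H x where "H \<in> M" "x \<in> H" using assms(3) by blast
      then show "\<one> \<in> \<Union>M" using subgroup.one_closed[OF NS] by blast
      show "inv x \<in> \<Union>M" if "x \<in> \<Union>M" for x
        using that subgroup.m_inv_closed[OF NS] by blast
      fix x y assume "x \<in> \<Union>M" "y \<in> \<Union>M"
      then obtain H K where HK: "H \<in> M" "K \<in> M" "x \<in> H" "y \<in> K" by blast
      then have "H \<subseteq> K \<or> K \<subseteq> H" using assms(1) by (auto simp: chain_def)
      then obtain J where "J \<in> M" "x \<in> J" "y \<in> J" using HK by blast
      then show "x \<otimes> y \<in> \<Union>M"
        using subgroup.m_closed[OF NS] by blast
    qed
    show "x \<otimes> h \<otimes> inv x \<in> \<Union>M" if "x \<in> carrier G" "h \<in> \<Union>M" for x h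
      using that normal.inv_op_closed2[OF N] by blast
  qed
qed

text \<open>The limit clause of the series is stated for arbitrary unions. To see that the terms form a
  chain, the successor is extended to a monotone function on all subsets of the group.\<close>

lemma (in group) upper_FC_series_normal:
  assumes "H \<in> upper_FC_series G"
  shows "H \<lhd> G"
proof -
  \<comment> \<open>Ranging over all normal subgroups inside \<open>H\<close> makes monotonicity
    evident. The inserted unit sends the empty set, where the iteration starts, to the trivial
    subgroup.\<close>
  define f where "f H = insert \<one> (\<Union>{FC_succ G K | K. K \<lhd> G \<and> K \<subseteq> H})" for H
  have mono: "monotone (\<le>) (\<le>) f"
    unfolding f_def by (rule monotoneI) blast
  have f_normal: "f H = FC_succ G H" if "H \<lhd> G" for H
  proof -
    have "\<one> \<in> FC_succ G H"
      using FC_succ_normal[OF that] by (simp add: normal_imp_subgroup subgroup.one_closed)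
    then show ?thesis unfolding f_def using FC_succ_mono that by auto
  qed
  have f_empty: "f {} = {\<one>}"
    unfolding f_def using normal_imp_subgroup subgroup.one_closed by fastforce
  have iter: "X = {} \<or> X \<lhd> G" if "X \<in> ccpo_class.iterates f" for X
    using that
  proof (induction rule: ccpo_class.iterates.induct)
    case (step X)
    from step.IH show ?case
    proof
      assume "X = {}"
      then show ?thesis using f_empty one_is_normal by simp
    next
      assume "X \<lhd> G"
      then show ?thesis using f_normal FC_succ_normal by simp
    qed
  next
    case (Sup M)
    then show ?case using normal_Union_chain[of M] by blast
  qed
  have "H \<in> ccpo_class.iterates f \<and> H \<noteq> {}"
    using assms
  proof (induction rule: upper_FC_series.induct)
    case zero
    show ?case using ccpo_class.iterates.step[OF ccpo_class.bot_in_iterates, of f] f_empty by simp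
  next
    case (succ H)
    then have "H \<lhd> G" using iter by blast
    moreover from this have "\<one> \<in> FC_succ G H"
      using FC_succ_normal normal_imp_subgroup subgroup.one_closed by blast
    ultimately show ?case
      using ccpo_class.iterates.step[of H f] succ.IH f_normal by auto
  next
    case (limit \<H>)
    have "Complete_Partial_Order.chain (\<le>) \<H>"
      using ccpo_class.chain_iterates[OF mono] limit.IH by (auto simp: chain_def)
    then show ?case using limit ccpo_class.iterates.Sup[of \<H> f] by auto
  qed
  then show ?thesis using iter by blast
qed

text \<open>Unions of subsets of \<open>K\<close> stay in \<open>K\<close>, so only the successor
  clause leaves work, and there the normality of the terms turns membership into finiteness of a set
  of cosets.\<close>

lemma (in group) FC_hypercenter_induct:
  assumes "\<one> \<in> K"
    and "\<And>H g. H \<lhd> G \<Longrightarrow> H \<subseteq> K \<Longrightarrow> g \<in> carrier G \<Longrightarrow>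
      finite {H #> (x \<otimes> g \<otimes> inv x) | x. x \<in> carrier G} \<Longrightarrow> g \<in> K"
  shows "FC_hypercenter G \<subseteq> K"
proof -
  have "H \<subseteq> K" if "H \<in> upper_FC_series G" for H
    using that
  proof (induction rule: upper_FC_series.induct)
    case (succ H)
    note N = upper_FC_series_normal[OF succ.hyps]
    show ?case
    proof
      fix g assume "g \<in> FC_succ G H"
      then show "g \<in> K"
        using assms(2)[OF N succ.IH] unfolding FC_succ_iff[OF N] by simp
    qed
  qed (use assms(1) in auto)
  then show ?thesis unfolding FC_hypercenter_def by blast
qed

section \<open>Deck transformations and bounded harmonic functions\<close>

lemma deck_group_simps [simp]:
  "x \<otimes>\<^bsub>deck_group \<pi>\<^esub> y = x \<circ> y" "\<one>\<^bsub>deck_group \<pi>\<^esub> = id"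
  by (simp_all add: deck_group_def)

lemma deck_group_carrier:
  "\<gamma> \<in> carrier (deck_group \<pi>) \<longleftrightarrow> (\<exists>\<gamma>'. homeomorphism UNIV UNIV \<gamma> \<gamma>') \<and> \<pi> \<circ> \<gamma> = \<pi>"
  by (simp add: deck_group_def)

lemma group_deck_group: "group (deck_group \<pi>)"
proof (rule groupI)
  show "\<one>\<^bsub>deck_group \<pi>\<^esub> \<in> carrier (deck_group \<pi>)"
    unfolding deck_group_carrier by (auto intro!: exI[of _ id] simp: homeomorphism_def)
  fix x y assume "x \<in> carrier (deck_group \<pi>)" "y \<in> carrier (deck_group \<pi>)"
  then show "x \<otimes>\<^bsub>deck_group \<pi>\<^esub> y \<in> carrier (deck_group \<pi>)"
    unfolding deck_group_carrier by (auto simp: o_assoc intro: homeomorphism_compose)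
next
  fix x assume "x \<in> carrier (deck_group \<pi>)"
  then obtain x' where x: "homeomorphism UNIV UNIV x x'" "\<pi> \<circ> x = \<pi>"
    unfolding deck_group_carrier by blast
  have inv: "x' \<circ> x = id" "x \<circ> x' = id" using x(1) by (auto simp: homeomorphism_def fun_eq_iff)
  have "\<pi> \<circ> x' = \<pi> \<circ> (x \<circ> x')" using x(2) by (simp add: o_assoc)
  then have "\<pi> \<circ> x' = \<pi>" using inv by simp
  then have "x' \<in> carrier (deck_group \<pi>)"
    unfolding deck_group_carrier using x(1) homeomorphism_symD by blast
  then show "\<exists>y\<in>carrier (deck_group \<pi>). y \<otimes>\<^bsub>deck_group \<pi>\<^esub> x = \<one>\<^bsub>deck_group \<pi>\<^esub>"
    using inv by auto
qed (auto simp: o_assoc)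

section \<open>Action of deck transformations on harmonic functions\<close>

context normal_cover
begin

abbreviation "L_harmonic f \<equiv> harmonic A L f"
abbreviation "\<Gamma> \<equiv> carrier (deck_group \<pi>)"

lemma deck_pi: "\<gamma> \<in> \<Gamma> \<Longrightarrow> \<pi> (\<gamma> x) = \<pi> x"
  unfolding deck_group_carrier by (metis comp_apply)

lemma deck_transitive: "\<pi> x = \<pi> y \<Longrightarrow> \<exists>\<gamma>\<in>\<Gamma>. \<gamma> x = y"
  using cover unfolding normal_covering_def by blast

lemma pi_surj: "\<exists>x. \<pi> x = p"
  using cover unfolding normal_covering_def smooth_covering_def covering_space_def by (metis UNIV_I imageE)

lemma harm_lincomb:
  assumes f: "L_harmonic f" and g: "L_harmonic g"
  shows "L_harmonic (\<lambda>x. \<alpha> * f x + \<beta> * g x + c)"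
proof -
  let ?h = "\<lambda>x. \<alpha> * f x + \<beta> * g x + c"
  have sf: "smooth_fun A f" "smooth_fun A g" using assms by (auto simp: harmonic_def)
  have "smooth_on (\<phi> ` U) (?h \<circ> inv_into U \<phi>)" if U: "(U, \<phi>) \<in> A" for U \<phi>
  proof -
    note op = chart_inv(2)[OF atlas_chart(1)[OF A U]]
    have "smooth_on (\<phi> ` U) (\<lambda>y. \<alpha> * (f \<circ> inv_into U \<phi>) y + \<beta> * (g \<circ> inv_into U \<phi>) y + c)"
      by (intro smooth_on_add smooth_on_cmult smooth_on_const op smooth_funD[OF sf(1) U] smooth_funD[OF sf(2) U])
    then show ?thesis by (simp add: o_def)
  qed
  then have sh: "smooth_fun A ?h" unfolding smooth_fun_def by blast
  have "L ?h x = 0" for x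
  proof -
    obtain U \<phi> D R \<sigma> a b where S: "section_chart x U \<phi> D R \<sigma> a b" using ex_section_chart by blast
    note sc = section_chartD[OF S]
    have "L ?h x = ell a b (?h \<circ> \<sigma>) (\<phi> (\<pi> x))" using sc(16)[OF sh sc(17)] sc(13) by simp
    also have "\<dots> = ell a b (\<lambda>y. \<alpha> * (f \<circ> \<sigma>) y + \<beta> * (g \<circ> \<sigma>) y + c) (\<phi> (\<pi> x))" by (simp add: o_def)
    also have "\<dots> = \<alpha> * ell a b (f \<circ> \<sigma>) (\<phi> (\<pi> x)) + \<beta> * ell a b (g \<circ> \<sigma>) (\<phi> (\<pi> x))"
      by (rule ell_lincomb[OF sc(3) sc(15)[OF sf(1)] sc(15)[OF sf(2)] sc(17)])
    also have "\<dots> = \<alpha> * L f x + \<beta> * L g x"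
      using sc(16)[OF sf(1) sc(17)] sc(16)[OF sf(2) sc(17)] sc(13) by simp
    finally show ?thesis using assms by (simp add: harmonic_def)
  qed
  then show ?thesis using sh by (simp add: harmonic_def)
qed

lemma harm_affine: "L_harmonic f \<Longrightarrow> L_harmonic (\<lambda>x. \<alpha> * f x + c)"
  using harm_lincomb[of f f \<alpha> 0 c] by simp

text \<open>A deck transformation is given only as a homeomorphism. For a section \<sigma> through
  \<open>\<gamma> x\<close> it equals \<open>\<sigma> \<circ> \<phi> \<circ> \<pi>\<close> near
  \<open>x\<close>, which yields smoothness. Since \<gamma> preserves \<pi>, the germs of
  \<open>f \<circ> \<gamma>\<close> at \<open>x\<close> and of \<open>f\<close> at
  \<open>\<gamma> x\<close> descend to the same functions on the base, so the pull back operator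
  commutes with \<gamma>.\<close>

lemma harm_deck:
  assumes f: "L_harmonic f" and \<gamma>: "\<gamma> \<in> \<Gamma>"
  shows "L_harmonic (f \<circ> \<gamma>)"
proof -
  have sf: "smooth_fun A f" using f by (simp add: harmonic_def)
  obtain \<gamma>' where h: "homeomorphism UNIV UNIV \<gamma> \<gamma>'" using \<gamma> unfolding deck_group_carrier by blast
  have cont: "continuous_on UNIV \<gamma>" "continuous_on UNIV \<gamma>'" and inv: "\<gamma>' (\<gamma> y) = y" "\<gamma> (\<gamma>' y) = y" for y
    using h by (auto simp: homeomorphism_def)
  have "smooth_fun A (f \<circ> \<gamma>)"
  proof (rule smooth_fun_localI[OF A])
    fix x
    obtain U \<phi> D R \<sigma> a b where S: "section_chart (\<gamma> x) U \<phi> D R \<sigma> a b" using ex_section_chart by blast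
    note sc = section_chartD[OF S]
    note cU = atlas_chart(1)[OF B sc(1)]
    obtain V \<psi> where V: "(V, \<psi>) \<in> A" "x \<in> V" using atlas_chart(2)[OF A] by blast
    note cV = atlas_chart(1)[OF A V(1)]
    obtain W where W: "x \<in> W" "open W" "open (\<pi> ` W)" "inj_on \<pi> W" "continuous_on W \<pi>"
      "continuous_on (\<pi> ` W) (inv_into W \<pi>)" "smooth_map_on A B W \<pi>" "smooth_map_on B A (\<pi> ` W) (inv_into W \<pi>)"
      by (rule local_section)
    let ?T = "\<psi> ` (V \<inter> W \<inter> \<gamma> -` (\<sigma> ` D))"
    have "open (\<gamma> -` (\<sigma> ` D))"
      using sc(14)[OF sc(3)] cont(1) continuous_on_open_vimage[of UNIV \<gamma>] by auto
    then have T: "open ?T"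
      using chart_inv(1)[OF cV] W(2) by (intro chart_image_open[OF cV]) auto
    have key: "\<pi> z \<in> U \<and> \<phi> (\<pi> z) \<in> D \<and> \<sigma> (\<phi> (\<pi> z)) = \<gamma> z" if z: "\<gamma> z \<in> \<sigma> ` D" for z
    proof -
      obtain y where y: "\<gamma> z = \<sigma> y" "y \<in> D" using z by blast
      then have "\<pi> z = inv_into U \<phi> y" using sc(12) deck_pi[OF \<gamma>, of z] by simp
      then show ?thesis using y chart_inv(7,8)[OF cU, of y] sc(4) by auto
    qed
    have "smooth_on ?T (\<lambda>y. (f \<circ> \<sigma>) ((\<phi> \<circ> \<pi> \<circ> inv_into V \<psi>) y))"
    proof (rule smooth_on_compose[OF T sc(3) _ sc(15)[OF sf]])
      have "smooth_on (\<psi> ` (V \<inter> W \<inter> \<pi> -` U)) (\<phi> \<circ> \<pi> \<circ> inv_into V \<psi>)"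
        using W(7) V(1) sc(1) unfolding smooth_map_on_def by blast
      then show "smooth_on ?T (\<phi> \<circ> \<pi> \<circ> inv_into V \<psi>)"
        by (rule smooth_on_subset) (use key in blast)
      show "(\<phi> \<circ> \<pi> \<circ> inv_into V \<psi>) ` ?T \<subseteq> D"
        using key chart_inv(6)[OF cV] by auto
    qed
    then have "smooth_on ?T (f \<circ> \<gamma> \<circ> inv_into V \<psi>)"
      by (rule smooth_on_cong[OF _ _ T]) (use key chart_inv(6)[OF cV] in auto)
    moreover have "\<psi> x \<in> ?T" using V W(1) sc(13,17) by (auto intro!: image_eqI[of _ _ x]) (metis imageI)
    ultimately show "\<exists>U \<phi> S. (U, \<phi>) \<in> A \<and> x \<in> U \<and> open S \<and> \<phi> x \<in> S \<and> S \<subseteq> \<phi> ` U \<and> smooth_on S (f \<circ> \<gamma> \<circ> inv_into U \<phi>)"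
      using V T by blast
  qed
  moreover have "L (f \<circ> \<gamma>) x = 0" for x
  proof -
    have "(\<forall>\<^sub>F y in nhds x. (f \<circ> \<gamma>) y = g (\<pi> y)) \<longleftrightarrow> (\<forall>\<^sub>F y in nhds (\<gamma> x). f y = g (\<pi> y))" for g
    proof
      assume "\<forall>\<^sub>F y in nhds x. (f \<circ> \<gamma>) y = g (\<pi> y)"
      then obtain S where S: "open S" "x \<in> S" "\<And>y. y \<in> S \<Longrightarrow> f (\<gamma> y) = g (\<pi> y)"
        unfolding eventually_nhds by auto
      have "open (\<gamma>' -` S)" using S(1) cont(2) continuous_on_open_vimage[of UNIV \<gamma>'] by auto
      moreover have "f y = g (\<pi> y)" if "y \<in> \<gamma>' -` S" for y
        using S(3)[of "\<gamma>' y"] that inv deck_pi[OF \<gamma>, of "\<gamma>' y"] by simp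
      ultimately show "\<forall>\<^sub>F y in nhds (\<gamma> x). f y = g (\<pi> y)"
        unfolding eventually_nhds using S(2) inv by (intro exI[of _ "\<gamma>' -` S"]) auto
    next
      assume "\<forall>\<^sub>F y in nhds (\<gamma> x). f y = g (\<pi> y)"
      then obtain S where S: "open S" "\<gamma> x \<in> S" "\<And>y. y \<in> S \<Longrightarrow> f y = g (\<pi> y)"
        unfolding eventually_nhds by auto
      have "open (\<gamma> -` S)" using S(1) cont(1) continuous_on_open_vimage[of UNIV \<gamma>] by auto
      then show "\<forall>\<^sub>F y in nhds x. (f \<circ> \<gamma>) y = g (\<pi> y)"
        unfolding eventually_nhds using S deck_pi[OF \<gamma>] by (intro exI[of _ "\<gamma> -` S"]) auto
    qed
    then have "L (f \<circ> \<gamma>) x = L f (\<gamma> x)"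
      unfolding pullback_operator_def deck_pi[OF \<gamma>] by simp
    then show ?thesis using f by (simp add: harmonic_def)
  qed
  ultimately show ?thesis by (simp add: harmonic_def)
qed

text \<open>The neighbourhood \<open>Q\<close> comes before \<delta>; therefore finitely many such
  comparisons can be chained.\<close>

lemma weak_harnack_local:
  "\<exists>Q. open Q \<and> x \<in> Q \<and> (\<forall>\<delta>>0. \<exists>\<epsilon>>0. \<forall>v. L_harmonic v \<longrightarrow> (\<forall>z. 0 \<le> v z \<and> v z \<le> 1) \<longrightarrow>
    (\<forall>z\<in>Q. \<forall>z'\<in>Q. v z \<le> \<epsilon> \<longrightarrow> v z' \<le> \<delta>))"
proof -
  obtain U \<phi> D R \<sigma> a b where S: "section_chart x U \<phi> D R \<sigma> a b" using ex_section_chart by blast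
  note sc = section_chartD[OF S]
  let ?y0 = "\<phi> (\<pi> x)"
  let ?b = "ball ?y0 (R/8)"
  have bD: "?b \<subseteq> D" using sc(5,6) by (auto simp: subset_iff)
  show ?thesis
  proof (intro exI[of _ "\<sigma> ` ?b"] conjI allI impI)
    show "open (\<sigma> ` ?b)" by (rule sc(14)[OF open_ball bD])
    show "x \<in> \<sigma> ` ?b" using sc(6,13) by (intro image_eqI[of _ _ ?y0]) auto
    fix \<delta> :: real assume \<delta>: "\<delta> > 0"
    show "\<exists>\<epsilon>>0. \<forall>v. L_harmonic v \<longrightarrow> (\<forall>z. 0 \<le> v z \<and> v z \<le> 1) \<longrightarrow> (\<forall>z\<in>\<sigma> ` ?b. \<forall>z'\<in>\<sigma> ` ?b. v z \<le> \<epsilon> \<longrightarrow> v z' \<le> \<delta>)"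
    proof (rule local_weak_harnack[OF sc(3,5,6) smooth_on_imp_continuous_on[OF sc(7)] smooth_on_imp_continuous_on[OF sc(8)] sc(9,10) \<delta>])
      fix \<epsilon> :: real
      assume \<epsilon>: "\<epsilon> > 0" "\<And>v x x'. smooth_on D v \<Longrightarrow> (\<And>y. y \<in> D \<Longrightarrow> ell a b v y = 0 \<and> 0 \<le> v y \<and> v y \<le> 1) \<Longrightarrow>
        x \<in> ?b \<Longrightarrow> x' \<in> ?b \<Longrightarrow> v x \<le> \<epsilon> \<Longrightarrow> v x' \<le> \<delta>"
      have "v (\<sigma> y') \<le> \<delta>" if v: "L_harmonic v" "\<forall>z. 0 \<le> v z \<and> v z \<le> 1" and y: "y \<in> ?b" "y' \<in> ?b" "v (\<sigma> y) \<le> \<epsilon>" for v y y'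
      proof -
        have sv: "smooth_fun A v" "\<And>z. L v z = 0" using v(1) by (auto simp: harmonic_def)
        have "(v \<circ> \<sigma>) y' \<le> \<delta>"
          by (rule \<epsilon>(2)[OF sc(15)[OF sv(1)] _ y(1,2)]) (use sc(16)[OF sv(1)] sv(2) v(2) y(3) in auto)
        then show ?thesis by simp
      qed
      then show ?thesis using \<epsilon>(1) by blast
    qed
  qed
qed

text \<open>That smallness at one point forces smallness at another is a transitive relation, valid
  in both directions within small neighbourhoods. The points reached from \<open>z\<close> and those
  not reached are thus both open, and connectedness excludes the latter.\<close>

lemma weak_harnack_global:
  assumes conn: "connected (UNIV :: 'm set)"
  shows "\<forall>\<delta>>0. \<exists>\<epsilon>>0. \<forall>v. L_harmonic v \<longrightarrow> (\<forall>z. 0 \<le> v z \<and> v z \<le> 1) \<longrightarrow> v z \<le> \<epsilon> \<longrightarrow> v z' \<le> \<delta>"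
proof -
  define adm where "adm v \<longleftrightarrow> L_harmonic v \<and> (\<forall>z. 0 \<le> v z \<and> v z \<le> 1)" for v
  define r where "r z z' \<longleftrightarrow> (\<forall>\<delta>>0. \<exists>\<epsilon>>0. \<forall>v. adm v \<longrightarrow> v z \<le> \<epsilon> \<longrightarrow> v z' \<le> \<delta>)" for z z'
  have trans: "r x z" if "r x y" "r y z" for x y z
    using that unfolding r_def by metis
  have loc: "\<exists>Q. open Q \<and> x \<in> Q \<and> (\<forall>z\<in>Q. \<forall>z'\<in>Q. r z z')" for x
    using weak_harnack_local[of x] unfolding r_def adm_def by meson
  have "open {z'. r z z'}"
    unfolding open_subopen[of "{z'. r z z'}"] using loc trans by (metis mem_Collect_eq subsetI)
  moreover have "open {z'. \<not> r z z'}"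
    unfolding open_subopen[of "{z'. \<not> r z z'}"] using loc trans by (metis mem_Collect_eq subsetI)
  moreover have "r z z" unfolding r_def by blast
  ultimately have "{z'. \<not> r z z'} = {}"
    using connectedD[OF conn, of "{z'. r z z'}" "{z'. \<not> r z z'}"] by blast
  then have "r z z'" by blast
  then show ?thesis unfolding r_def adm_def by (simp only: imp_conjL)
qed

lemma weak_harnack_finite:
  assumes conn: "connected (UNIV :: 'm set)" and "finite Z" "\<delta> > 0"
  shows "\<exists>\<epsilon>>0. \<forall>v. L_harmonic v \<longrightarrow> (\<forall>z. 0 \<le> v z \<and> v z \<le> 1) \<longrightarrow> v z0 \<le> \<epsilon> \<longrightarrow> (\<forall>z\<in>Z. v z \<le> \<delta>)"
  using assms(2)
proof (induction Z rule: finite_induct)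
  case empty show ?case by (auto intro: exI[of _ 1])
next
  case (insert z Z)
  obtain \<epsilon>1 where 1: "\<epsilon>1 > 0" "\<forall>v. L_harmonic v \<longrightarrow> (\<forall>z. 0 \<le> v z \<and> v z \<le> 1) \<longrightarrow> v z0 \<le> \<epsilon>1 \<longrightarrow> (\<forall>z\<in>Z. v z \<le> \<delta>)"
    using insert.IH by blast
  obtain \<epsilon>2 where 2: "\<epsilon>2 > 0" "\<forall>v. L_harmonic v \<longrightarrow> (\<forall>z. 0 \<le> v z \<and> v z \<le> 1) \<longrightarrow> v z0 \<le> \<epsilon>2 \<longrightarrow> v z \<le> \<delta>"
    using weak_harnack_global[OF conn, of z0 z] assms(3) by blast
  show ?case
    by (rule exI[of _ "min \<epsilon>1 \<epsilon>2"]) (use 1 2 in auto)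
qed

text \<open>The form in which recurrence of the base enters the group-theoretic part: a bounded
  harmonic function comes close to its supremum on every orbit.\<close>

definition "fibre_recurrent \<longleftrightarrow> (\<forall>u z0 \<epsilon>. L_harmonic u \<longrightarrow> bounded (range u) \<longrightarrow> \<epsilon> > 0 \<longrightarrow>
   (\<exists>\<gamma>\<in>\<Gamma>. \<forall>x. u x \<le> u (\<gamma> z0) + \<epsilon>))"

text \<open>The choices are made in the order \<open>k\<close>, \<open>Z\<close>, \<epsilon>,
  \<open>a\<close>. The set \<open>Z\<close> contains the iterates for every coset in
  \<open>X\<close>, hence also for the one containing the conjugate of \<gamma> by the deck
  transformation \<open>a\<close> that appears last.\<close>

lemma invariance_step:
  assumes conn: "connected (UNIV :: 'm set)" and rec: fibre_recurrent
    and H: "H \<lhd> deck_group \<pi>"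
    and Hinv: "\<And>h \<eta>. L_harmonic h \<Longrightarrow> bounded (range h) \<Longrightarrow> \<eta> \<in> H \<Longrightarrow> h \<circ> \<eta> = h"
    and \<gamma>: "\<gamma> \<in> \<Gamma>"
    and fin: "finite {H #>\<^bsub>deck_group \<pi>\<^esub> (x \<otimes>\<^bsub>deck_group \<pi>\<^esub> \<gamma> \<otimes>\<^bsub>deck_group \<pi>\<^esub> inv\<^bsub>deck_group \<pi>\<^esub> x) | x. x \<in> \<Gamma>}"
    and h: "L_harmonic h" "bounded (range h)"
  shows "h (\<gamma> x) \<le> h x"
proof (rule ccontr)
  assume contr: "\<not> h (\<gamma> x) \<le> h x"
  let ?G = "deck_group \<pi>"
  interpret G: group ?G by (rule group_deck_group)
  interpret N: normal H ?G by (rule H)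
  define u where "u x = h (\<gamma> x) - h x" for x
  obtain C where C: "\<And>x. \<bar>h x\<bar> \<le> C" using h(2) by (auto simp: bounded_iff)
  have C0: "C \<ge> 0" using C[of x] by simp
  have uC: "\<bar>u x\<bar> \<le> 2 * C" for x using C[of x] C[of "\<gamma> x"] unfolding u_def by linarith
  have bu: "bounded (range u)" unfolding bounded_iff using uC by (auto intro!: exI[of _ "2 * C"])
  have hu: "L_harmonic u"
    using harm_lincomb[OF harm_deck[OF h(1) \<gamma>] h(1), of 1 "-1" 0] by (simp add: u_def[abs_def])
  define S where "S = Sup (range u)"
  have bdd: "bdd_above (range u)" using bu by (simp add: bounded_imp_bdd_above)
  have uS: "u x \<le> S" for x unfolding S_def by (intro cSup_upper bdd) auto
  have "u x > 0" using contr by (simp add: u_def)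
  then have S0: "S > 0" using uS[of x] by linarith
  \<comment> \<open>Since \<open>u \<ge> - 2 * C\<close>, this bounds \<open>S - u\<close>, and
    \<open>(S - u) / T\<close> takes values in [0, 1].\<close>
  define T where "T = S + 2 * C"
  have T0: "T > 0" using S0 C0 by (simp add: T_def)
  have "\<exists>k. 2 * C < real k * (S/2)"
    by (rule reals_Archimedean3[rule_format]) (use S0 in simp)
  then obtain k :: nat where k: "2 * C < real k * (S/2)" by blast
  define X where "X = {H #>\<^bsub>?G\<^esub> (x \<otimes>\<^bsub>?G\<^esub> \<gamma> \<otimes>\<^bsub>?G\<^esub> inv\<^bsub>?G\<^esub> x) | x. x \<in> \<Gamma>}"
  \<comment> \<open>An arbitrary but fixed choice for each coset; it is what makes \<open>Z\<close>
    finite and independent of \<open>a\<close>.\<close>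
  define rep where "rep Y = (SOME g. g \<in> Y)" for Y :: "('m \<Rightarrow> 'm) set"
  define z0 where "z0 = x"
  define Z where "Z = (\<lambda>(Y, j). (rep Y ^^ j) z0) ` (X \<times> {..<k})"
  have "finite Z" using fin by (simp add: Z_def X_def)
  moreover have "S / (2 * T) > 0" using S0 T0 by simp
  ultimately obtain \<epsilon> where \<epsilon>: "\<epsilon> > 0" "\<And>v. L_harmonic v \<Longrightarrow> (\<And>z. 0 \<le> v z \<and> v z \<le> 1) \<Longrightarrow> v z0 \<le> \<epsilon> \<Longrightarrow> (\<forall>z\<in>Z. v z \<le> S / (2 * T))"
    using weak_harnack_finite[OF conn, of Z "S / (2 * T)" z0] by blast
  obtain a where a: "a \<in> \<Gamma>" "\<And>x. u x \<le> u (a z0) + \<epsilon> * T"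
    using rec hu bu \<epsilon>(1) T0 unfolding fibre_recurrent_def by (meson mult_pos_pos)
  have "S \<le> u (a z0) + \<epsilon> * T" unfolding S_def by (intro cSup_least) (use a(2) in auto)
  define v where "v z = (- 1 / T) * (u \<circ> a) z + S / T" for z
  have v: "v z = (S - u (a z)) / T" for z by (simp add: v_def diff_divide_distrib)
  have "L_harmonic v" unfolding v_def[abs_def] by (intro harm_affine harm_deck hu a(1))
  moreover have "0 \<le> v z \<and> v z \<le> 1" for z
  proof -
    have "- 2 * C \<le> u (a z)" using uC[of "a z"] by linarith
    then show ?thesis using uS[of "a z"] T0 unfolding v by (auto simp: T_def)
  qed
  moreover have "v z0 \<le> \<epsilon>"
    using \<open>S \<le> u (a z0) + \<epsilon> * T\<close> T0 unfolding v by (simp add: field_simps)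
  ultimately have vZ: "\<forall>z\<in>Z. v z \<le> S / (2 * T)" by (rule \<epsilon>(2))
  have uZ: "u (a z) \<ge> S / 2" if "z \<in> Z" for z
    using bspec[OF vZ that] T0 unfolding v by (simp add: field_simps)
  have ia: "inv\<^bsub>?G\<^esub> a \<in> \<Gamma>" using a(1) by simp
  have aa: "inv\<^bsub>?G\<^esub> a \<circ> a = id" "a \<circ> inv\<^bsub>?G\<^esub> a = id"
    using G.l_inv[OF a(1)] G.r_inv[OF a(1)] by auto
  have ig: "inv\<^bsub>?G\<^esub> \<gamma> \<in> \<Gamma>" using \<gamma> by simp
  have gg: "(inv\<^bsub>?G\<^esub> \<gamma>) (\<gamma> y) = y" "\<gamma> ((inv\<^bsub>?G\<^esub> \<gamma>) y) = y" for y
    using G.l_inv[OF \<gamma>] G.r_inv[OF \<gamma>] by (auto simp: fun_eq_iff)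
  define c where "c = inv\<^bsub>?G\<^esub> a \<circ> \<gamma> \<circ> a"
  have c: "c \<in> \<Gamma>" using G.m_closed[OF G.m_closed[OF ia \<gamma>] a(1)] by (simp add: c_def)
  define Y where "Y = H #>\<^bsub>?G\<^esub> c"
  have YX: "Y \<in> X" unfolding X_def Y_def c_def
    using ia G.inv_inv[OF a(1)] by (auto intro!: exI[of _ "inv\<^bsub>?G\<^esub> a"])
  define f where "f = rep Y"
  have "c \<in> Y" unfolding Y_def by (rule G.rcos_self[OF c N.subgroup_axioms])
  then have "f \<in> Y" unfolding f_def rep_def by (rule someI[of "\<lambda>g. g \<in> Y"])
  then obtain \<eta> where \<eta>: "\<eta> \<in> H" "f = \<eta> \<circ> c" unfolding Y_def r_coset_def by auto
  have HG: "\<eta> \<in> \<Gamma>" if "\<eta> \<in> H" for \<eta> using N.subset that by blast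
  have i\<eta>: "inv\<^bsub>?G\<^esub> \<eta> \<in> H" using \<eta>(1) by simp
  have ci: "c y = (inv\<^bsub>?G\<^esub> \<eta>) (f y)" for y
    using G.l_inv[OF HG[OF \<eta>(1)]] \<eta>(2) by (auto simp: fun_eq_iff)
  \<comment> \<open>\<open>\<gamma> \<circ> a\<close> equals \<open>a \<circ> c\<close>, and
    \<open>c\<close> differs from \<open>f\<close> by an element of \<open>H\<close>. Thus \<gamma>
    takes \<open>a w\<close> to \<open>a (f w)\<close> up to \<open>H\<close>, and normality lets
    these factors be collected on the left.\<close>
  have orbit: "\<exists>\<eta>'\<in>H. (\<gamma> ^^ j) (a z0) = \<eta>' (a ((f ^^ j) z0))" for j
  proof (induction j)
    case 0
    show ?case using N.one_closed by (intro bexI[of _ id]) auto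
  next
    case (Suc j)
    then obtain \<eta>' where \<eta>': "\<eta>' \<in> H" "(\<gamma> ^^ j) (a z0) = \<eta>' (a ((f ^^ j) z0))" by blast
    define w where "w = (f ^^ j) z0"
    define \<mu> where "\<mu> = (\<gamma> \<circ> \<eta>' \<circ> inv\<^bsub>?G\<^esub> \<gamma>) \<circ> (a \<circ> inv\<^bsub>?G\<^esub> \<eta> \<circ> inv\<^bsub>?G\<^esub> a)"
    have "\<mu> \<in> H" unfolding \<mu>_def
      using N.m_closed[OF N.inv_op_closed2[OF \<gamma> \<eta>'(1)] N.inv_op_closed2[OF a(1) i\<eta>]] by simp
    moreover have "(\<gamma> ^^ Suc j) (a z0) = \<gamma> (\<eta>' (a w))" using \<eta>'(2) by (simp add: w_def)
    moreover have "\<mu> (a (f w)) = \<gamma> (\<eta>' (a w))"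
    proof -
      have "(inv\<^bsub>?G\<^esub> \<eta>) (f w) = (inv\<^bsub>?G\<^esub> a) (\<gamma> (a w))" using ci[of w] by (simp add: c_def)
      then show ?thesis using aa gg by (simp add: \<mu>_def fun_eq_iff)
    qed
    ultimately show ?case by (intro bexI[of _ \<mu>]) (simp_all add: w_def)
  qed
  \<comment> \<open>For the summand \<open>h \<circ> \<gamma>\<close>, invariance under \<eta> is
    invariance of \<open>h\<close> under the conjugate of \<eta> by \<gamma>, again an element of
    \<open>H\<close>.\<close>
  have uH: "u (\<eta> y) = u y" if "\<eta> \<in> H" for \<eta> y
  proof -
    have "\<gamma> \<circ> \<eta> \<circ> inv\<^bsub>?G\<^esub> \<gamma> \<in> H" using N.inv_op_closed2[OF \<gamma> that] by simp
    then have "(h \<circ> (\<gamma> \<circ> \<eta> \<circ> inv\<^bsub>?G\<^esub> \<gamma>)) (\<gamma> y) = h (\<gamma> y)" using Hinv[OF h] by metis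
    then have "h (\<gamma> (\<eta> y)) = h (\<gamma> y)" using gg by simp
    moreover have "h (\<eta> y) = h y" using Hinv[OF h that] by (metis comp_apply)
    ultimately show ?thesis by (simp add: u_def)
  qed
  have ge: "u ((\<gamma> ^^ j) (a z0)) \<ge> S / 2" if "j < k" for j
  proof -
    obtain \<eta>' where "\<eta>' \<in> H" "(\<gamma> ^^ j) (a z0) = \<eta>' (a ((f ^^ j) z0))" using orbit by blast
    moreover have "(f ^^ j) z0 \<in> Z" unfolding Z_def f_def using YX that by force
    ultimately show ?thesis using uH uZ by simp
  qed
  have "h ((\<gamma> ^^ j) (a z0)) - h (a z0) \<ge> real j * (S / 2)" if "j \<le> k" for j
    using that
  proof (induction j)
    case (Suc j)
    then show ?case using ge[of j] by (simp add: u_def algebra_simps add_divide_distrib)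
  qed auto
  from this[of k] k C[of "(\<gamma> ^^ k) (a z0)"] C[of "a z0"] show False by (simp add: abs_le_iff)
qed

text \<open>The induction runs over the set of deck transformations fixing every bounded harmonic
  function at once, since a step for one \<open>h\<close> uses \<open>H\<close>-invariance of
  \<open>h\<close>. The one-sided step is applied to \<open>h\<close> and to
  \<open>- h\<close>.\<close>

theorem invariance:
  assumes conn: "connected (UNIV :: 'm set)" and rec: fibre_recurrent
    and h: "L_harmonic h" "bounded (range h)" and \<gamma>: "\<gamma> \<in> FC_hypercenter (deck_group \<pi>)"
  shows "h \<circ> \<gamma> = h"
proof -
  interpret G: group "deck_group \<pi>" by (rule group_deck_group)
  let ?K = "{\<gamma> \<in> \<Gamma>. \<forall>h. L_harmonic h \<longrightarrow> bounded (range h) \<longrightarrow> h \<circ> \<gamma> = h}"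
  have "FC_hypercenter (deck_group \<pi>) \<subseteq> ?K"
  proof (rule G.FC_hypercenter_induct)
    show "\<one>\<^bsub>deck_group \<pi>\<^esub> \<in> ?K" using G.one_closed by simp
    fix H \<gamma>
    assume H: "H \<lhd> deck_group \<pi>" "H \<subseteq> ?K" and \<gamma>: "\<gamma> \<in> \<Gamma>"
      and fin: "finite {H #>\<^bsub>deck_group \<pi>\<^esub> (x \<otimes>\<^bsub>deck_group \<pi>\<^esub> \<gamma> \<otimes>\<^bsub>deck_group \<pi>\<^esub> inv\<^bsub>deck_group \<pi>\<^esub> x) | x. x \<in> \<Gamma>}"
    have Hinv: "h \<circ> \<eta> = h" if "L_harmonic h" "bounded (range h)" "\<eta> \<in> H" for h \<eta>
      using H(2) that by blast
    note le = invariance_step[OF conn rec H(1) Hinv \<gamma> fin]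
    have "h (\<gamma> x) = h x" if h: "L_harmonic h" "bounded (range h)" for h x
    proof -
      have "L_harmonic (\<lambda>x. - h x)" using harm_affine[OF h(1), of "-1" 0] by simp
      moreover have "bounded (range (\<lambda>x. - h x))" using h(2) by (simp add: bounded_iff)
      ultimately show ?thesis using le[of "\<lambda>x. - h x" x] le[OF _ _ _ h, of x] by force
    qed
    then show "\<gamma> \<in> ?K" using \<gamma> by auto
  qed
  then show ?thesis using \<gamma> h by blast
qed

text \<open>An invariant \<open>h\<close> is constant on the orbit of \<open>y\<close>, where it
  approaches its supremum; so \<open>y\<close>, which is arbitrary, is a maximum point.\<close>

theorem liouville:
  assumes conn: "connected (UNIV :: 'm set)" and rec: fibre_recurrent
    and FC: "FC_hypercentral (deck_group \<pi>)"
    and h: "L_harmonic h" "bounded (range h)"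
  shows "h constant_on UNIV"
proof -
  have inv: "h (\<gamma> x) = h x" if "\<gamma> \<in> \<Gamma>" for \<gamma> x
    using invariance[OF conn rec h, of \<gamma>] FC that unfolding FC_hypercentral_def by (metis comp_apply)
  have "h x \<le> h y" for x y
  proof (rule field_le_epsilon)
    fix \<epsilon> :: real assume "\<epsilon> > 0"
    then obtain \<gamma> where "\<gamma> \<in> \<Gamma>" "h x \<le> h (\<gamma> y) + \<epsilon>" using rec h unfolding fibre_recurrent_def by blast
    then show "h x \<le> h y + \<epsilon>" using inv by simp
  qed
  then have "h x = h y" for x y by (intro order_antisym)
  then show ?thesis unfolding constant_on_def by blast
qed

end

section \<open>Paths and the martingale problem\<close>

lemma path_open_times:
  assumes "\<omega> \<in> paths" "open U"
  shows "\<exists>T. open T \<and> {s. 0 \<le> s \<and> \<omega> s \<in> Some ` U} = {0..} \<inter> T"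
proof -
  have "openin (top_of_set {0..}) {s \<in> topspace (top_of_set {0..}). \<omega> s \<in> Some ` U}"
    by (rule openin_continuous_map_preimage[where Y = "Alexandroff_compactification euclidean"])
      (use assms in \<open>auto simp: paths_def\<close>)
  then show ?thesis unfolding openin_open by auto
qed

text \<open>Up to the hitting time the path avoids the absorbing cemetery, so by compactness it
  stays in a single \<open>\<Omega> K\<close>, and by continuity also for a short time afterwards,
  while it is still in \<open>U\<close>. A fine grid has a point in that short interval.
  \<open>N\<close> and \<open>n\<close> vary independently above \<open>k\<close> because the limit
  in \<open>n\<close> will be taken with \<open>N\<close> fixed.\<close>

lemma path_hits_on_grid:
  fixes \<Omega> :: "nat \<Rightarrow> 'n::topological_space set"
  assumes \<omega>: "\<omega> \<in> paths" and t: "0 \<le> t" "\<omega> t \<in> Some ` U" and U: "open U"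
    and \<Omega>: "\<And>K. open (\<Omega> K)" "mono \<Omega>" "(\<Union>K. \<Omega> K) = UNIV"
  shows "\<exists>k. \<forall>N\<ge>k. \<forall>n\<ge>k. \<exists>j<N * 2 ^ n. \<omega> (real j * (1 / 2 ^ n)) \<in> Some ` U \<and> (\<forall>i<j. \<omega> (real i * (1 / 2 ^ n)) \<in> Some ` \<Omega> N)"
proof -
  have "\<forall>K. \<exists>T. open T \<and> {s. 0 \<le> s \<and> \<omega> s \<in> Some ` \<Omega> K} = {0..} \<inter> T"
    using path_open_times[OF \<omega> \<Omega>(1)] by blast
  then obtain T where T: "\<And>K. open (T K)" "\<And>K. {s. 0 \<le> s \<and> \<omega> s \<in> Some ` \<Omega> K} = {0..} \<inter> T K"
    by metis
  obtain TU where TU: "open TU" "{s. 0 \<le> s \<and> \<omega> s \<in> Some ` U} = {0..} \<inter> TU"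
    using path_open_times[OF \<omega> U] by blast
  have inT: "\<omega> s \<in> Some ` \<Omega> K \<longleftrightarrow> s \<in> T K" if "0 \<le> s" for s K using T(2)[of K] that by auto
  have inTU: "\<omega> s \<in> Some ` U \<longleftrightarrow> s \<in> TU" if "0 \<le> s" for s using TU(2) that by auto
  have "{0..t} \<subseteq> (\<Union>K. T K)"
  proof
    fix s assume s: "s \<in> {0..t}"
    have "\<omega> s \<noteq> None"
    proof
      assume "\<omega> s = None"
      then have "\<omega> t = None" using \<omega> s unfolding paths_def by auto
      then show False using t(2) by auto
    qed
    then obtain q where "\<omega> s = Some q" by blast
    then show "s \<in> (\<Union>K. T K)" using \<Omega>(3) inT[of s] s by auto
  qed
  then obtain F where F: "finite F" "{0..t} \<subseteq> (\<Union>K\<in>F. T K)"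
    using compactE_image[of "{0..t}" UNIV T] T(1) by (metis compact_Icc)
  define K where "K = Max (insert 0 F)"
  have K: "s \<in> T K" if s: "s \<in> {0..t}" for s
  proof -
    obtain K' where K': "K' \<in> F" "s \<in> T K'" using F(2) s by blast
    then have "K' \<le> K" using F(1) unfolding K_def by (intro Max_ge) auto
    then have "\<Omega> K' \<subseteq> \<Omega> K" using \<Omega>(2) by (simp add: monoD)
    moreover have "\<omega> s \<in> Some ` \<Omega> K'" using inT[of s K'] K'(2) s by simp
    ultimately have "\<omega> s \<in> Some ` \<Omega> K" by blast
    then show ?thesis using inT[of s K] s by simp
  qed
  have "open (TU \<inter> T K)" "t \<in> TU \<inter> T K" using TU(1) T(1) inTU[OF t(1)] t K[of t] by auto
  then obtain e where e: "e > 0" "ball t e \<subseteq> TU \<inter> T K" by (rule openE)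
  obtain n0 where n0: "(1/2) ^ n0 < e" using real_arch_pow_inv[OF e(1), of "1/2"] by auto
  obtain N0 :: nat where N0: "t + e < real N0" using reals_Archimedean2 by blast
  show ?thesis
  proof (rule exI[of _ "max (max K N0) n0"], intro allI impI)
    fix N n assume N: "max (max K N0) n0 \<le> N" and n: "max (max K N0) n0 \<le> n"
    define p :: real where "p = 2 ^ n"
    have p: "p > 0" by (simp add: p_def)
    have "(1/2 :: real) ^ n \<le> (1/2) ^ n0" using n by (intro power_decreasing) auto
    then have pe: "1 / p < e" using n0 by (simp add: p_def power_divide)
    \<comment> \<open>The first grid time not before \<open>t\<close>; it exceeds \<open>t\<close>
      by less than \<open>e\<close>.\<close>
    define j where "j = nat \<lceil>t * p\<rceil>"
    have "0 \<le> t * p" using t p by simp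
    then have rj: "real j = real_of_int \<lceil>t * p\<rceil>" by (simp add: j_def)
    have j: "t * p \<le> real j" "real j < t * p + 1" unfolding rj by linarith+
    have jt: "t \<le> real j * (1 / p)" "real j * (1 / p) < t + e"
    proof -
      show "t \<le> real j * (1 / p)" using j(1) p by (simp add: field_simps)
      have "real j * (1 / p) < (t * p + 1) * (1 / p)" using j(2) p by (intro mult_strict_right_mono) auto
      also have "\<dots> = t + 1 / p" using p by (simp add: field_simps)
      finally show "real j * (1 / p) < t + e" using pe by linarith
    qed
    have near: "r \<in> TU" "r \<in> T K" if "t \<le> r" "r < t + e" for r
    proof -
      have "r \<in> ball t e" using that by (simp add: dist_real_def)
      then show "r \<in> TU" "r \<in> T K" using e(2) by blast+
    qed
    have 1: "\<omega> (real j * (1 / p)) \<in> Some ` U"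
      using near(1)[OF jt] inTU[of "real j * (1 / p)"] p by simp
    have "real j * (1 / p) < real N" using jt N0 N by linarith
    then have "real j < real N * p" using p by (simp add: field_simps)
    then have "real j < real (N * 2 ^ n)" by (simp add: p_def)
    then have 2: "j < N * 2 ^ n" by (simp only: of_nat_less_iff)
    have 3: "\<omega> (real i * (1 / p)) \<in> Some ` \<Omega> N" if i: "i < j" for i
    proof -
      have i0: "0 \<le> real i * (1 / p)" using p by simp
      have "real i * (1 / p) \<le> real j * (1 / p)" using i p by (intro mult_right_mono) auto
      then have "real i * (1 / p) < t + e" using jt(2) by linarith
      then have "real i * (1 / p) \<in> T K"
        using near(2) K[of "real i * (1 / p)"] i0 by (cases "real i * (1 / p) \<le> t") auto
      then have "\<omega> (real i * (1 / p)) \<in> Some ` \<Omega> K" using inT[OF i0] by blast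
      moreover have "\<Omega> K \<subseteq> \<Omega> N" using N \<Omega>(2) by (simp add: monoD)
      ultimately show ?thesis by blast
    qed
    show "\<exists>j<N * 2 ^ n. \<omega> (real j * (1 / 2 ^ n)) \<in> Some ` U \<and> (\<forall>i<j. \<omega> (real i * (1 / 2 ^ n)) \<in> Some ` \<Omega> N)"
      using 1 2 3 unfolding p_def by blast
  qed
qed

text \<open>Near 0 the preimage contains \<open>None\<close> and omits only a closed part of the
  compact support, so it is open in the compactification.\<close>

lemma continuous_map_ext0:
  fixes f :: "'n::t2_space \<Rightarrow> real"
  assumes "continuous_on UNIV f" "compact (closure {x. f x \<noteq> 0})"
  shows "continuous_map (Alexandroff_compactification euclidean) euclidean (ext0 f)"
  unfolding continuous_map_def
proof (intro conjI allI impI)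
  fix S :: "real set" assume "openin euclidean S"
  then have S: "open S" by simp
  let ?V = "{z \<in> topspace (Alexandroff_compactification euclidean). ext0 f z \<in> S}"
  have top: "topspace (Alexandroff_compactification (euclidean :: 'n topology)) = UNIV"
    by (auto simp: UNIV_option_conv)
  show "openin (Alexandroff_compactification euclidean) ?V"
  proof (cases "0 \<in> S")
    case True
    let ?C = "f -` (- S)"
    have cl: "closed ?C" by (rule closed_vimage) (use assms(1) S in auto)
    have "?C \<subseteq> closure {x. f x \<noteq> 0}" using True closure_subset by fastforce
    then have "compact ?C" using assms(2) cl compact_Int_closed[of "closure {x. f x \<noteq> 0}" ?C] by (simp add: Int_absorb1)
    moreover have "z \<in> ?V \<longleftrightarrow> z \<in> insert None (Some ` (topspace euclidean - ?C))" for z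
      unfolding top using True by (cases z) (auto simp: ext0_def)
    then have "?V = insert None (Some ` (topspace euclidean - ?C))" by blast
    ultimately show ?thesis
      unfolding openin_Alexandroff_compactification using cl by auto
  next
    case False
    have "z \<in> ?V \<longleftrightarrow> z \<in> Some ` (f -` S)" for z
      unfolding top using False by (cases z) (auto simp: ext0_def)
    then have "?V = Some ` (f -` S)" by blast
    then show ?thesis using assms(1) S by (simp add: open_vimage)
  qed
qed auto

lemma path_continuous:
  assumes "\<omega> \<in> paths" "continuous_map (Alexandroff_compactification euclidean) euclidean F"
  shows "continuous_on {0..} (\<lambda>t. F (\<omega> t))"
  using continuous_map_compose[of "top_of_set {0..}" "Alexandroff_compactification euclidean" \<omega> euclidean F] assms
  by (auto simp: paths_def o_def continuous_map_iff_continuous)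

section \<open>Measurability on path space\<close>

lemma space_path_algebra [simp]: "space (path_algebra I) = paths"
  by (simp add: path_algebra_def space_measure_of_conv)

lemma sets_path_algebra: "sets (path_algebra I) = sigma_sets paths
    {{\<omega> \<in> paths. \<omega> t \<in> V} | t V. t \<in> I \<and> openin (Alexandroff_compactification euclidean) V}"
  unfolding path_algebra_def by (rule sets_measure_of) auto

lemma sets_path_algebra_mono: "I \<subseteq> J \<Longrightarrow> sets (path_algebra I) \<subseteq> sets (path_algebra J)"
  unfolding sets_path_algebra by (rule sigma_sets_mono') auto

lemma path_event:
  "t \<in> I \<Longrightarrow> openin (Alexandroff_compactification euclidean) V \<Longrightarrow> {\<omega> \<in> paths. \<omega> t \<in> V} \<in> sets (path_algebra I)"
  unfolding sets_path_algebra by (rule sigma_sets.Basic) blast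

text \<open>Stated for lower semicontinuous functions: superlevel sets for \<open>c \<ge> 0\<close>
  are open and avoid the cemetery, those for \<open>c < 0\<close> are everything.\<close>

lemma ext0_measurable:
  assumes "\<And>c. open {x. c < f x}" "\<And>x. 0 \<le> f x" "t \<in> I"
  shows "(\<lambda>\<omega>. ext0 f (\<omega> t)) \<in> borel_measurable (path_algebra I)"
  unfolding borel_measurable_iff_greater
proof (intro allI)
  fix c
  show "{\<omega> \<in> space (path_algebra I). c < ext0 f (\<omega> t)} \<in> sets (path_algebra I)"
  proof (cases "c < 0")
    case True
    then have "{\<omega> \<in> space (path_algebra I). c < ext0 f (\<omega> t)} = space (path_algebra I)"
      using assms(2) by (auto simp: ext0_def split: option.splits intro: less_le_trans)
    then show ?thesis by (simp only: sets.top)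
  next
    case False
    then have "c < ext0 f z \<longleftrightarrow> z \<in> Some ` {x. c < f x}" for z
      by (cases z) (auto simp: ext0_def)
    then have "{\<omega> \<in> space (path_algebra I). c < ext0 f (\<omega> t)} = {\<omega> \<in> paths. \<omega> t \<in> Some ` {x. c < f x}}"
      by simp
    then show ?thesis using path_event[OF assms(3), of "Some ` {x. c < f x}"] assms(1) by simp
  qed
qed

lemma continuous_ext0_measurable:
  assumes F: "continuous_map (Alexandroff_compactification euclidean) euclidean (F :: _ \<Rightarrow> real)" and "t \<in> I"
  shows "(\<lambda>\<omega>. F (\<omega> t)) \<in> borel_measurable (path_algebra I)"
  unfolding borel_measurable_iff_greater
proof (intro allI)
  fix c
  have top: "topspace (Alexandroff_compactification (euclidean :: 'a topology)) = UNIV"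
    by (auto simp: UNIV_option_conv)
  have "openin (Alexandroff_compactification euclidean) {z. F z \<in> {c<..}}"
    using F unfolding continuous_map_def top by (metis (no_types, lifting) Collect_cong UNIV_I open_greaterThan open_openin)
  from path_event[OF assms(2) this]
  show "{\<omega> \<in> space (path_algebra I). c < F (\<omega> t)} \<in> sets (path_algebra I)" by simp
qed

text \<open>Time is approximated by multiples of \<open>1 / Suc n\<close>, of which there are
  countably many, and continuity of paths gives the limit. \<open>max 0 r\<close> extends the
  evaluation to negative times, so that Fubini can be used with Lebesgue measure on the
  line.\<close>

lemma path_jointly_measurable:
  fixes F :: "'n::t2_space option \<Rightarrow> real"
  assumes F: "continuous_map (Alexandroff_compactification euclidean) euclidean F" and P: "sets P = sets (path_algebra {0..})"
  shows "(\<lambda>(\<omega>, r). F (\<omega> (max 0 r))) \<in> borel_measurable (P \<Otimes>\<^sub>M lborel)"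
proof (rule borel_measurable_LIMSEQ_real)
  let ?u = "\<lambda>n z. F (fst z (max 0 (real_of_int \<lceil>real (Suc n) * snd z\<rceil> / real (Suc n))))"
  have meas: "(\<lambda>\<omega>. F (\<omega> t)) \<in> borel_measurable P" if "t \<ge> 0" for t
    using continuous_ext0_measurable[OF F, of t "{0..}"] that measurable_cong_sets[OF P refl] by auto
  show "?u n \<in> borel_measurable (P \<Otimes>\<^sub>M lborel)" for n
  proof (rule measurable_compose_countable[where g = "\<lambda>z. \<lceil>real (Suc n) * snd z\<rceil>"])
    show "(\<lambda>z. F (fst z (max 0 (real_of_int i / real (Suc n))))) \<in> borel_measurable (P \<Otimes>\<^sub>M lborel)" for i
      by (rule measurable_compose[OF measurable_fst meas]) simp
    show "(\<lambda>z. \<lceil>real (Suc n) * snd z\<rceil>) \<in> measurable (P \<Otimes>\<^sub>M lborel) (count_space UNIV)"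
      by measurable
  qed
  fix z assume "z \<in> space (P \<Otimes>\<^sub>M (lborel :: real measure))"
  then have "fst z \<in> space P" unfolding space_pair_measure by (simp add: mem_Times_iff)
  then have "fst z \<in> paths" unfolding sets_eq_imp_space_eq[OF P] space_path_algebra .
  then have cont: "continuous_on {0..} (\<lambda>t. F (fst z t))" by (rule path_continuous[OF _ F])
  let ?r = "snd z" and ?q = "\<lambda>n. real_of_int \<lceil>real (Suc n) * snd z\<rceil> / real (Suc n)"
  have b: "?r \<le> ?q n" "?q n \<le> ?r + 1 / real (Suc n)" for n
  proof -
    define m where "m = real (Suc n)"
    have m: "m > 0" by (simp add: m_def)
    have "m * ?r \<le> real_of_int \<lceil>m * ?r\<rceil>" "real_of_int \<lceil>m * ?r\<rceil> \<le> m * ?r + 1"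
      by (rule le_of_int_ceiling, rule of_int_ceiling_le_add_one)
    then have "?r \<le> real_of_int \<lceil>m * ?r\<rceil> / m" "real_of_int \<lceil>m * ?r\<rceil> / m \<le> ?r + 1 / m"
      using m by (simp_all add: field_simps)
    then show "?r \<le> ?q n" "?q n \<le> ?r + 1 / real (Suc n)" by (simp_all only: m_def)
  qed
  have "(\<lambda>n. ?r + 1 / real (Suc n)) \<longlonglongrightarrow> ?r + 0"
    by (intro tendsto_intros LIMSEQ_Suc[OF lim_1_over_n])
  then have "?q \<longlonglongrightarrow> ?r"
    using b by (intro tendsto_sandwich[of "\<lambda>_. ?r" ?q sequentially]) (auto intro!: always_eventually)
  then have "(\<lambda>n. max 0 (?q n)) \<longlonglongrightarrow> max 0 ?r" by (intro tendsto_intros)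
  then have "(\<lambda>n. F (fst z (max 0 (?q n)))) \<longlonglongrightarrow> F (fst z (max 0 ?r))"
    by (intro continuous_on_tendsto_compose[OF cont]) auto
  then show "(\<lambda>n. ?u n z) \<longlonglongrightarrow> (case z of (\<omega>, r) \<Rightarrow> F (\<omega> (max 0 r)))"
    by (simp add: case_prod_beta)
qed

lemma LBINT_difference_lower:
  fixes \<phi> \<psi> :: "real \<Rightarrow> real"
  assumes "continuous_on {0..} \<phi>" "continuous_on {0..} \<psi>" "0 \<le> s" "s \<le> t" "\<And>r. r \<ge> 0 \<Longrightarrow> \<psi> r \<le> \<phi> r"
  shows "(LBINT r:{0..t}. \<phi> r) - (LBINT r:{0..s}. \<phi> r) \<ge> (LBINT r:{s<..t}. \<psi> r)"
proof -
  have int: "set_integrable lborel S \<phi>'" if "continuous_on {0..} \<phi>'" "S \<subseteq> {0..t}" "S \<in> sets lborel" for \<phi>' :: "real \<Rightarrow> real" and S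
    by (rule set_integrable_subset[OF borel_integrable_atLeastAtMost'[of 0 t]])
      (use that in \<open>auto intro: continuous_on_subset\<close>)
  have "{0..t} = {0..s} \<union> {s<..t}" using assms by auto
  then have "(LBINT r:{0..t}. \<phi> r) = (LBINT r:{0..s}. \<phi> r) + (LBINT r:{s<..t}. \<phi> r)"
    using assms by (simp only:) (rule set_integral_Un, auto intro!: int)
  moreover have "(LBINT r:{s<..t}. \<psi> r) \<le> (LBINT r:{s<..t}. \<phi> r)"
    using assms by (intro set_integral_mono int) auto
  ultimately show ?thesis by simp
qed

text \<open>One starting point, with continuity at the cemetery recorded for test functions and
  their images under \<open>L\<close>. The estimates that follow use the manifold only through these
  facts.\<close>

locale martingale_solution =
  fixes B :: "('n::{t2_space,second_countable_topology}, 'e::euclidean_space) chart set"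
    and L :: "('n \<Rightarrow> real) \<Rightarrow> 'n \<Rightarrow> real" and P :: "(real \<Rightarrow> 'n option) measure" and x0 :: 'n
  assumes P: "prob_space P" and setsP: "sets P = sets (path_algebra {0..})"
    and start: "AE \<omega> in P. \<omega> 0 = Some x0"
    and mart: "\<And>f. test_fun B f \<Longrightarrow> martingale P (\<lambda>t. path_algebra {0..t})
             (\<lambda>t \<omega>. ext0 f (\<omega> t) - ext0 f (\<omega> 0) - (LBINT r:{0..t}. ext0 (L f) (\<omega> r)))"
    and test_cont: "\<And>f. test_fun B f \<Longrightarrow> continuous_map (Alexandroff_compactification euclidean) euclidean (ext0 f)"
    and test_L_cont: "\<And>f. test_fun B f \<Longrightarrow> continuous_map (Alexandroff_compactification euclidean) euclidean (ext0 (L f))"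
begin

interpretation P: prob_space P by (rule P)

abbreviation "\<F> t \<equiv> path_algebra {0..t::real} :: (real \<Rightarrow> 'n option) measure"

lemma spaceP: "space P = paths"
  using sets_eq_imp_space_eq[OF setsP] by simp

lemma sets_F: "E \<in> sets (\<F> t) \<Longrightarrow> E \<in> sets P"
  using sets_path_algebra_mono[of "{0..t}" "{0..}"] setsP by auto

lemma subalg: "subalgebra P (\<F> t)"
  unfolding subalgebra_def using spaceP sets_F by auto

lemma measurable_F: "f \<in> borel_measurable (\<F> t) \<Longrightarrow> f \<in> borel_measurable P"
  by (rule measurable_from_subalg[OF subalg])

lemma set_integrable_bounded:
  fixes f :: "_ \<Rightarrow> real"
  assumes "f \<in> borel_measurable P" "\<And>\<omega>. \<omega> \<in> paths \<Longrightarrow> \<bar>f \<omega>\<bar> \<le> C" "E \<in> sets P"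
  shows "set_integrable P E f"
proof -
  have "integrable P f"
    by (rule P.integrable_const_bound[of _ C]) (use assms spaceP in auto)
  then show ?thesis unfolding set_integrable_def by (rule integrable_mult_indicator[OF assms(3)])
qed

lemma ext0_test_measurable: "test_fun B f \<Longrightarrow> 0 \<le> t \<Longrightarrow> (\<lambda>\<omega>. ext0 f (\<omega> t)) \<in> borel_measurable P"
  using continuous_ext0_measurable[OF test_cont, of f t "{0..t}"] measurable_F by auto

lemma ext0_test_bounded:
  assumes "test_fun B f"
  obtains C where "\<And>z. \<bar>ext0 f z\<bar> \<le> C"
proof -
  have "compact (ext0 f ` UNIV)"
    using image_compactin[OF _ test_cont[OF assms], of UNIV] compact_space_Alexandroff_compactification[of "euclidean :: 'n topology"]
    unfolding compact_space_def by (auto simp: UNIV_option_conv)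
  then have "bounded (range (ext0 f))" by (rule compact_imp_bounded)
  then show thesis using that by (auto simp: bounded_iff)
qed

text \<open>Integrating the martingale identity over an event of the past at time \<open>s\<close>
  removes the conditional expectation; \<Delta> is the accumulated drift.\<close>

lemma increment:
  assumes f: "test_fun B f" and st: "0 \<le> s" "s \<le> t" and E: "E \<in> sets (\<F> s)"
  defines "\<Delta> \<equiv> \<lambda>\<omega>. (LBINT r:{0..t}. ext0 (L f) (\<omega> r)) - (LBINT r:{0..s}. ext0 (L f) (\<omega> r))"
  shows "(\<integral>\<omega>\<in>E. (ext0 f (\<omega> t) - ext0 f (\<omega> s) - \<Delta> \<omega>) \<partial>P) = 0"
    and "set_integrable P E (\<lambda>\<omega>. ext0 f (\<omega> t) - ext0 f (\<omega> s))" and "set_integrable P E \<Delta>"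
proof -
  let ?X = "\<lambda>t \<omega>. ext0 f (\<omega> t) - ext0 f (\<omega> 0) - (LBINT r:{0..t}. ext0 (L f) (\<omega> r))"
  have int: "integrable P (?X u)" if "u \<ge> 0" for u
    using mart[OF f] that unfolding martingale_def by blast
  have EP: "E \<in> sets P" by (rule sets_F[OF E])
  have si: "set_integrable P E (?X u)" if "u \<ge> 0" for u
    unfolding set_integrable_def using int[OF that] EP by (rule integrable_mult_indicator[rotated])
  interpret finite_measure_subalgebra P "\<F> s"
    by unfold_locales (rule subalg)
  have "(\<integral>\<omega>\<in>E. ?X t \<omega> \<partial>P) = (\<integral>\<omega>\<in>E. real_cond_exp P (\<F> s) (?X t) \<omega> \<partial>P)"
    using int[of t] st E by (intro real_cond_exp_intA) auto
  also have "\<dots> = (\<integral>\<omega>\<in>E. ?X s \<omega> \<partial>P)"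
  proof -
    have ae: "AE \<omega> in P. real_cond_exp P (\<F> s) (?X t) \<omega> = ?X s \<omega>"
      using mart[OF f] st unfolding martingale_def by blast
    show ?thesis
      by (rule set_lebesgue_integral_cong_AE)
        (use EP ae borel_measurable_integrable[OF int[OF st(1)]] in auto)
  qed
  finally have "(\<integral>\<omega>\<in>E. (?X t \<omega> - ?X s \<omega>) \<partial>P) = 0"
    using si[of t] si[of s] st by (subst set_integral_diff) auto
  moreover have diff: "?X t \<omega> - ?X s \<omega> = ext0 f (\<omega> t) - ext0 f (\<omega> s) - \<Delta> \<omega>" for \<omega>
    by (simp add: \<Delta>_def)
  ultimately show "(\<integral>\<omega>\<in>E. (ext0 f (\<omega> t) - ext0 f (\<omega> s) - \<Delta> \<omega>) \<partial>P) = 0" by simp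
  obtain C where C: "\<And>z. \<bar>ext0 f z\<bar> \<le> C" using ext0_test_bounded[OF f] by blast
  have "\<bar>ext0 f (\<omega> t) - ext0 f (\<omega> s)\<bar> \<le> 2 * C" for \<omega>
    using C[of "\<omega> t"] C[of "\<omega> s"] by linarith
  then show i1: "set_integrable P E (\<lambda>\<omega>. ext0 f (\<omega> t) - ext0 f (\<omega> s))"
    using st by (intro set_integrable_bounded[OF _ _ EP] borel_measurable_diff ext0_test_measurable f) auto
  have "set_integrable P E (\<lambda>\<omega>. (ext0 f (\<omega> t) - ext0 f (\<omega> s)) - (?X t \<omega> - ?X s \<omega>))"
    by (rule set_integral_diff(1)[OF i1 set_integral_diff(1)[OF si[of t] si[of s]]]) (use st in auto)
  then show "set_integrable P E \<Delta>" unfolding diff by simp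
qed

lemma L_path_continuous: "test_fun B f \<Longrightarrow> \<omega> \<in> paths \<Longrightarrow> continuous_on {0..} (\<lambda>r. ext0 (L f) (\<omega> r))"
  by (rule path_continuous[OF _ test_L_cont])

text \<open>On \<open>E\<close> the cutoff starts at its level \<open>c\<close> and its drift is at
  least \<open>- Q\<close>, so its mean deficit at time \<open>r\<close> is at most
  \<open>Q * (r - s) * measure P E\<close>. By Fubini the deficit accumulated in a step is quadratic
  in the length of the step. This takes the place of stopping the process when it leaves the region
  where \<theta> equals \<open>c\<close>.\<close>

lemma occupation_bound:
  assumes \<theta>: "test_fun B \<theta>" and st: "0 \<le> s" "s \<le> t" and E: "E \<in> sets (\<F> s)"
    and c: "0 \<le> c" and Q: "0 \<le> Q" and L\<theta>: "\<And>q. - Q \<le> L \<theta> q"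
    and on_E: "\<And>\<omega>. \<omega> \<in> E \<Longrightarrow> ext0 \<theta> (\<omega> s) = c"
  defines "J \<equiv> \<lambda>\<omega>. LBINT r:{s<..t}. c - ext0 \<theta> (\<omega> r)"
  shows "(\<integral>\<omega>\<in>E. J \<omega> \<partial>P) \<le> Q * (t - s)\<^sup>2 * measure P E" and "set_integrable P E J"
proof -
  interpret PL: pair_sigma_finite P lborel ..
  have EP: "E \<in> sets P" by (rule sets_F[OF E])
  obtain C where C: "\<And>z. \<bar>ext0 \<theta> z\<bar> \<le> C" using ext0_test_bounded[OF \<theta>] by blast
  define f where "f \<omega> r = indicator E \<omega> * (indicator {s<..t} r * (c - ext0 \<theta> (\<omega> (max 0 r))))" for \<omega> and r :: real
  note [measurable] = path_jointly_measurable[OF test_cont[OF \<theta>] setsP] EP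
  have int: "integrable (P \<Otimes>\<^sub>M lborel) (case_prod f)"
  proof (rule integrableI_bounded_set[where A = "E \<times> {s<..t}" and B = "\<bar>c\<bar> + C"])
    show "E \<times> {s<..t} \<in> sets (P \<Otimes>\<^sub>M lborel)" by measurable
    show "case_prod f \<in> borel_measurable (P \<Otimes>\<^sub>M lborel)"
    proof -
      have "(\<lambda>z. indicator E (fst z) * (indicator {s<..t} (snd z) * (c - (case z of (\<omega>, r) \<Rightarrow> ext0 \<theta> (\<omega> (max 0 r)))))) \<in> borel_measurable (P \<Otimes>\<^sub>M lborel)"
        by measurable
      then show ?thesis by (simp add: f_def case_prod_beta' cong: measurable_cong)
    qed
    show "emeasure (P \<Otimes>\<^sub>M lborel) (E \<times> {s<..t}) < \<infinity>"
      using EP st by (subst lborel.emeasure_pair_measure_Times) (auto simp: P.emeasure_eq_measure ennreal_mult_less_top)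
    show "AE z in P \<Otimes>\<^sub>M lborel. z \<in> E \<times> {s<..t} \<longrightarrow> norm (case_prod f z) \<le> \<bar>c\<bar> + C"
    proof (intro AE_I2 impI)
      fix z assume "z \<in> E \<times> {s<..t}"
      then show "norm (case_prod f z) \<le> \<bar>c\<bar> + C"
        using C[of "fst z (max 0 (snd z))"] by (auto simp: f_def split: prod.splits)
    qed
    show "AE z in P \<Otimes>\<^sub>M lborel. z \<notin> E \<times> {s<..t} \<longrightarrow> case_prod f z = 0"
      by (intro AE_I2 impI) (auto simp: f_def split: prod.splits split_indicator)
  qed
  have fJ: "(\<integral>r. f \<omega> r \<partial>lborel) = indicator E \<omega> *\<^sub>R J \<omega>" for \<omega>
  proof -
    have "(\<integral>r. f \<omega> r \<partial>lborel) = (\<integral>r. indicator E \<omega> * (indicator {s<..t} r *\<^sub>R (c - ext0 \<theta> (\<omega> r))) \<partial>lborel)"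
      using st(1) by (intro Bochner_Integration.integral_cong) (auto simp: f_def max_def split: split_indicator)
    then show ?thesis by (simp add: J_def set_lebesgue_integral_def)
  qed
  show "set_integrable P E J"
    using PL.integrable_fst[OF int] unfolding fJ set_integrable_def .
  have "(\<integral>\<omega>\<in>E. J \<omega> \<partial>P) = (\<integral>\<omega>. (\<integral>r. f \<omega> r \<partial>lborel) \<partial>P)"
    unfolding fJ set_lebesgue_integral_def ..
  also have "\<dots> = (\<integral>r. (\<integral>\<omega>. f \<omega> r \<partial>P) \<partial>lborel)"
    by (rule PL.Fubini_integral[OF int, symmetric])
  also have "\<dots> \<le> (\<integral>r. indicator {s<..t} r * (Q * (t - s) * measure P E) \<partial>lborel)"
  proof (rule integral_mono)
    show "integrable lborel (\<lambda>r. \<integral>\<omega>. f \<omega> r \<partial>P)" by (rule PL.integrable_snd[OF int])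
    show "integrable lborel (\<lambda>r. indicator {s<..t} r * (Q * (t - s) * measure P E))"
      using st by (intro integrable_mult_left integrable_real_indicator) auto
    fix r :: real
    show "(\<integral>\<omega>. f \<omega> r \<partial>P) \<le> indicator {s<..t} r * (Q * (t - s) * measure P E)"
    proof (cases "r \<in> {s<..t}")
      case True
      then have r: "s \<le> r" "r \<le> t" "0 \<le> r" using st by auto
      define \<Delta> where "\<Delta> \<omega> = (LBINT u:{0..r}. ext0 (L \<theta>) (\<omega> u)) - (LBINT u:{0..s}. ext0 (L \<theta>) (\<omega> u))" for \<omega>
      note inc = increment[OF \<theta> st(1) r(1) E, folded \<Delta>_def[abs_def] \<Delta>_def]
      have low: "- Q * (r - s) \<le> \<Delta> \<omega>" if "\<omega> \<in> paths" for \<omega>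
      proof -
        have "(LBINT u:{s<..r}. - Q) \<le> \<Delta> \<omega>" unfolding \<Delta>_def
          using L\<theta> Q by (intro LBINT_difference_lower L_path_continuous[OF \<theta> that] st r) (auto simp: ext0_def split: option.splits)
        moreover have "(LBINT u:{s<..r}. - Q) = - Q * (r - s)" using r by (simp add: set_lebesgue_integral_def)
        ultimately show ?thesis by simp
      qed
      have Epaths: "\<omega> \<in> paths" if "\<omega> \<in> E" for \<omega> using sets.sets_into_space[OF EP] spaceP that by auto
      have "(\<integral>\<omega>\<in>E. - Q * (r - s) \<partial>P) \<le> (\<integral>\<omega>\<in>E. \<Delta> \<omega> \<partial>P)"
        by (intro set_integral_mono inc(3) set_integrable_bounded[where C = "\<bar>Q * (r - s)\<bar>"] EP low Epaths) auto
      also have "\<dots> = (\<integral>\<omega>\<in>E. (ext0 \<theta> (\<omega> r) - ext0 \<theta> (\<omega> s)) \<partial>P)"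
        using inc(1) set_integral_diff(2)[OF inc(2,3)] by simp
      finally have 1: "- Q * (r - s) * measure P E \<le> (\<integral>\<omega>\<in>E. (ext0 \<theta> (\<omega> r) - ext0 \<theta> (\<omega> s)) \<partial>P)"
        using EP by (simp add: set_lebesgue_integral_def mult.commute mult.left_commute)
      have "(\<integral>\<omega>. f \<omega> r \<partial>P) = (\<integral>\<omega>\<in>E. - (ext0 \<theta> (\<omega> r) - ext0 \<theta> (\<omega> s)) \<partial>P)"
        unfolding set_lebesgue_integral_def using True r on_E
        by (intro Bochner_Integration.integral_cong) (auto simp: f_def max_def split: split_indicator)
      also have "\<dots> = - (\<integral>\<omega>\<in>E. (ext0 \<theta> (\<omega> r) - ext0 \<theta> (\<omega> s)) \<partial>P)"
        by (rule set_integral_uminus[OF inc(2)])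
      also have "\<dots> \<le> Q * (r - s) * measure P E" using 1 by simp
      also have "\<dots> \<le> Q * (t - s) * measure P E" using r Q by (intro mult_right_mono mult_left_mono) auto
      finally show ?thesis using True by simp
    qed (simp add: f_def)
  qed
  also have "\<dots> = Q * (t - s)\<^sup>2 * measure P E" using st by (simp add: power2_eq_square)
  finally show "(\<integral>\<omega>\<in>E. J \<omega> \<partial>P) \<le> Q * (t - s)\<^sup>2 * measure P E" .
qed

text \<open>The drift of \<open>g\<close> may be negative only in proportion to the deficit of
  \<theta>, so the mean loss is at most \<open>Q\<close> times the accumulated deficit.\<close>

lemma test_step:
  assumes \<theta>: "test_fun B \<theta>" and g: "test_fun B g" and st: "0 \<le> s" "s \<le> t" and E: "E \<in> sets (\<F> s)"
    and c: "0 \<le> c" and Q: "0 \<le> Q" and L\<theta>: "\<And>q. - Q \<le> L \<theta> q" and Lg: "\<And>q. - Q * (c - \<theta> q) \<le> L g q"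
    and on_E: "\<And>\<omega>. \<omega> \<in> E \<Longrightarrow> ext0 \<theta> (\<omega> s) = c"
  shows "- Q\<^sup>2 * (t - s)\<^sup>2 * measure P E \<le> (\<integral>\<omega>\<in>E. (ext0 g (\<omega> t) - ext0 g (\<omega> s)) \<partial>P)"
proof -
  define J where "J \<omega> = (LBINT r:{s<..t}. c - ext0 \<theta> (\<omega> r))" for \<omega>
  have occ: "(\<integral>\<omega>\<in>E. J \<omega> \<partial>P) \<le> Q * (t - s)\<^sup>2 * measure P E" "set_integrable P E J"
    unfolding J_def[abs_def]
    by (rule occupation_bound[of \<theta> s t E c Q]; use \<theta> st E c Q L\<theta> on_E in blast)+
  define \<Delta> where "\<Delta> \<omega> = (LBINT u:{0..t}. ext0 (L g) (\<omega> u)) - (LBINT u:{0..s}. ext0 (L g) (\<omega> u))" for \<omega>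
  note inc = increment[OF g st E, folded \<Delta>_def[abs_def] \<Delta>_def]
  have low: "- Q * J \<omega> \<le> \<Delta> \<omega>" if "\<omega> \<in> E" for \<omega>
  proof -
    have \<omega>: "\<omega> \<in> paths" using sets.sets_into_space[OF sets_F[OF E]] spaceP that by auto
    have "(LBINT r:{s<..t}. - Q * (c - ext0 \<theta> (\<omega> r))) \<le> \<Delta> \<omega>" unfolding \<Delta>_def
    proof (intro LBINT_difference_lower L_path_continuous[OF g \<omega>] st continuous_intros path_continuous[OF \<omega> test_cont[OF \<theta>]])
      \<comment> \<open>At the cemetery the right-hand side is 0 and the cutoff is 0, and the
        inequality holds because \<open>c\<close> and \<open>Q\<close> are nonnegative.\<close>
      show "- Q * (c - ext0 \<theta> (\<omega> r)) \<le> ext0 (L g) (\<omega> r)" for r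
        using Lg c Q by (auto simp: ext0_def split: option.splits)
    qed
    moreover have "(LBINT r:{s<..t}. - Q * (c - ext0 \<theta> (\<omega> r))) = - Q * J \<omega>"
      unfolding J_def by (rule set_integral_mult_right)
    ultimately show ?thesis by simp
  qed
  have "- Q * (Q * (t - s)\<^sup>2 * measure P E) \<le> - Q * (\<integral>\<omega>\<in>E. J \<omega> \<partial>P)"
    using occ(1) Q by (intro mult_left_mono_neg) auto
  also have "\<dots> = (\<integral>\<omega>\<in>E. - Q * J \<omega> \<partial>P)" by (rule set_integral_mult_right[symmetric])
  also have "\<dots> \<le> (\<integral>\<omega>\<in>E. \<Delta> \<omega> \<partial>P)"
    by (intro set_integral_mono inc(3) set_integrable_mult_right occ(2) low)
  also have "\<dots> = (\<integral>\<omega>\<in>E. (ext0 g (\<omega> t) - ext0 g (\<omega> s)) \<partial>P)"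
    using inc(1) set_integral_diff(2)[OF inc(2,3)] by simp
  finally show ?thesis by (simp add: power2_eq_square algebra_simps)
qed

end

text \<open>Local subharmonicity of a non-smooth \<open>h\<close>: on \<open>V\<close> it is a
  supremum of test functions lying below it everywhere, whose negative drift is controlled by the
  deficit of one cutoff \<theta> with plateau \<open>V\<close>. A common \<open>Q\<close> and
  \<theta> make the loss independent of the competitor chosen, and countability makes the choice
  measurable.\<close>

definition submartingale_chart where
  "submartingale_chart B L h V Q c \<theta> \<G> \<longleftrightarrow>
     open V \<and> countable \<G> \<and> test_fun B \<theta> \<and> 0 \<le> Q \<and> 0 \<le> c \<and> (\<forall>q. - Q \<le> L \<theta> q) \<and> (\<forall>q\<in>V. \<theta> q = c) \<and>
     (\<forall>g\<in>\<G>. test_fun B g \<and> (\<forall>q. g q \<le> h q \<and> - Q * (c - \<theta> q) \<le> L g q)) \<and>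
     (\<forall>q\<in>V. \<forall>\<eta>>0. \<exists>g\<in>\<G>. h q \<le> g q + \<eta>)"

section \<open>Submartingale estimates on a time grid\<close>

context martingale_solution
begin

interpretation P: prob_space P by (rule P)

context
  fixes h :: "'n \<Rightarrow> real"
  assumes h_lsc: "\<And>c. open {x. c < h x}" and h01: "\<And>x. 0 \<le> h x" "\<And>x. h x \<le> 1"
begin

lemma ext0_h_measurable: "0 \<le> r \<Longrightarrow> r \<le> t \<Longrightarrow> (\<lambda>\<omega>. ext0 h (\<omega> r)) \<in> borel_measurable (\<F> t)"
  by (rule ext0_measurable[OF h_lsc h01(1)]) simp

lemma ext0_h_measurable': "0 \<le> r \<Longrightarrow> (\<lambda>\<omega>. ext0 h (\<omega> r)) \<in> borel_measurable P"
  using ext0_h_measurable[of r r] measurable_F by simp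

lemma ext0_h01: "0 \<le> ext0 h z" "ext0 h z \<le> 1"
  using h01 by (auto simp: ext0_def split: option.splits)

lemma step_integrable:
  assumes "0 \<le> t" "0 < \<delta>" "E \<in> sets P"
  shows "set_integrable P E (\<lambda>\<omega>. ext0 h (\<omega> (t + \<delta>)) - ext0 h (\<omega> t) + K)"
proof (rule set_integrable_bounded[OF _ _ assms(3)])
  show "(\<lambda>\<omega>. ext0 h (\<omega> (t + \<delta>)) - ext0 h (\<omega> t) + K) \<in> borel_measurable P"
    using assms by (intro borel_measurable_add borel_measurable_diff ext0_h_measurable') auto
  show "\<bar>ext0 h (\<omega> (t + \<delta>)) - ext0 h (\<omega> t) + K\<bar> \<le> 2 + \<bar>K\<bar>" for \<omega>
    using ext0_h01[of "\<omega> (t + \<delta>)"] ext0_h01[of "\<omega> t"] by linarith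
qed

text \<open>\<open>E\<close> is divided according to the first competitor within
  \<open>\<delta>\<^sup>2\<close> of \<open>h\<close> at time \<open>t\<close>. As it stays below
  \<open>h\<close> at the later time, replacing \<open>h\<close> by it costs
  \<open>\<delta>\<^sup>2\<close>, and its own drift another
  \<open>Q\<^sup>2 * \<delta>\<^sup>2\<close>; hence the bound \<open>1 + Q\<^sup>2\<close> on
  \<open>C\<close>.\<close>

lemma chart_step:
  assumes ch: "submartingale_chart B L h V Q c \<theta> \<G>" and t: "0 \<le> t" and \<delta>: "0 < \<delta>"
    and E: "E \<in> sets (\<F> t)" "\<And>\<omega>. \<omega> \<in> E \<Longrightarrow> \<omega> t \<in> Some ` V" and C: "1 + Q\<^sup>2 \<le> C"
  shows "0 \<le> (\<integral>\<omega>\<in>E. (ext0 h (\<omega> (t + \<delta>)) - ext0 h (\<omega> t) + C * \<delta>\<^sup>2) \<partial>P)"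
proof (cases "E = {}")
  case False
  let ?f = "\<lambda>\<omega>. ext0 h (\<omega> (t + \<delta>)) - ext0 h (\<omega> t) + C * \<delta>\<^sup>2"
  have \<G>: "countable \<G>" and \<theta>: "test_fun B \<theta>" and Q: "0 \<le> Q" and c: "0 \<le> c" and L\<theta>: "\<And>q. - Q \<le> L \<theta> q"
    and \<theta>V: "\<And>q. q \<in> V \<Longrightarrow> \<theta> q = c" and g: "\<And>g. g \<in> \<G> \<Longrightarrow> test_fun B g" "\<And>g q. g \<in> \<G> \<Longrightarrow> g q \<le> h q"
      "\<And>g q. g \<in> \<G> \<Longrightarrow> - Q * (c - \<theta> q) \<le> L g q"
    and sup: "\<And>q \<eta>. q \<in> V \<Longrightarrow> \<eta> > 0 \<Longrightarrow> \<exists>g\<in>\<G>. h q \<le> g q + \<eta>"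
    using ch unfolding submartingale_chart_def by auto
  have EP: "E \<in> sets P" by (rule sets_F[OF E(1)])
  have d2: "\<delta>\<^sup>2 > 0" using \<delta> by simp
  have one: "0 \<le> (\<integral>\<omega>\<in>E'. ?f \<omega> \<partial>P)"
    if g': "g' \<in> \<G>" and E': "E' \<in> sets (\<F> t)" "E' \<subseteq> E" "\<And>\<omega>. \<omega> \<in> E' \<Longrightarrow> ext0 h (\<omega> t) \<le> ext0 g' (\<omega> t) + \<delta>\<^sup>2" for g' E'
  proof -
    have E'P: "E' \<in> sets P" by (rule sets_F[OF E'(1)])
    have on: "ext0 \<theta> (\<omega> t) = c" if w: "\<omega> \<in> E'" for \<omega>
    proof -
      obtain q where "\<omega> t = Some q" "q \<in> V" using E(2)[of \<omega>] w E'(2) by blast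
      then show ?thesis using \<theta>V by (simp add: ext0_def)
    qed
    have tt: "t \<le> t + \<delta>" using \<delta> by simp
    note inc = increment[OF g(1)[OF g'] t tt E'(1)]
    have "- Q\<^sup>2 * (t + \<delta> - t)\<^sup>2 * measure P E' \<le> (\<integral>\<omega>\<in>E'. (ext0 g' (\<omega> (t + \<delta>)) - ext0 g' (\<omega> t)) \<partial>P)"
      by (rule test_step[of \<theta> g' t "t + \<delta>" E' c Q]; use \<theta> g(1,3) g' t tt E'(1) c Q L\<theta> on in blast)
    then have "0 \<le> (\<integral>\<omega>\<in>E'. (ext0 g' (\<omega> (t + \<delta>)) - ext0 g' (\<omega> t)) \<partial>P) + (\<integral>\<omega>\<in>E'. Q\<^sup>2 * \<delta>\<^sup>2 \<partial>P)"
      using E'P by (simp add: set_lebesgue_integral_def mult.commute mult.left_commute)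
    also have "\<dots> = (\<integral>\<omega>\<in>E'. (ext0 g' (\<omega> (t + \<delta>)) - ext0 g' (\<omega> t) + Q\<^sup>2 * \<delta>\<^sup>2) \<partial>P)"
      by (rule set_integral_add(2)[symmetric, OF inc(2)]) (rule set_integrable_bounded[where C = "Q\<^sup>2 * \<delta>\<^sup>2"], use E'P in auto)
    also have "\<dots> \<le> (\<integral>\<omega>\<in>E'. ?f \<omega> \<partial>P)"
    proof (rule set_integral_mono)
      show "set_integrable P E' (\<lambda>\<omega>. ext0 g' (\<omega> (t + \<delta>)) - ext0 g' (\<omega> t) + Q\<^sup>2 * \<delta>\<^sup>2)"
        by (rule set_integral_add(1)[OF inc(2)]) (rule set_integrable_bounded[where C = "Q\<^sup>2 * \<delta>\<^sup>2"], use E'P in auto)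
      show "set_integrable P E' ?f" by (rule step_integrable[OF t \<delta> E'P])
      fix \<omega> assume \<omega>: "\<omega> \<in> E'"
      have "ext0 g' z \<le> ext0 h z" for z using g(2)[OF g'] by (auto simp: ext0_def split: option.splits)
      then have "ext0 g' (\<omega> (t + \<delta>)) - ext0 g' (\<omega> t) \<le> ext0 h (\<omega> (t + \<delta>)) - ext0 h (\<omega> t) + \<delta>\<^sup>2"
        using E'(3)[OF \<omega>] by (smt (verit))
      moreover have "\<delta>\<^sup>2 + Q\<^sup>2 * \<delta>\<^sup>2 \<le> C * \<delta>\<^sup>2" using mult_right_mono[OF C, of "\<delta>\<^sup>2"] by (simp add: distrib_right)
      ultimately show "ext0 g' (\<omega> (t + \<delta>)) - ext0 g' (\<omega> t) + Q\<^sup>2 * \<delta>\<^sup>2 \<le> ?f \<omega>" by linarith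
    qed
    finally show ?thesis .
  qed
  obtain \<omega>0 where "\<omega>0 \<in> E" using False by blast
  then obtain q0 where "q0 \<in> V" using E(2) by blast
  then have ne: "\<G> \<noteq> {}" using sup[of q0 1] by auto
  define G where "G = from_nat_into \<G>"
  have G: "G n \<in> \<G>" for n unfolding G_def by (rule from_nat_into[OF ne])
  define A where "A N = {\<omega> \<in> E. \<exists>n<N. ext0 h (\<omega> t) \<le> ext0 (G n) (\<omega> t) + \<delta>\<^sup>2}" for N
  have A_sets: "A N \<in> sets (\<F> t)" for N
  proof -
    have "(\<lambda>\<omega>. ext0 h (\<omega> t)) \<in> borel_measurable (\<F> t)" using t by (intro ext0_h_measurable) auto
    moreover have "(\<lambda>\<omega>. ext0 (G n) (\<omega> t) + \<delta>\<^sup>2) \<in> borel_measurable (\<F> t)" for n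
      using t by (intro borel_measurable_add continuous_ext0_measurable test_cont g(1) G) auto
    ultimately have "{\<omega> \<in> space (\<F> t). ext0 h (\<omega> t) \<le> ext0 (G n) (\<omega> t) + \<delta>\<^sup>2} \<in> sets (\<F> t)" for n
      by (rule borel_measurable_le)
    then have "(\<Union>n\<in>{..<N}. E \<inter> {\<omega> \<in> space (\<F> t). ext0 h (\<omega> t) \<le> ext0 (G n) (\<omega> t) + \<delta>\<^sup>2}) \<in> sets (\<F> t)"
      using E(1) by (intro sets.finite_UN sets.Int) auto
    moreover have "A N = (\<Union>n\<in>{..<N}. E \<inter> {\<omega> \<in> space (\<F> t). ext0 h (\<omega> t) \<le> ext0 (G n) (\<omega> t) + \<delta>\<^sup>2})"
      using sets.sets_into_space[OF E(1)] by (auto simp: A_def)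
    ultimately show ?thesis by simp
  qed
  have nonneg: "0 \<le> (\<integral>\<omega>\<in>A N. ?f \<omega> \<partial>P)" for N
  proof (induction N)
    case 0
    show ?case by (simp add: A_def set_lebesgue_integral_def)
  next
    case (Suc N)
    have split: "A (Suc N) = A N \<union> (A (Suc N) - A N)" by (auto simp: A_def less_Suc_eq)
    have "(\<integral>\<omega>\<in>A (Suc N). ?f \<omega> \<partial>P) = (\<integral>\<omega>\<in>A N. ?f \<omega> \<partial>P) + (\<integral>\<omega>\<in>A (Suc N) - A N. ?f \<omega> \<partial>P)"
      by (subst split, rule set_integral_Un) (auto intro!: step_integrable t \<delta> sets_F A_sets sets.Diff)
    moreover have "0 \<le> (\<integral>\<omega>\<in>A (Suc N) - A N. ?f \<omega> \<partial>P)"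
    proof (rule one[OF G[of N]])
      show "A (Suc N) - A N \<in> sets (\<F> t)" by (intro sets.Diff A_sets)
      show "A (Suc N) - A N \<subseteq> E" by (auto simp: A_def)
      fix \<omega> assume "\<omega> \<in> A (Suc N) - A N"
      then show "ext0 h (\<omega> t) \<le> ext0 (G N) (\<omega> t) + \<delta>\<^sup>2" unfolding A_def less_Suc_eq by blast
    qed
    ultimately show ?case using Suc by simp
  qed
  have lim: "(\<lambda>N. \<integral>\<omega>\<in>A N. ?f \<omega> \<partial>P) \<longlonglongrightarrow> (\<integral>\<omega>\<in>(\<Union>N. A N). ?f \<omega> \<partial>P)"
  proof (rule set_integral_cont_up)
    show "A i \<in> sets P" for i by (rule sets_F[OF A_sets])
    show "incseq A" by (force simp: incseq_def A_def)
    show "set_integrable P (\<Union>N. A N) ?f"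
      by (intro step_integrable t \<delta> sets.countable_UN) (use sets_F[OF A_sets] in auto)
  qed
  have un: "(\<Union>N. A N) = E"
  proof (intro equalityI subsetI)
    fix \<omega> assume \<omega>: "\<omega> \<in> E"
    then obtain q where q: "\<omega> t = Some q" "q \<in> V" using E(2) by auto
    obtain g' where g': "g' \<in> \<G>" "h q \<le> g' q + \<delta>\<^sup>2" using sup[OF q(2) d2] by blast
    obtain n where "g' = G n" using g'(1) from_nat_into_surj[OF \<G>] unfolding G_def by metis
    then have "\<omega> \<in> A (Suc n)" using \<omega> q g'(2) by (auto simp: A_def ext0_def)
    then show "\<omega> \<in> (\<Union>N. A N)" by blast
  qed (auto simp: A_def)
  have "0 \<le> (\<integral>\<omega>\<in>(\<Union>N. A N). ?f \<omega> \<partial>P)"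
    by (rule LIMSEQ_le_const[OF lim]) (use nonneg in blast)
  then show ?thesis unfolding un .
qed (simp add: set_lebesgue_integral_def)

text \<open>The position at time \<open>t\<close> decides which chart is used. Overlaps are removed
  by peeling off one chart at a time, with one \<open>C\<close> for all.\<close>

lemma multi_chart_step:
  fixes V :: "nat \<Rightarrow> 'n set"
  assumes ch: "\<And>l. l < K \<Longrightarrow> submartingale_chart B L h (V l) (Q l) (c l) (\<theta> l) (\<G> l) \<and> 1 + (Q l)\<^sup>2 \<le> C"
    and t: "0 \<le> t" and \<delta>: "0 < \<delta>"
    and E: "E \<in> sets (\<F> t)" "\<And>\<omega>. \<omega> \<in> E \<Longrightarrow> \<omega> t \<in> Some ` (\<Union>l<K. V l)"
  shows "0 \<le> (\<integral>\<omega>\<in>E. (ext0 h (\<omega> (t + \<delta>)) - ext0 h (\<omega> t) + C * \<delta>\<^sup>2) \<partial>P)"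
  using ch E
proof (induction K arbitrary: E)
  case 0
  then have "E = {}" by auto
  then show ?case by (simp add: set_lebesgue_integral_def)
next
  case (Suc K)
  let ?f = "\<lambda>\<omega>. ext0 h (\<omega> (t + \<delta>)) - ext0 h (\<omega> t) + C * \<delta>\<^sup>2"
  note chK = Suc.prems(1)[of K]
  have oV: "open (V K)" using chK by (auto simp: submartingale_chart_def)
  define E1 where "E1 = E \<inter> {\<omega> \<in> paths. \<omega> t \<in> Some ` V K}"
  have E1: "E1 \<in> sets (\<F> t)" unfolding E1_def
    using Suc.prems(2) path_event[of t "{0..t}" "Some ` V K"] t oV by auto
  then have E2: "E - E1 \<in> sets (\<F> t)" using Suc.prems(2) by auto
  have "E = E1 \<union> (E - E1)" by (auto simp: E1_def)
  then have "(\<integral>\<omega>\<in>E. ?f \<omega> \<partial>P) = (\<integral>\<omega>\<in>E1 \<union> (E - E1). ?f \<omega> \<partial>P)" by simp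
  also have "\<dots> = (\<integral>\<omega>\<in>E1. ?f \<omega> \<partial>P) + (\<integral>\<omega>\<in>E - E1. ?f \<omega> \<partial>P)"
    by (rule set_integral_Un) (auto intro!: step_integrable t \<delta> sets_F E1 E2)
  also have "\<dots> \<ge> 0 + 0"
  proof (rule add_mono)
    show "0 \<le> (\<integral>\<omega>\<in>E1. ?f \<omega> \<partial>P)"
      using chK by (intro chart_step[OF _ t \<delta> E1]) (auto simp: E1_def)
    show "0 \<le> (\<integral>\<omega>\<in>E - E1. ?f \<omega> \<partial>P)"
    proof (rule Suc.IH[OF _ E2])
      fix \<omega> assume \<omega>: "\<omega> \<in> E - E1"
      then have "\<omega> \<in> paths" using sets.sets_into_space[OF Suc.prems(2)] by auto
      then show "\<omega> t \<in> Some ` (\<Union>l<K. V l)"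
      proof -
        obtain q l where q: "\<omega> t = Some q" "q \<in> V l" "l < Suc K" using Suc.prems(3)[of \<omega>] \<omega> by auto
        then have "l \<noteq> K" using \<omega> \<open>\<omega> \<in> paths\<close> by (auto simp: E1_def)
        then show ?thesis unfolding q(1) using q(2,3) by (intro imageI UN_I[of l]) auto
      qed
    qed (use Suc.prems(1) in auto)
  qed
  finally show ?case by simp
qed

text \<open>Optional stopping for the process seen on the grid, carried out by hand. Stopping
  happens on entering \<open>U\<close>, where \<open>h\<close> is at most \<theta>, or on leaving
  \<Omega>, where only \<open>h \<le> 1\<close> is known.\<close>

lemma grid_bound:
  assumes step: "\<And>t \<delta> E. 0 \<le> t \<Longrightarrow> 0 < \<delta> \<Longrightarrow> E \<in> sets (\<F> t) \<Longrightarrow> (\<And>\<omega>. \<omega> \<in> E \<Longrightarrow> \<omega> t \<in> Some ` \<Omega>) \<Longrightarrow>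
      0 \<le> (\<integral>\<omega>\<in>E. (ext0 h (\<omega> (t + \<delta>)) - ext0 h (\<omega> t) + C * \<delta>\<^sup>2) \<partial>P)"
    and U: "open U" "\<And>q. q \<in> U \<Longrightarrow> h q \<le> \<theta>" and \<theta>: "0 \<le> \<theta>" and \<Omega>: "open \<Omega>" and C: "0 \<le> C" and \<delta>: "0 < \<delta>"
  shows "h x0 - \<theta> \<le> 1 - measure P {\<omega> \<in> paths. \<exists>j<k. \<omega> (real j * \<delta>) \<in> Some ` U \<and> (\<forall>i<j. \<omega> (real i * \<delta>) \<in> Some ` \<Omega>)}
    + real k * (C * \<delta>\<^sup>2)"
proof -
  let ?X = "\<lambda>j \<omega>. \<omega> (real j * \<delta>)"
  define inU where "inU j \<omega> \<longleftrightarrow> ?X j \<omega> \<in> Some ` U" for j and \<omega> :: "real \<Rightarrow> 'n option"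
  define in\<Omega> where "in\<Omega> j \<omega> \<longleftrightarrow> ?X j \<omega> \<in> Some ` \<Omega>" for j and \<omega> :: "real \<Rightarrow> 'n option"
  \<comment> \<open>\<open>D\<close>: still running; \<open>Bad\<close>, defined next: \<Omega> was
    left before \<open>U\<close> was entered; \<open>Hit\<close>: \<open>U\<close> was entered with
    all earlier grid points in \<Omega>. They are pairwise disjoint, which bounds the sum of their
    probabilities by 1.\<close>
  define D where "D k = {\<omega> \<in> paths. \<forall>j<k. in\<Omega> j \<omega> \<and> \<not> inU j \<omega>}" for k
  define Bad where "Bad k = {\<omega> \<in> paths. \<exists>j<k. \<not> in\<Omega> j \<omega> \<and> \<not> inU j \<omega> \<and> (\<forall>i<j. in\<Omega> i \<omega> \<and> \<not> inU i \<omega>)}" for k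
  define Hit where "Hit k = {\<omega> \<in> paths. \<exists>j<k. inU j \<omega> \<and> (\<forall>i<j. in\<Omega> i \<omega>)}" for k
  define d where "d k \<omega> = ext0 h (?X k \<omega>) - \<theta>" for k and \<omega> :: "real \<Rightarrow> 'n option"
  have ev: "{\<omega> \<in> paths. inU j \<omega>} \<in> sets (\<F> (real k * \<delta>))" "{\<omega> \<in> paths. in\<Omega> j \<omega>} \<in> sets (\<F> (real k * \<delta>))" if "j \<le> k" for j k
    unfolding inU_def in\<Omega>_def using that \<delta> U(1) \<Omega> by (auto intro!: path_event)
  have evP: "{\<omega> \<in> paths. inU j \<omega>} \<in> sets P" "{\<omega> \<in> paths. in\<Omega> j \<omega>} \<in> sets P" for j
    by (rule sets_F[OF ev(1)[OF order_refl]], rule sets_F[OF ev(2)[OF order_refl]])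
  have [measurable]: "Measurable.pred P (inU j)" "Measurable.pred P (in\<Omega> j)" for j
    unfolding Measurable.pred_def spaceP by (rule evP)+
  have DF: "D k \<in> sets (\<F> (real l * \<delta>))" if "k \<le> Suc l" for k l
  proof -
    have "D k = paths \<inter> (\<Inter>j\<in>{..<k}. {\<omega> \<in> paths. in\<Omega> j \<omega>} - {\<omega> \<in> paths. inU j \<omega>})"
      by (auto simp: D_def)
    also have "\<dots> \<in> sets (\<F> (real l * \<delta>))"
    proof (cases "k = 0")
      case True
      then show ?thesis using sets.top[of "\<F> (real l * \<delta>)"] by simp
    next
      case False
      then show ?thesis using that sets.top[of "\<F> (real l * \<delta>)"]
        by (intro sets.Int sets.finite_INT sets.Diff ev) auto
    qed
    finally show ?thesis .
  qed
  have DP: "D k \<in> sets P" for k by (rule sets_F[OF DF[of k k]]) simp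
  have BadP: "Bad k \<in> sets P" for k
  proof -
    have "Bad k = {\<omega> \<in> space P. \<exists>j\<in>{..<k}. \<not> in\<Omega> j \<omega> \<and> \<not> inU j \<omega> \<and> (\<forall>i\<in>{..<j}. in\<Omega> i \<omega> \<and> \<not> inU i \<omega>)}"
      by (auto simp: Bad_def spaceP)
    also have "\<dots> \<in> sets P" by measurable
    finally show ?thesis .
  qed
  have HitP: "Hit k \<in> sets P" for k
  proof -
    have "Hit k = {\<omega> \<in> space P. \<exists>j\<in>{..<k}. inU j \<omega> \<and> (\<forall>i\<in>{..<j}. in\<Omega> i \<omega>)}"
      by (auto simp: Hit_def spaceP)
    also have "\<dots> \<in> sets P" by measurable
    finally show ?thesis .
  qed
  have dmeas: "d k \<in> borel_measurable P" for k
    unfolding d_def[abs_def] using \<delta> by (intro borel_measurable_diff ext0_h_measurable') auto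
  have dle: "d k \<omega> \<le> 1" for k \<omega> using ext0_h01[of "?X k \<omega>"] \<theta> unfolding d_def by linarith
  have dbd: "\<bar>d k \<omega>\<bar> \<le> 1 + \<theta>" for k \<omega> using ext0_h01[of "?X k \<omega>"] \<theta> unfolding d_def by linarith
  have dint: "set_integrable P E (d k)" if "E \<in> sets P" for E k
    by (rule set_integrable_bounded[OF dmeas dbd that])
  \<comment> \<open>Of the mass leaving \<open>D\<close> in a step, the part in \<open>U\<close> has
    \<open>d \<le> 0\<close> and is dropped, and the part outside \<Omega> has
    \<open>d \<le> 1\<close> and is charged to \<open>Bad\<close>. The mass that remains loses at
    most \<open>C * \<delta>\<^sup>2\<close> before the next grid time.\<close>
  have claim: "h x0 - \<theta> \<le> (\<integral>\<omega>\<in>D k. d k \<omega> \<partial>P) + measure P (Bad k) + real k * (C * \<delta>\<^sup>2)" for k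
  proof (induction k)
    case 0
    have "D 0 = space P" by (simp add: D_def spaceP)
    moreover have "(\<integral>\<omega>\<in>space P. d 0 \<omega> \<partial>P) = (\<integral>\<omega>\<in>space P. h x0 - \<theta> \<partial>P)"
    proof (rule set_lebesgue_integral_cong_AE)
      show "AE \<omega>\<in>space P in P. d 0 \<omega> = h x0 - \<theta>"
        using start by eventually_elim (simp add: d_def ext0_def)
    qed (use dmeas in auto)
    moreover have "\<dots> = h x0 - \<theta>" by (simp add: set_lebesgue_integral_def P.prob_space)
    ultimately show ?case by simp
  next
    case (Suc k)
    define E1 where "E1 = D k \<inter> {\<omega> \<in> paths. inU k \<omega>}"
    define E2 where "E2 = D k \<inter> {\<omega> \<in> paths. \<not> inU k \<omega> \<and> \<not> in\<Omega> k \<omega>}"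
    have E2': "E2 = D k - {\<omega> \<in> paths. inU k \<omega>} - {\<omega> \<in> paths. in\<Omega> k \<omega>}" by (auto simp: E2_def D_def)
    have E1P: "E1 \<in> sets P" using DP evP by (auto simp: E1_def)
    have E2P: "E2 \<in> sets P" unfolding E2' using DP evP by (intro sets.Diff)
    have dj1: "D (Suc k) \<inter> (E1 \<union> E2) = {}" unfolding D_def E1_def E2_def by blast
    have dj2: "E1 \<inter> E2 = {}" unfolding E1_def E2_def by blast
    have Dk: "D k = D (Suc k) \<union> (E1 \<union> E2)" by (auto simp: D_def E1_def E2_def less_Suc_eq)
    have "(\<integral>\<omega>\<in>D k. d k \<omega> \<partial>P) = (\<integral>\<omega>\<in>D (Suc k) \<union> (E1 \<union> E2). d k \<omega> \<partial>P)" using Dk by simp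
    also have "\<dots> = (\<integral>\<omega>\<in>D (Suc k). d k \<omega> \<partial>P) + (\<integral>\<omega>\<in>E1 \<union> E2. d k \<omega> \<partial>P)"
      by (rule set_integral_Un[OF dj1 dint[OF DP] dint[OF sets.Un[OF E1P E2P]]])
    also have "(\<integral>\<omega>\<in>E1 \<union> E2. d k \<omega> \<partial>P) = (\<integral>\<omega>\<in>E1. d k \<omega> \<partial>P) + (\<integral>\<omega>\<in>E2. d k \<omega> \<partial>P)"
      by (rule set_integral_Un[OF dj2 dint[OF E1P] dint[OF E2P]])
    also have "(\<integral>\<omega>\<in>E1. d k \<omega> \<partial>P) \<le> (\<integral>\<omega>\<in>E1. 0 \<partial>P)"
    proof (rule set_integral_mono[OF dint[OF E1P]])
      show "set_integrable P E1 (\<lambda>_. 0 :: real)" by (simp add: set_integrable_def)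
      fix \<omega> assume "\<omega> \<in> E1"
      then obtain q where "?X k \<omega> = Some q" "q \<in> U" by (auto simp: E1_def inU_def)
      then show "d k \<omega> \<le> 0" using U(2) by (simp add: d_def ext0_def)
    qed
    also have "(\<integral>\<omega>\<in>E2. d k \<omega> \<partial>P) \<le> (\<integral>\<omega>\<in>E2. 1 \<partial>P)"
      by (rule set_integral_mono[OF dint[OF E2P] set_integrable_bounded[OF _ _ E2P, of _ 1] dle]) auto
    finally have A: "(\<integral>\<omega>\<in>D k. d k \<omega> \<partial>P) \<le> (\<integral>\<omega>\<in>D (Suc k). d k \<omega> \<partial>P) + measure P E2"
      using E2P by (simp add: set_lebesgue_integral_def)
    have "Bad (Suc k) = Bad k \<union> E2"
      unfolding Bad_def E2_def D_def less_Suc_eq by blast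
    moreover have "Bad k \<inter> E2 = {}" unfolding Bad_def E2_def D_def by blast
    ultimately have Bm: "measure P (Bad (Suc k)) = measure P (Bad k) + measure P E2"
      using BadP E2P by (simp add: P.finite_measure_Union)
    have t: "0 \<le> real k * \<delta>" using \<delta> by simp
    have tk: "real k * \<delta> + \<delta> = real (Suc k) * \<delta>" by (simp add: algebra_simps)
    have "0 \<le> (\<integral>\<omega>\<in>D (Suc k). (ext0 h (\<omega> (real k * \<delta> + \<delta>)) - ext0 h (\<omega> (real k * \<delta>)) + C * \<delta>\<^sup>2) \<partial>P)"
      by (rule step[OF t \<delta> DF]) (auto simp: D_def in\<Omega>_def)
    also have "\<dots> = (\<integral>\<omega>\<in>D (Suc k). (d (Suc k) \<omega> - d k \<omega> + C * \<delta>\<^sup>2) \<partial>P)"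
      unfolding tk by (simp add: d_def)
    also have "\<dots> = (\<integral>\<omega>\<in>D (Suc k). (d (Suc k) \<omega> - d k \<omega>) \<partial>P) + (\<integral>\<omega>\<in>D (Suc k). C * \<delta>\<^sup>2 \<partial>P)"
      by (intro set_integral_add(2) set_integral_diff(1) dint DP set_integrable_bounded[where C = "\<bar>C * \<delta>\<^sup>2\<bar>"]) auto
    also have "(\<integral>\<omega>\<in>D (Suc k). (d (Suc k) \<omega> - d k \<omega>) \<partial>P) = (\<integral>\<omega>\<in>D (Suc k). d (Suc k) \<omega> \<partial>P) - (\<integral>\<omega>\<in>D (Suc k). d k \<omega> \<partial>P)"
      by (intro set_integral_diff(2) dint DP)
    also have "(\<integral>\<omega>\<in>D (Suc k). C * \<delta>\<^sup>2 \<partial>P) = measure P (D (Suc k)) * (C * \<delta>\<^sup>2)"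
      using DP[of "Suc k"] by (simp add: set_lebesgue_integral_def)
    also have "\<dots> \<le> 1 * (C * \<delta>\<^sup>2)" using C by (intro mult_right_mono) auto
    finally have "(\<integral>\<omega>\<in>D (Suc k). d k \<omega> \<partial>P) \<le> (\<integral>\<omega>\<in>D (Suc k). d (Suc k) \<omega> \<partial>P) + C * \<delta>\<^sup>2" by simp
    with A Bm Suc show ?case by (simp add: algebra_simps)
  qed
  have "(\<integral>\<omega>\<in>D k. d k \<omega> \<partial>P) \<le> (\<integral>\<omega>\<in>D k. 1 \<partial>P)"
    by (rule set_integral_mono[OF dint[OF DP] set_integrable_bounded[OF _ _ DP, of _ 1] dle]) auto
  then have "(\<integral>\<omega>\<in>D k. d k \<omega> \<partial>P) \<le> measure P (D k)"
    using DP by (simp add: set_lebesgue_integral_def)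
  moreover have "measure P (D k) + measure P (Bad k) + measure P (Hit k) \<le> 1"
  proof -
    have "D k \<inter> Bad k = {}" by (auto simp: D_def Bad_def)
    moreover have "(D k \<union> Bad k) \<inter> Hit k = {}"
    proof -
      have "False" if bh: "\<omega> \<in> Bad k" "\<omega> \<in> Hit k" for \<omega>
      proof -
        obtain j where j: "\<not> in\<Omega> j \<omega>" "\<not> inU j \<omega>" "\<And>i. i < j \<Longrightarrow> \<not> inU i \<omega>" using bh(1) unfolding Bad_def by blast
        obtain j' where j': "inU j' \<omega>" "\<And>i. i < j' \<Longrightarrow> in\<Omega> i \<omega>" using bh(2) unfolding Hit_def by blast
        show False using j j' by (metis linorder_neqE_nat)
      qed
      moreover have "False" if "\<omega> \<in> D k" "\<omega> \<in> Hit k" for \<omega>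
        using that unfolding D_def Hit_def by blast
      ultimately show ?thesis by blast
    qed
    ultimately have "measure P (D k \<union> Bad k \<union> Hit k) = measure P (D k) + measure P (Bad k) + measure P (Hit k)"
      using DP BadP HitP by (simp add: P.finite_measure_Union sets.Un)
    then show ?thesis using P.prob_le_1[of "D k \<union> Bad k \<union> Hit k"] by simp
  qed
  ultimately show ?thesis using claim[of k] unfolding Hit_def inU_def in\<Omega>_def by linarith
qed

text \<open>\<open>k\<close> is fixed first, freezing the time horizon, the number of charts and the
  constant \<open>C k\<close>. The mesh \<open>1 / 2 ^ n\<close> is then refined:
  \<open>k * 2 ^ n\<close> steps lose \<open>C k / 4 ^ n\<close> each, which vanishes in
  total.\<close>

lemma recurrent_bound:
  assumes ch: "\<And>l :: nat. submartingale_chart B L h (V l) (Q l) (c l) (\<theta> l) (\<G> l)" and cov: "(\<Union>l. V l) = UNIV"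
    and U: "open U" "\<And>q. q \<in> U \<Longrightarrow> h q \<le> \<theta>'" "0 \<le> \<theta>'"
    and rec: "AE \<omega> in P. \<exists>t\<ge>0. \<omega> t \<in> Some ` U"
  shows "h x0 \<le> \<theta>'"
proof (rule field_le_epsilon)
  fix \<epsilon> :: real assume \<epsilon>: "\<epsilon> > 0"
  define \<Omega> where "\<Omega> K = (\<Union>l<K. V l)" for K
  have oV: "open (V l)" for l using ch[of l] by (simp add: submartingale_chart_def)
  have \<Omega>: "open (\<Omega> K)" "mono \<Omega>" "(\<Union>K. \<Omega> K) = UNIV" for K
  proof -
    show "open (\<Omega> K)" unfolding \<Omega>_def by (intro open_UN ballI oV)
    show "mono \<Omega>" unfolding \<Omega>_def mono_def by fastforce
    show "(\<Union>K. \<Omega> K) = UNIV"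
    proof (rule UNIV_eq_I[symmetric])
      fix q
      obtain l where "q \<in> V l" using cov by blast
      then have "q \<in> \<Omega> (Suc l)" by (auto simp: \<Omega>_def)
      then show "q \<in> (\<Union>K. \<Omega> K)" by blast
    qed
  qed
  define C where "C K = (\<Sum>l<K. 1 + (Q l)\<^sup>2)" for K
  have C: "1 + (Q l)\<^sup>2 \<le> C K" if "l < K" for l K
    unfolding C_def using that by (intro member_le_sum) auto
  have C0: "0 \<le> C K" for K unfolding C_def by (intro sum_nonneg) auto
  define H where "H n N = {\<omega> \<in> paths. \<exists>j<N * 2 ^ n. \<omega> (real j * (1 / 2 ^ n)) \<in> Some ` U \<and> (\<forall>i<j. \<omega> (real i * (1 / 2 ^ n)) \<in> Some ` \<Omega> N)}" for n N :: nat
  have HP: "H n N \<in> sets P" for n N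
  proof -
    have ev: "{\<omega> \<in> space P. \<omega> r \<in> Some ` W} \<in> sets P" if "open W" "0 \<le> r" for W r
      using path_event[of r "{0..}" "Some ` W"] that by (simp add: spaceP setsP)
    have "H n N = (\<Union>j\<in>{..<N * 2 ^ n}. {\<omega> \<in> space P. \<omega> (real j * (1 / 2 ^ n)) \<in> Some ` U} \<inter>
        {\<omega> \<in> space P. \<forall>i\<in>{..<j}. \<omega> (real i * (1 / 2 ^ n)) \<in> Some ` \<Omega> N})"
      by (auto simp: H_def spaceP)
    also have "\<dots> \<in> sets P"
      by (intro sets.finite_UN sets.Int sets.sets_Collect_finite_All ev U(1) \<Omega>(1)) auto
    finally show ?thesis .
  qed
  have Hmono: "H n N \<subseteq> H n N'" if "N \<le> N'" for n N N'
  proof -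
    have sub: "\<Omega> N \<subseteq> \<Omega> N'" using \<Omega>(2) that by (simp add: monoD)
    have le: "N * 2 ^ n \<le> N' * 2 ^ n" using that by simp
    show ?thesis
    proof
      fix \<omega> assume "\<omega> \<in> H n N"
      then obtain j where j: "\<omega> \<in> paths" "j < N * 2 ^ n" "\<omega> (real j * (1 / 2 ^ n)) \<in> Some ` U"
          "\<forall>i<j. \<omega> (real i * (1 / 2 ^ n)) \<in> Some ` \<Omega> N"
        unfolding H_def by blast
      have "\<forall>i<j. \<omega> (real i * (1 / 2 ^ n)) \<in> Some ` \<Omega> N'" using j(4) sub by blast
      then show "\<omega> \<in> H n N'" unfolding H_def using j(1,3) less_le_trans[OF j(2) le] by blast
    qed
  qed
  \<comment> \<open>A hit is demanded on all grids from the \<open>k\<close>-th on simultaneously,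
    so one event of probability close to 1 serves every \<open>n\<close> in the limit.\<close>
  define G where "G k = (\<Inter>n\<in>{k..}. H n k)" for k
  have GP: "G k \<in> sets P" for k
    unfolding G_def by (intro sets.countable_INT') (use HP in auto)
  have Ginc: "incseq G"
  proof (rule incseq_SucI)
    show "G k \<subseteq> G (Suc k)" for k unfolding G_def using Hmono[of k "Suc k"] by fastforce
  qed
  have "AE \<omega> in P. \<omega> \<in> (\<Union>k. G k)"
    using rec AE_space
  proof eventually_elim
    fix \<omega> assume \<omega>: "\<exists>t\<ge>0. \<omega> t \<in> Some ` U" "\<omega> \<in> space P"
    then obtain t where t: "0 \<le> t" "\<omega> t \<in> Some ` U" by blast
    have pth: "\<omega> \<in> paths" using \<omega>(2) spaceP by simp
    obtain k where k: "\<And>N n. k \<le> N \<Longrightarrow> k \<le> n \<Longrightarrow> \<exists>j<N * 2 ^ n. \<omega> (real j * (1 / 2 ^ n)) \<in> Some ` U \<and> (\<forall>i<j. \<omega> (real i * (1 / 2 ^ n)) \<in> Some ` \<Omega> N)"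
      using path_hits_on_grid[OF pth t U(1) \<Omega>] by blast
    then have "\<omega> \<in> G k" unfolding G_def H_def using pth by simp
    then show "\<omega> \<in> (\<Union>k. G k)" by blast
  qed
  then have "measure P (\<Union>k. G k) = 1" using GP by (intro P.prob_eq_1[THEN iffD2]) auto
  moreover have "(\<lambda>k. measure P (G k)) \<longlonglongrightarrow> measure P (\<Union>k. G k)"
    using GP Ginc by (intro P.finite_Lim_measure_incseq) auto
  ultimately have "(\<lambda>k. measure P (G k)) \<longlonglongrightarrow> 1" by simp
  then have "\<forall>\<^sub>F k in sequentially. measure P (G k) > 1 - \<epsilon>"
    using \<epsilon> by (intro order_tendstoD(1)) auto
  then obtain k where k: "measure P (G k) > 1 - \<epsilon>"
    using eventually_happens'[OF sequentially_bot] by blast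
  have bound: "h x0 - \<theta>' \<le> \<epsilon> + real k * C k * (1/2) ^ n" if n: "n \<ge> k" for n
  proof -
    have "h x0 - \<theta>' \<le> 1 - measure P (H n k) + real (k * 2 ^ n) * (C k * (1 / 2 ^ n)\<^sup>2)"
      unfolding H_def
    proof (rule grid_bound[where \<Omega> = "\<Omega> k" and C = "C k"])
      fix t \<delta> :: real and E
      assume tE: "0 \<le> t" "0 < \<delta>" "E \<in> sets (\<F> t)" "\<And>\<omega>. \<omega> \<in> E \<Longrightarrow> \<omega> t \<in> Some ` \<Omega> k"
      show "0 \<le> (\<integral>\<omega>\<in>E. (ext0 h (\<omega> (t + \<delta>)) - ext0 h (\<omega> t) + C k * \<delta>\<^sup>2) \<partial>P)"
      proof (rule multi_chart_step[of k V Q c \<theta> \<G>])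
        show "submartingale_chart B L h (V l) (Q l) (c l) (\<theta> l) (\<G> l) \<and> 1 + (Q l)\<^sup>2 \<le> C k" if "l < k" for l
          using ch C[OF that] by blast
        show "\<omega> t \<in> Some ` (\<Union>l<k. V l)" if "\<omega> \<in> E" for \<omega>
          using tE(4)[OF that] unfolding \<Omega>_def .
      qed (rule tE)+
    qed (use U \<Omega> C0 in auto)
    moreover have "measure P (G k) \<le> measure P (H n k)"
      using n by (intro P.finite_measure_mono HP) (auto simp: G_def)
    moreover have "real (k * 2 ^ n) * (C k * (1 / 2 ^ n)\<^sup>2) = real k * C k * (1/2) ^ n"
      by (simp add: power2_eq_square power_divide)
    ultimately show ?thesis using k by linarith
  qed
  have "(\<lambda>n. \<epsilon> + real k * C k * (1/2) ^ n) \<longlonglongrightarrow> \<epsilon> + real k * C k * 0"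
    by (intro tendsto_intros LIMSEQ_power_zero) auto
  then have "h x0 - \<theta>' \<le> \<epsilon> + real k * C k * 0"
    by (rule LIMSEQ_le_const) (use bound in blast)
  then show "h x0 \<le> \<theta>' + \<epsilon>" by simp
qed

end

end

section \<open>Recurrence on the base\<close>

lemma partial_mult:
  assumes "smooth_on D F" "smooth_on D G" "y \<in> D"
  shows "partial i (\<lambda>z. F z * G z) y = F y * partial i G y + partial i F y * G y"
proof -
  have "((\<lambda>z. F z * G z) has_derivative (\<lambda>v. F y * frechet_derivative G (at y) v + frechet_derivative F (at y) v * G y)) (at y)"
    by (intro has_derivative_mult smooth_on_has_derivative[OF assms(1,3)] smooth_on_has_derivative[OF assms(2,3)])
  then show ?thesis unfolding partial_def by (simp add: frechet_derivative_at[symmetric])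
qed

lemma partial_flat:
  assumes "smooth_on D F" "y \<in> D"
  shows "partial i (\<lambda>z. flat k (F z)) y = (flat (k + 2) (F y) - real k * flat (k + 1) (F y)) * partial i F y"
proof -
  have "((\<lambda>z. flat k (F z)) has_derivative
      (\<lambda>v. (flat (k + 2) (F y) - real k * flat (k + 1) (F y)) * frechet_derivative F (at y) v)) (at y)"
    using diff_chain_at[OF smooth_on_has_derivative[OF assms] flat_deriv[of k "F y", unfolded has_field_derivative_def]]
    by (simp add: o_def)
  then show ?thesis unfolding partial_def by (simp add: frechet_derivative_at[symmetric])
qed

lemma smooth_on_flat: "open D \<Longrightarrow> smooth_on D F \<Longrightarrow> smooth_on D (\<lambda>z. flat k (F z))"
  by (rule smooth_on_compose[OF _ open_UNIV _ flat_smooth]) auto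

text \<open>The chain rule adds half the second derivative of \<open>flat 0\<close> times the
  quadratic form of \<open>a\<close> on the gradient of \<open>F\<close>. Below 1/2 both factors are
  nonnegative, and the term is dropped; \<open>flat 2\<close> is the first derivative.\<close>

lemma ell_flat_ge:
  assumes D: "open D" and F: "smooth_on D F" and y: "y \<in> D" and le: "F y \<le> 1/2"
    and pos: "\<And>\<xi>. \<xi> \<noteq> 0 \<Longrightarrow> (\<Sum>i\<in>Basis. \<Sum>j\<in>Basis. a i j y * (\<xi> \<bullet> i) * (\<xi> \<bullet> j)) > 0"
  shows "flat 2 (F y) * ell a b F y \<le> ell a b (\<lambda>z. flat 0 (F z)) y"
proof -
  have p1: "partial j (\<lambda>z. flat 0 (F z)) z = flat 2 (F z) * partial j F z" if "z \<in> D" for j z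
    using partial_flat[OF F that, of j 0] by (simp add: numeral_2_eq_2)
  have p2: "partial i (partial j (\<lambda>z. flat 0 (F z))) y =
      flat 2 (F y) * partial i (partial j F) y + (flat 4 (F y) - 2 * flat 3 (F y)) * partial i F y * partial j F y" for i j
  proof -
    have "partial i (partial j (\<lambda>z. flat 0 (F z))) y = partial i (\<lambda>z. flat 2 (F z) * partial j F z) y"
      by (rule partial_cong_open[OF D y p1])
    also have "\<dots> = flat 2 (F y) * partial i (partial j F) y + partial i (\<lambda>z. flat 2 (F z)) y * partial j F y"
      by (rule partial_mult[OF smooth_on_flat[OF D F] smooth_on_partial[OF F] y])
    also have "partial i (\<lambda>z. flat 2 (F z)) y = (flat 4 (F y) - 2 * flat 3 (F y)) * partial i F y"
      using partial_flat[OF F y, of i 2] by simp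
    finally show ?thesis .
  qed
  define \<xi> where "\<xi> = (\<Sum>i\<in>Basis. partial i F y *\<^sub>R i)"
  have \<xi>: "\<xi> \<bullet> i = partial i F y" if "i \<in> Basis" for i using that by (simp add: \<xi>_def)
  have "(\<Sum>i\<in>Basis. \<Sum>j\<in>Basis. a i j y * partial i F y * partial j F y) = (\<Sum>i\<in>Basis. \<Sum>j\<in>Basis. a i j y * (\<xi> \<bullet> i) * (\<xi> \<bullet> j))"
    using \<xi> by simp
  moreover have "(\<Sum>i\<in>Basis. \<Sum>j\<in>Basis. a i j y * (\<xi> \<bullet> i) * (\<xi> \<bullet> j)) \<ge> 0"
    using pos[of \<xi>] by (cases "\<xi> = 0") auto
  ultimately have q: "(flat 4 (F y) - 2 * flat 3 (F y)) * (\<Sum>i\<in>Basis. \<Sum>j\<in>Basis. a i j y * partial i F y * partial j F y) \<ge> 0"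
    using flat_second_deriv_nonneg[OF le] by simp
  have "ell a b (\<lambda>z. flat 0 (F z)) y = flat 2 (F y) * ell a b F y +
      1/2 * ((flat 4 (F y) - 2 * flat 3 (F y)) * (\<Sum>i\<in>Basis. \<Sum>j\<in>Basis. a i j y * partial i F y * partial j F y))"
  proof -
    define A B where "A = flat 2 (F y)" and "B = flat 4 (F y) - 2 * flat 3 (F y)"
    have s1: "(\<Sum>i\<in>Basis. \<Sum>j\<in>Basis. a i j y * (A * partial i (partial j F) y + B * partial i F y * partial j F y)) =
        A * (\<Sum>i\<in>Basis. \<Sum>j\<in>Basis. a i j y * partial i (partial j F) y) +
        B * (\<Sum>i\<in>Basis. \<Sum>j\<in>Basis. a i j y * partial i F y * partial j F y)"
      unfolding sum_distrib_left sum.distrib[symmetric] by (intro sum.cong refl) (simp add: algebra_simps)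
    have s2: "(\<Sum>k\<in>Basis. b k y * (A * partial k F y)) = A * (\<Sum>k\<in>Basis. b k y * partial k F y)"
      unfolding sum_distrib_left by (intro sum.cong refl) (simp add: algebra_simps)
    show ?thesis unfolding ell_def p2 p1[OF y] A_def[symmetric] B_def[symmetric] s1 s2
      by (simp only: distrib_left mult.assoc mult.left_commute)
  qed
  then show ?thesis using q by simp
qed

text \<open>With \<open>t = 1 / x\<close> the claim is that \<open>t\<^sup>2\<close> is at most
  \<open>2 * exp t\<close>, the quadratic Taylor bound.\<close>

lemma flat_2_le: "flat 2 x \<le> 2"
proof (cases "x \<le> 0")
  case False
  define t where "t = 1 / x"
  have t: "t > 0" using False by (simp add: t_def)
  have "t\<^sup>2 \<le> 2 * exp t" using exp_lower_Taylor_quadratic[of t] t by simp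
  moreover have "exp (- 1 / x) / x\<^sup>2 = t\<^sup>2 / exp t"
    by (simp add: t_def exp_minus power_divide field_simps)
  ultimately show ?thesis using False by (simp add: flat_def divide_le_eq)
qed (simp add: flat_zero)

lemma ell_zero: "ell a b (\<lambda>_. 0) y = 0"
proof -
  have "partial i (\<lambda>_. 0) = (\<lambda>_. 0)" for i :: 'a
    unfolding partial_def[abs_def] by (simp add: frechet_derivative_const)
  then show ?thesis by (simp add: ell_def)
qed

lemma smooth_fun_zero: "smooth_atlas B \<Longrightarrow> smooth_fun B (\<lambda>_. 0)"
  unfolding smooth_fun_def o_def
  using chart_inv(2)[OF atlas_chart(1)] smooth_on_const by blast

lemma elliptic_operator_zero:
  assumes B: "smooth_atlas B" and L: "elliptic_diffusion_operator B L" and f: "smooth_fun B f"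
    and W: "open W" "p \<in> W" "\<And>q. q \<in> W \<Longrightarrow> f q = 0"
  shows "L f p = 0"
proof -
  obtain U \<phi> where U: "(U, \<phi>) \<in> B" "p \<in> U" using atlas_chart(2)[OF B] by blast
  have "L (\<lambda>_. 0) p = 0"
  proof (rule elliptic_operator_chart[OF L U(1)])
    fix a b assume ab: "\<And>f p. smooth_fun B f \<Longrightarrow> p \<in> U \<Longrightarrow> L f p = ell a b (f \<circ> inv_into U \<phi>) (\<phi> p)"
    show ?thesis using ab[OF smooth_fun_zero[OF B] U(2)] ell_zero[of a b "\<phi> p"] by (simp add: o_def)
  qed
  then show ?thesis using elliptic_operator_local[OF B L f smooth_fun_zero[OF B] W] by simp
qed

lemma smooth_fun_continuous:
  assumes B: "smooth_atlas B" and f: "smooth_fun B f"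
  shows "continuous_on UNIV f"
proof (rule continuous_at_imp_continuous_on, rule ballI)
  fix p
  obtain U \<phi> where U: "(U, \<phi>) \<in> B" "p \<in> U" using atlas_chart(2)[OF B] by blast
  note c = atlas_chart(1)[OF B U(1)]
  have "continuous_on U (\<lambda>p. (f \<circ> inv_into U \<phi>) (\<phi> p))"
    by (rule continuous_on_compose2[OF smooth_on_imp_continuous_on[OF smooth_funD[OF f U(1)]] chart_inv(3)[OF c]]) auto
  then have "continuous_on U f" by (rule continuous_on_eq) (simp add: chart_inv(6)[OF c])
  then show "isCont f p" using chart_inv(1)[OF c] U(2) continuous_on_eq_continuous_at by blast
qed

text \<open>By locality the support of \<open>L f\<close> lies in that of \<open>f\<close>, so both
  extend continuously by 0 to the cemetery.\<close>

lemma diffusion_martingale_solution: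
  fixes B :: "('n::{t2_space,second_countable_topology}, 'e::euclidean_space) chart set"
  assumes B: "smooth_atlas B" and L: "elliptic_diffusion_operator B L" and P: "diffusion_process B L P"
  shows "martingale_solution B L (P x) x"
proof (rule martingale_solution.intro)
  show "prob_space (P x)" "sets (P x) = sets (path_algebra {0..})" "AE \<omega> in P x. \<omega> 0 = Some x"
    using P by (auto simp: diffusion_process_def)
  fix f assume f: "test_fun B f"
  show "martingale (P x) (\<lambda>t. path_algebra {0..t}) (\<lambda>t \<omega>. ext0 f (\<omega> t) - ext0 f (\<omega> 0) - (LBINT r:{0..t}. ext0 (L f) (\<omega> r)))"
    using P f by (simp add: diffusion_process_def)
  have sf: "smooth_fun B f" and K: "compact (closure {x. f x \<noteq> 0})" using f by (auto simp: test_fun_def)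
  show "continuous_map (Alexandroff_compactification euclidean) euclidean (ext0 f)"
    by (rule continuous_map_ext0[OF smooth_fun_continuous[OF B sf] K])
  have "L f q = 0" if "q \<notin> closure {x. f x \<noteq> 0}" for q
    by (rule elliptic_operator_zero[OF B L sf, of "- closure {x. f x \<noteq> 0}"])
      (use that subsetD[OF closure_subset, of _ "{x. f x \<noteq> 0}"] in auto)
  then have "closure {x. L f x \<noteq> 0} \<subseteq> closure {x. f x \<noteq> 0}"
    by (intro closure_minimal) auto
  then have "compact (closure {x. L f x \<noteq> 0})"
    using K compact_Int_closed[OF K closed_closure] by (metis inf.absorb2)
  then show "continuous_map (Alexandroff_compactification euclidean) euclidean (ext0 (L f))"
    by (rule continuous_map_ext0[OF elliptic_operator_continuous[OF B L sf]])
qed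

text \<open>Composing with the flat function turns a function on a chart which is nonpositive near the
  boundary into a test function; by convexity, only a lower bound of the operator is needed, so
  that no derivative of the function has to be controlled.\<close>

lemma flat_test_fun:
  assumes B: "smooth_atlas B" and L: "elliptic_diffusion_operator B L" and U: "(U, \<phi>) \<in> B"
    and D: "open D" "D \<subseteq> \<phi> ` U" and r: "cball y0 r \<subseteq> D"
    and Lab: "\<And>f p. smooth_fun B f \<Longrightarrow> p \<in> U \<Longrightarrow> L f p = ell a b (f \<circ> inv_into U \<phi>) (\<phi> p)"
    and pos: "\<And>y \<xi>. y \<in> D \<Longrightarrow> \<xi> \<noteq> 0 \<Longrightarrow> (\<Sum>i\<in>Basis. \<Sum>j\<in>Basis. a i j y * (\<xi> \<bullet> i) * (\<xi> \<bullet> j)) > 0"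
    and F: "smooth_on D F" "\<And>y. y \<in> D \<Longrightarrow> F y \<le> 1/2" "\<And>y. y \<in> D \<Longrightarrow> y \<notin> cball y0 r \<Longrightarrow> F y \<le> 0"
    and m: "\<And>y. y \<in> cball y0 r \<Longrightarrow> m (inv_into U \<phi> y) \<le> 2 * min 0 (ell a b F y)" "\<And>q. m q \<le> 0"
  defines "G \<equiv> chart_ext U \<phi> D (\<lambda>y. flat 0 (F y))"
  shows "test_fun B G" "\<And>q. m q \<le> L G q"
proof -
  note c = atlas_chart(1)[OF B U]
  have zero: "flat 0 (F y) = 0" if "y \<in> D" "y \<notin> cball y0 r" for y
    using F(3)[OF that] by (rule flat_zero)
  have ext: "test_fun B G" "\<And>y. y \<in> D \<Longrightarrow> G (inv_into U \<phi> y) = flat 0 (F y)"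
    "closed (inv_into U \<phi> ` cball y0 r)" "\<And>q. q \<notin> inv_into U \<phi> ` cball y0 r \<Longrightarrow> G q = 0"
    unfolding G_def
    by (rule chart_ext_test_fun[OF B U D smooth_on_flat[OF D(1) F(1), of 0] compact_cball r]; simp add: zero)+
  show test: "test_fun B G" by (rule ext(1))
  then have sG: "smooth_fun B G" by (simp add: test_fun_def)
  fix q
  show "m q \<le> L G q"
  proof (cases "q \<in> inv_into U \<phi> ` cball y0 r")
    case False
    then have "L G q = 0"
      using ext(3,4) by (intro elliptic_operator_zero[OF B L sG, of "- (inv_into U \<phi> ` cball y0 r)"]) auto
    then show ?thesis using m(2) by simp
  next
    case True
    then obtain y where y: "y \<in> cball y0 r" "q = inv_into U \<phi> y" by blast
    have yD: "y \<in> D" using y r by blast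
    then have qU: "q \<in> U" "\<phi> q = y" using y chart_inv(7,8)[OF c] D(2) by auto
    \<comment> \<open>The factor \<open>flat 2\<close> lies between 0 and 2: a negative value of the
      operator is at most doubled, and a positive one is given away by the minimum.\<close>
    have "2 * min 0 (ell a b F y) \<le> flat 2 (F y) * min 0 (ell a b F y)"
      using flat_2_le[of "F y"] by (intro mult_right_mono_neg) auto
    also have "\<dots> \<le> flat 2 (F y) * ell a b F y"
      using flat_nonneg[of 2 "F y"] by (intro mult_left_mono) auto
    also have "\<dots> \<le> ell a b (\<lambda>z. flat 0 (F z)) y"
      by (rule ell_flat_ge[OF D(1) F(1) yD F(2)[OF yD]], rule pos[OF yD])
    also have "\<dots> = ell a b (G \<circ> inv_into U \<phi>) y"
      by (rule ell_cong_open[OF D(1) yD]) (simp only: ext(2) comp_apply)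
    also have "\<dots> = L G q" using Lab[OF sG qU(1)] qU(2) by simp
    finally show ?thesis using m(1)[OF y(1)] y(2) by simp
  qed
qed

lemma (in normal_cover) pi_open:
  assumes "open S" shows "open (\<pi> ` S)"
proof (subst open_subopen, rule ballI)
  fix p assume "p \<in> \<pi> ` S"
  then obtain x where x: "x \<in> S" "p = \<pi> x" by blast
  obtain W where W: "x \<in> W" "open W" "open (\<pi> ` W)" "inj_on \<pi> W" "continuous_on W \<pi>"
    "continuous_on (\<pi> ` W) (inv_into W \<pi>)" "smooth_map_on A B W \<pi>" "smooth_map_on B A (\<pi> ` W) (inv_into W \<pi>)"
    by (rule local_section)
  let ?T = "\<pi> ` W \<inter> inv_into W \<pi> -` S"
  have "open ?T" by (rule continuous_open_preimage[OF W(6,3) assms])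
  moreover have "p \<in> ?T" using x W(1,4) by auto
  moreover have "?T \<subseteq> \<pi> ` S" using W(4) by auto
  ultimately show "\<exists>T. open T \<and> p \<in> T \<and> T \<subseteq> \<pi> ` S" by blast
qed

text \<open>The countable subfamily is returned as a set of indices, since functions attached to the
  indices have to be selected along with the open sets.\<close>

lemma Lindelof_image:
  fixes O' :: "'i \<Rightarrow> 'a::second_countable_topology set"
  assumes "\<And>i. i \<in> I \<Longrightarrow> open (O' i)"
  shows "\<exists>J\<subseteq>I. countable J \<and> (\<Union>i\<in>J. O' i) = (\<Union>i\<in>I. O' i)"
proof -
  have "\<And>S. S \<in> O' ` I \<Longrightarrow> open S" using assms by blast
  then obtain F where F: "F \<subseteq> O' ` I" "countable F" "\<Union>F = \<Union>(O' ` I)" using Lindelof by metis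
  have "\<exists>J. countable J \<and> J \<subseteq> I \<and> F = O' ` J"
    by (rule countable_subset_image[THEN iffD1, OF conjI[OF F(2,1)]])
  then obtain J where "countable J" "J \<subseteq> I" "F = O' ` J" by (elim exE conjE)
  with F(3) show ?thesis by (intro exI[of _ J]) simp
qed

text \<open>The bound 1/4 matches the penalties, which reach 1/4 at the edge of their ball, so that
  \<open>w\<close> minus a penalty is nonpositive there. It also keeps arguments of
  \<open>flat 0\<close> in the range of convexity.\<close>

locale bounded_harmonic = normal_cover A B \<pi> L\<^sub>0
  for A :: "('m::{t2_space,second_countable_topology}, 'e::euclidean_space) chart set"
    and B :: "('n::{t2_space,second_countable_topology}, 'e) chart set"
    and \<pi> :: "'m \<Rightarrow> 'n"
    and L\<^sub>0 :: "('n \<Rightarrow> real) \<Rightarrow> 'n \<Rightarrow> real" +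
  fixes w :: "'m \<Rightarrow> real"
  assumes w_harm: "harmonic A (pullback_operator B \<pi> L\<^sub>0) w" and w_range: "\<And>x. 0 \<le> w x" "\<And>x. w x \<le> 1/4"
begin

text \<open>\<open>flat 0\<close> is increasing, strictly so on positive numbers, so this still
  detects how close \<open>w\<close> comes to its supremum on a fibre. Flattening inside the
  supremum is what allows approximation from below by flattened cutoffs of \<open>w\<close> on
  single sheets.\<close>

definition fib :: "'n \<Rightarrow> real" where "fib q = (SUP x\<in>\<pi> -` {q}. flat 0 (w x))"

lemma fib_bdd: "bdd_above ((\<lambda>x. flat 0 (w x)) ` S)"
  by (rule bdd_aboveI2[of _ _ 1]) (rule flat_le_1)

lemma fib_ne: "\<pi> -` {q} \<noteq> {}"
  using pi_surj[of q] by auto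

lemma fib_upper: "flat 0 (w x) \<le> fib (\<pi> x)"
  unfolding fib_def by (rule cSUP_upper[OF _ fib_bdd]) simp

lemma fib_least: "(\<And>x. \<pi> x = q \<Longrightarrow> flat 0 (w x) \<le> C) \<Longrightarrow> fib q \<le> C"
  unfolding fib_def by (rule cSUP_least[OF fib_ne]) auto

lemma fib_less: "c < fib q \<longleftrightarrow> (\<exists>x. \<pi> x = q \<and> c < flat 0 (w x))"
  unfolding fib_def less_cSUP_iff[OF fib_ne fib_bdd] by auto

lemma fib01: "0 \<le> fib q" "fib q \<le> 1"
proof -
  obtain x where "\<pi> x = q" using pi_surj by blast
  then show "0 \<le> fib q" using fib_upper[of x] flat_nonneg[of 0 "w x"] by simp
  show "fib q \<le> 1" by (rule fib_least) (rule flat_le_1)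
qed

lemma w_continuous: "continuous_on UNIV w"
  using smooth_fun_continuous[OF A] w_harm by (simp add: harmonic_def)

lemma flat_continuous: "continuous_on UNIV (flat k)"
  by (rule smooth_on_imp_continuous_on[OF flat_smooth])

text \<open>A superlevel set is the image of an open set under \<pi>, which is open.\<close>

lemma fib_lsc: "open {q. c < fib q}"
proof -
  have "{q. c < fib q} = \<pi> ` {x. c < flat 0 (w x)}" by (auto simp: fib_less)
  moreover have "open {x. c < flat 0 (w x)}"
    by (intro open_Collect_less continuous_intros continuous_on_compose2[OF flat_continuous w_continuous]) auto
  ultimately show ?thesis using pi_open by simp
qed

text \<open>The competitors are the flattened functions \<open>v \<gamma> - \<rho>1\<close> on the
  sheets over a chart. Within \<open>R/4\<close> the penalty is zero, so the argument is harmonic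
  and convexity makes the drift nonnegative. Between \<open>R/4\<close> and \<open>R/2\<close> the
  drift is bounded below through \<rho>1 alone, uniformly in \<gamma>; there \<theta> has dropped to
  0, and the full deficit \<open>c0\<close> pays for it.\<close>

lemma ex_submartingale_chart:
  "\<exists>V Q c \<theta> \<G>. p \<in> V \<and> submartingale_chart B L\<^sub>0 fib V Q c \<theta> \<G>"
proof -
  obtain x where x: "\<pi> x = p" using pi_surj by blast
  obtain U \<phi> D R \<sigma> a b where S: "section_chart x U \<phi> D R \<sigma> a b" using ex_section_chart by blast
  note sc = section_chartD[OF S]
  note c = atlas_chart(1)[OF B sc(1)]
  define y0 where "y0 = \<phi> (\<pi> x)"
  have R: "R > 0" and RD: "cball y0 R \<subseteq> D" using sc(5,6) by (auto simp: y0_def)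
  have halfD: "cball y0 (R/2) \<subseteq> D" and qD: "cball y0 (R/4) \<subseteq> D" using R RD by (auto simp: subset_iff)
  \<comment> \<open>Two nested penalties: \<rho>2 has grown to 1/4 at radius \<open>R/4\<close>,
    exactly where \<rho>1 begins to act.\<close>
  define \<rho>1 where "\<rho>1 y = 1/4 * bump (R/4) (R/2) y0 y" for y
  define \<rho>2 where "\<rho>2 y = 1/4 * bump (R/8) (R/4) y0 y" for y
  have r1: "0 < R/4" "R/4 < R/2" and r2: "0 < R/8" "R/8 < R/4" using R by auto
  note b1 = bump[OF r1, where c = y0] and b2 = bump[OF r2, where c = y0]
  have s1: "smooth_on D \<rho>1" and s2: "smooth_on D \<rho>2" unfolding \<rho>1_def[abs_def] \<rho>2_def[abs_def]
    by (intro smooth_on_cmult sc(3) smooth_on_subset[OF b1(1)] smooth_on_subset[OF b2(1)] subset_UNIV)+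
  have \<rho>0: "\<rho>1 y \<ge> 0" "\<rho>2 y \<ge> 0" for y using b1(4) b2(4) by (auto simp: \<rho>1_def \<rho>2_def)
  have \<rho>in: "norm (y - y0) \<le> R/4 \<Longrightarrow> \<rho>1 y = 0" "norm (y - y0) \<le> R/8 \<Longrightarrow> \<rho>2 y = 0" for y
    using b1(2) b2(2) by (auto simp: \<rho>1_def \<rho>2_def)
  have \<rho>out: "norm (y - y0) \<ge> R/2 \<Longrightarrow> \<rho>1 y \<ge> 1/4" "norm (y - y0) \<ge> R/4 \<Longrightarrow> \<rho>2 y \<ge> 1/4" for y
    using b1(3)[of y] b2(3)[of y] by (auto simp: \<rho>1_def \<rho>2_def)
  have ell_cont: "continuous_on D (ell a b F)" if "smooth_on D F" for F
    unfolding ell_def[abs_def]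
    by (intro continuous_intros smooth_on_imp_continuous_on smooth_on_partial that sc(7,8))
  have bdd: "\<exists>M\<ge>0. \<forall>y\<in>cball y0 r. \<bar>ell a b F y\<bar> \<le> M" if "smooth_on D F" "cball y0 r \<subseteq> D" for F r
  proof -
    have "bounded (ell a b F ` cball y0 r)"
      by (intro compact_imp_bounded compact_continuous_image continuous_on_subset[OF ell_cont] that compact_cball)
    then obtain M where "\<forall>y\<in>cball y0 r. \<bar>ell a b F y\<bar> \<le> M" unfolding bounded_iff by auto
    then show ?thesis by (intro exI[of _ "max 0 M"]) auto
  qed
  obtain M1 where M1: "M1 \<ge> 0" "\<And>y. y \<in> cball y0 (R/2) \<Longrightarrow> \<bar>ell a b \<rho>1 y\<bar> \<le> M1" using bdd[OF s1 halfD] by blast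
  obtain M2 where M2: "M2 \<ge> 0" "\<And>y. y \<in> cball y0 (R/4) \<Longrightarrow> \<bar>ell a b \<rho>2 y\<bar> \<le> M2" using bdd[OF s2 qD] by blast
  define \<theta> where "\<theta> = chart_ext U \<phi> D (\<lambda>y. flat 0 (1/4 - \<rho>2 y))"
  define c0 where "c0 = flat 0 (1/4)"
  have c0: "c0 > 0" unfolding c0_def by (rule flat_pos) simp
  \<comment> \<open>The first entry controls the drift of the cutoff \<theta>, the second gives
    \<open>Q * c0 \<ge> 2 * M1\<close> for the competitors; the factors 2 bound the derivative of
    \<open>flat 0\<close>.\<close>
  define Q where "Q = max (2 * M2) (2 * M1 / c0)"
  have Q: "Q \<ge> 2 * M2" "Q * c0 \<ge> 2 * M1" "Q \<ge> 0"
  proof -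
    show "Q \<ge> 2 * M2" "Q \<ge> 0" using M2(1) by (auto simp: Q_def)
    have "2 * M1 / c0 \<le> Q" by (simp add: Q_def)
    then show "Q * c0 \<ge> 2 * M1" using c0 by (simp add: pos_divide_le_eq)
  qed
  have const: "smooth_on D (\<lambda>_. k :: real)" for k by (rule smooth_on_const[OF sc(3)])
  have lin: "ell a b (\<lambda>y. v y - \<rho> y) y = ell a b v y - ell a b \<rho> y" if "smooth_on D v" "smooth_on D \<rho>" "y \<in> D" for v \<rho> y
    using ell_lincomb[OF sc(3) that, of a b 1 "-1" 0] by simp
  have ell_const: "ell a b (\<lambda>_. k) y = 0" if "y \<in> D" for k y
    using ell_lincomb[OF sc(3) const[of 0] const[of 0] that, of a b 0 0 k] by simp
  have \<theta>F: "ell a b (\<lambda>y. 1/4 - \<rho>2 y) y = - ell a b \<rho>2 y" if "y \<in> D" for y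
    using lin[OF const[of "1/4"] s2 that] ell_const[OF that] by simp
  have \<theta>_test: "test_fun B \<theta>" and \<theta>L: "- Q \<le> L\<^sub>0 \<theta> q" for q
  proof -
    have A1: "smooth_on D (\<lambda>y. 1/4 - \<rho>2 y)" by (rule smooth_on_diff[OF sc(3) const s2])
    have A2: "1/4 - \<rho>2 y \<le> 1/2" for y using \<rho>0(2)[of y] by simp
    have A3: "1/4 - \<rho>2 y \<le> 0" if "y \<notin> cball y0 (R/4)" for y
      using that \<rho>out(2)[of y] by (simp add: dist_norm norm_minus_commute)
    have A4: "- Q \<le> 2 * min 0 (ell a b (\<lambda>y. 1/4 - \<rho>2 y) y)" if "y \<in> cball y0 (R/4)" for y
      using M2(2)[OF that] \<theta>F[OF subsetD[OF qD that]] Q(1,3) M2(1) by (auto simp: min_def abs_le_iff)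
    note ft = flat_test_fun[OF B L0 sc(1,3,4) qD, where a = a and b = b and m = "\<lambda>_. - Q"]
    show "test_fun B \<theta>" unfolding \<theta>_def by (rule ft(1)) (use sc(10,11) A1 A2 A3 A4 Q(3) in auto)
    show "- Q \<le> L\<^sub>0 \<theta> q" unfolding \<theta>_def by (rule ft(2)) (use sc(10,11) A1 A2 A3 A4 Q(3) in auto)
  qed
  have \<theta>_le: "\<theta> q \<le> c0" for q
    unfolding \<theta>_def chart_ext_def c0_def using flat_mono[of "1/4 - \<rho>2 (\<phi> q)" "1/4"] \<rho>0(2)[of "\<phi> q"] flat_nonneg[of 0 "1/4"] by auto
  have \<theta>_out: "\<theta> (inv_into U \<phi> y) = 0" if "y \<in> D" "norm (y - y0) \<ge> R/4" for y
    using that \<rho>out(2)[of y] chart_inv(8)[OF c, of y] sc(4) by (auto simp: \<theta>_def chart_ext_def flat_zero)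
  define V where "V = U \<inter> \<phi> -` ball y0 (R/8)"
  have V_open: "open V" unfolding V_def by (rule chart_vimage_open[OF c open_ball])
  have pV: "p \<in> V" using sc(2) x R by (auto simp: V_def y0_def)
  have V_D: "\<phi> q \<in> D" "norm (\<phi> q - y0) \<le> R/8" "q \<in> U" if "q \<in> V" for q
    using that RD R by (auto simp: V_def dist_norm norm_minus_commute subset_iff)
  have \<theta>V: "\<theta> q = c0" if "q \<in> V" for q
    using V_D[OF that] \<rho>in(2)[of "\<phi> q"] by (simp add: \<theta>_def chart_ext_def c0_def)
  define v where "v \<gamma> y = w (\<gamma> (\<sigma> y))" for \<gamma> y
  define g where "g \<gamma> = chart_ext U \<phi> D (\<lambda>y. flat 0 (v \<gamma> y - \<rho>1 y))" for \<gamma>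
  have v_eq: "v \<gamma> = (w \<circ> \<gamma>) \<circ> \<sigma>" for \<gamma> by (auto simp: v_def)
  have v: "smooth_on D (v \<gamma>)" "\<And>y. y \<in> D \<Longrightarrow> ell a b (v \<gamma>) y = 0" if "\<gamma> \<in> \<Gamma>" for \<gamma>
  proof -
    have "L_harmonic (w \<circ> \<gamma>)" by (rule harm_deck[OF w_harm that])
    then have h: "smooth_fun A (w \<circ> \<gamma>)" "\<And>z. L (w \<circ> \<gamma>) z = 0" by (auto simp: harmonic_def)
    show "smooth_on D (v \<gamma>)" unfolding v_eq by (rule sc(15)[OF h(1)])
    show "ell a b (v \<gamma>) y = 0" if "y \<in> D" for y
      unfolding v_eq using sc(16)[OF h(1) that] h(2) by simp
  qed
  have g_test: "test_fun B (g \<gamma>)" and gL: "- Q * (c0 - \<theta> q) \<le> L\<^sub>0 (g \<gamma>) q" if \<gamma>: "\<gamma> \<in> \<Gamma>" for \<gamma> q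
  proof -
    have A1: "smooth_on D (\<lambda>y. v \<gamma> y - \<rho>1 y)" by (rule smooth_on_diff[OF sc(3) v(1)[OF \<gamma>] s1])
    have A2: "v \<gamma> y - \<rho>1 y \<le> 1/2" for y using w_range(2)[of "\<gamma> (\<sigma> y)"] \<rho>0(1)[of y] by (simp add: v_def)
    have A3: "v \<gamma> y - \<rho>1 y \<le> 0" if "y \<notin> cball y0 (R/2)" for y
    proof -
      have "norm (y - y0) \<ge> R/2" using that by (simp add: dist_norm norm_minus_commute)
      from \<rho>out(1)[OF this] w_range(2)[of "\<gamma> (\<sigma> y)"] show ?thesis unfolding v_def by linarith
    qed
    have A4: "- Q * (c0 - \<theta> (inv_into U \<phi> y)) \<le> 2 * min 0 (ell a b (\<lambda>y. v \<gamma> y - \<rho>1 y) y)" if y: "y \<in> cball y0 (R/2)" for y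
    proof (cases "norm (y - y0) < R/4")
      case True
      have yD: "y \<in> D" using y halfD by blast
      have "ell a b \<rho>1 y = ell a b (\<lambda>_. 0) y"
        by (rule ell_cong_open[OF open_ball[of y0 "R/4"]]) (use True \<rho>in(1) in \<open>auto simp: dist_norm norm_minus_commute\<close>)
      then have "ell a b (\<lambda>y. v \<gamma> y - \<rho>1 y) y = 0"
        using lin[OF v(1)[OF \<gamma>] s1 yD] v(2)[OF \<gamma> yD] ell_const[OF yD] by simp
      moreover have "- Q * (c0 - \<theta> (inv_into U \<phi> y)) \<le> 0"
        using Q(3) \<theta>_le[of "inv_into U \<phi> y"] by (simp add: mult_nonneg_nonneg)
      ultimately show ?thesis by simp
    next
      case False
      have yD: "y \<in> D" using y halfD by blast
      have "ell a b (\<lambda>y. v \<gamma> y - \<rho>1 y) y = - ell a b \<rho>1 y"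
        using lin[OF v(1)[OF \<gamma>] s1 yD] v(2)[OF \<gamma> yD] by simp
      moreover have "\<bar>ell a b \<rho>1 y\<bar> \<le> M1" by (rule M1(2)[OF y])
      ultimately have "- (2 * M1) \<le> 2 * min 0 (ell a b (\<lambda>y. v \<gamma> y - \<rho>1 y) y)"
        using M1(1) by (auto simp: min_def abs_le_iff)
      moreover have "\<theta> (inv_into U \<phi> y) = 0" by (rule \<theta>_out[OF yD]) (use False in simp)
      then have "- Q * (c0 - \<theta> (inv_into U \<phi> y)) \<le> - (2 * M1)" using Q(2) by simp
      ultimately show ?thesis by (rule order_trans[rotated])
    qed
    have A5: "- Q * (c0 - \<theta> q) \<le> 0" for q using Q(3) \<theta>_le[of q] by (simp add: mult_nonneg_nonneg)
    note ft = flat_test_fun[OF B L0 sc(1,3,4) halfD, where a = a and b = b and m = "\<lambda>q. - Q * (c0 - \<theta> q)"]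
    show "test_fun B (g \<gamma>)" unfolding g_def by (rule ft(1)) (use sc(10,11) A1 A2 A3 A4 A5 in blast)+
    show "- Q * (c0 - \<theta> q) \<le> L\<^sub>0 (g \<gamma>) q" unfolding g_def by (rule ft(2)) (use sc(10,11) A1 A2 A3 A4 A5 in blast)+
  qed
  have g_le: "g \<gamma> q \<le> fib q" if \<gamma>: "\<gamma> \<in> \<Gamma>" for \<gamma> q
  proof (cases "q \<in> U \<and> \<phi> q \<in> D")
    case True
    then have "\<pi> (\<gamma> (\<sigma> (\<phi> q))) = q" using sc(12)[of "\<phi> q"] deck_pi[OF \<gamma>] chart_inv(6)[OF c] by simp
    moreover have "flat 0 (v \<gamma> (\<phi> q) - \<rho>1 (\<phi> q)) \<le> flat 0 (v \<gamma> (\<phi> q))" using \<rho>0(1) by (intro flat_mono) simp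
    ultimately show ?thesis using True fib_upper[of "\<gamma> (\<sigma> (\<phi> q))"] by (simp add: g_def chart_ext_def v_def)
  next
    case False
    then show ?thesis using fib01(1) by (auto simp: g_def chart_ext_def)
  qed
  have v_cont: "continuous_on D (v \<gamma>)" if "\<gamma> \<in> \<Gamma>" for \<gamma> by (rule smooth_on_imp_continuous_on[OF v(1)[OF that]])
  \<comment> \<open>For each level \<open>s\<close>, countably many \<gamma> already cover the
    region where some \<open>v \<gamma>\<close> exceeds \<open>s\<close>. With rational levels this
    replaces the supremum over the group by a countable one.\<close>
  have "\<exists>J\<subseteq>\<Gamma>. countable J \<and> (\<Union>\<gamma>\<in>J. D \<inter> v \<gamma> -` {s<..}) = (\<Union>\<gamma>\<in>\<Gamma>. D \<inter> v \<gamma> -` {s<..})" for s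
    by (rule Lindelof_image) (rule continuous_open_preimage[OF v_cont sc(3) open_greaterThan])
  then obtain J where J: "\<And>s. J s \<subseteq> \<Gamma>" "\<And>s. countable (J s)"
      "\<And>s. (\<Union>\<gamma>\<in>J s. D \<inter> v \<gamma> -` {s<..}) = (\<Union>\<gamma>\<in>\<Gamma>. D \<inter> v \<gamma> -` {s<..})"
    by metis
  define \<G> where "\<G> = g ` (\<Union>s\<in>\<rat>. J s)"
  have "countable \<G>" unfolding \<G>_def by (intro countable_image countable_UN countable_rat J(2))
  moreover have "\<exists>g'\<in>\<G>. fib q \<le> g' q + \<eta>" if q: "q \<in> V" and \<eta>: "\<eta> > 0" for q \<eta>
  proof -
    define y where "y = \<phi> q"
    have y: "y \<in> D" "\<rho>1 y = 0" "q \<in> U" using V_D[OF q] \<rho>in(1)[of y] R by (auto simp: y_def)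
    obtain x' where x': "\<pi> x' = q" "fib q - \<eta> < flat 0 (w x')" using fib_less[of "fib q - \<eta>" q] \<eta> by auto
    have "\<pi> (\<sigma> y) = \<pi> x'" using sc(12)[OF y(1)] chart_inv(6)[OF c y(3)] x'(1) by (simp add: y_def)
    then obtain \<gamma> where \<gamma>: "\<gamma> \<in> \<Gamma>" "\<gamma> (\<sigma> y) = x'" using deck_transitive by blast
    have "open {s. fib q - \<eta> < flat 0 s}"
      by (intro open_Collect_less continuous_intros flat_continuous)
    moreover have "v \<gamma> y \<in> {s. fib q - \<eta> < flat 0 s}" using x'(2) \<gamma>(2) by (simp add: v_def)
    ultimately obtain e where e: "e > 0" "ball (v \<gamma> y) e \<subseteq> {s. fib q - \<eta> < flat 0 s}" by (rule openE)
    \<comment> \<open>A rational level just below the value attained; by continuity of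
      \<open>flat 0\<close> it still gives \<open>fib q\<close> up to \<eta>.\<close>
    obtain s where s: "s \<in> \<rat>" "v \<gamma> y - e < s" "s < v \<gamma> y" using Rats_dense_in_real[of "v \<gamma> y - e" "v \<gamma> y"] e(1) by auto
    have fs: "fib q - \<eta> < flat 0 s" using e(2) s by (auto simp: dist_real_def subset_iff)
    have "y \<in> (\<Union>\<gamma>\<in>J s. D \<inter> v \<gamma> -` {s<..})" unfolding J(3) using \<gamma>(1) y(1) s(3) by blast
    then obtain \<gamma>' where \<gamma>': "\<gamma>' \<in> J s" "s < v \<gamma>' y" by blast
    have "flat 0 s \<le> flat 0 (v \<gamma>' y)" using \<gamma>'(2) by (intro flat_mono) simp
    moreover have "g \<gamma>' q = flat 0 (v \<gamma>' y)" using y by (simp add: g_def chart_ext_def y_def)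
    ultimately have "fib q \<le> g \<gamma>' q + \<eta>" using fs by linarith
    moreover have "g \<gamma>' \<in> \<G>" unfolding \<G>_def using s(1) \<gamma>'(1) by blast
    ultimately show ?thesis by blast
  qed
  moreover have "test_fun B g' \<and> (\<forall>q. g' q \<le> fib q \<and> - Q * (c0 - \<theta> q) \<le> L\<^sub>0 g' q)" if g': "g' \<in> \<G>" for g'
  proof -
    obtain \<gamma> where "\<gamma> \<in> \<Gamma>" "g' = g \<gamma>" using g' J(1) unfolding \<G>_def by blast
    then show ?thesis using g_test g_le gL by blast
  qed
  ultimately have "submartingale_chart B L\<^sub>0 fib V Q c0 \<theta> \<G>"
    unfolding submartingale_chart_def using V_open \<theta>_test Q(3) c0 \<theta>L \<theta>V by auto
  then show ?thesis using pV by blast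
qed

text \<open>Countably many of the local charts cover the base, and recurrence provides a visit to
  \<open>U\<close> from every starting point.\<close>

lemma fib_recurrent_bound:
  assumes P: "diffusion_process B L\<^sub>0 P" and rec: "recurrent_process P"
    and U: "open U" "U \<noteq> {}" "\<And>q. q \<in> U \<Longrightarrow> fib q \<le> C" "0 \<le> C"
  shows "fib p \<le> C"
proof -
  have "\<forall>p. \<exists>V Q c \<theta> \<G>. p \<in> V \<and> submartingale_chart B L\<^sub>0 fib V Q c \<theta> \<G>" using ex_submartingale_chart by blast
  then obtain V Q c \<theta> \<G> where ch: "\<And>p. p \<in> V p" "\<And>p. submartingale_chart B L\<^sub>0 fib (V p) (Q p) (c p) (\<theta> p) (\<G> p)"
    by metis
  have "\<exists>J\<subseteq>UNIV. countable J \<and> (\<Union>p\<in>J. V p) = (\<Union>p\<in>UNIV. V p)"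
    by (rule Lindelof_image) (use ch(2) in \<open>auto simp: submartingale_chart_def\<close>)
  moreover have "(\<Union>p\<in>UNIV. V p) = UNIV" using ch(1) by blast
  ultimately obtain J where J: "countable J" "(\<Union>p\<in>J. V p) = UNIV" by (elim exE conjE) (simp only:)
  then have Jne: "J \<noteq> {}" by auto
  define e where "e = from_nat_into J"
  have re: "range e = J" unfolding e_def by (rule range_from_nat_into[OF Jne J(1)])
  interpret ms: martingale_solution B L\<^sub>0 "P p" p by (rule diffusion_martingale_solution[OF B L0 P])
  show ?thesis
  proof (rule ms.recurrent_bound[OF fib_lsc fib01 ch(2)])
    show "(\<Union>l. V (e l)) = UNIV" using J(2) re by (metis UN_extend_simps(10))
    have "AE \<omega> in P p. \<forall>T\<ge>0. \<exists>t\<ge>T. \<omega> t \<in> Some ` U" using rec U(1,2) unfolding recurrent_process_def by blast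
    then show "AE \<omega> in P p. \<exists>t\<ge>0. \<omega> t \<in> Some ` U" by eventually_elim blast
  qed (use U in auto)
qed

end

lemma (in normal_cover) fibre_recurrent:
  assumes rec: "recurrent_for B L\<^sub>0"
  shows fibre_recurrent
  unfolding fibre_recurrent_def
proof (intro allI impI, rule ccontr)
  fix u z0 and \<epsilon> :: real
  assume u: "L_harmonic u" "bounded (range u)" and \<epsilon>: "\<epsilon> > 0" and contr: "\<not> (\<exists>\<gamma>\<in>\<Gamma>. \<forall>x. u x \<le> u (\<gamma> z0) + \<epsilon>)"
  obtain P where P: "diffusion_process B L\<^sub>0 P" "recurrent_process P" using rec unfolding recurrent_for_def by blast
  obtain C where C: "\<And>x. \<bar>u x\<bar> \<le> C" using u(2) by (auto simp: bounded_iff)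
  define S where "S = Sup (range u)"
  have bdd: "bdd_above (range u)" using u(2) by (simp add: bounded_imp_bdd_above)
  have uS: "u x \<le> S" for x unfolding S_def by (intro cSup_upper bdd) auto
  \<comment> \<open>The summand 1 keeps \<open>R\<close> positive even when \<open>S + C\<close> is
    0.\<close>
  define R where "R = S + C + 1"
  have R: "R > 0" "S - u x \<le> R" for x
  proof -
    have "- u z \<le> C" for z using C[of z] by (simp add: abs_le_iff)
    from this[of z0] this[of x] show "R > 0" "S - u x \<le> R" using uS[of z0] unfolding R_def by linarith+
  qed
  define v where "v x = (- 1 / R) * u x + S / R" for x
  have v: "v x = (S - u x) / R" for x by (simp add: v_def diff_divide_distrib)
  have v01: "0 \<le> v x" "v x \<le> 1" for x using uS[of x] R(1) R(2)[of x] unfolding v by auto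
  have hv: "L_harmonic v" unfolding v_def[abs_def] by (rule harm_affine[OF u(1)])
  \<comment> \<open>An order-reversing map of [0, 1] onto [1/8, 1/4], where \<open>flat 0\<close> is
    convex and strictly increasing.\<close>
  define w where "w x = (- 1 / 8) * v x + 1/4" for x
  have hw: "L_harmonic w" unfolding w_def[abs_def] by (rule harm_affine[OF hv])
  interpret bh: bounded_harmonic A B \<pi> L\<^sub>0 w
  proof
    show "0 \<le> w x" "w x \<le> 1/4" for x using v01[of x] by (auto simp: w_def)
  qed (rule hw)
  define \<delta> where "\<delta> = \<epsilon> / (2 * R)"
  have \<delta>: "\<delta> > 0" using \<epsilon> R(1) by (simp add: \<delta>_def)
  have far: "v (\<gamma> z0) > \<delta>" if "\<gamma> \<in> \<Gamma>" for \<gamma>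
  proof -
    obtain x where "u x > u (\<gamma> z0) + \<epsilon>" using contr \<open>\<gamma> \<in> \<Gamma>\<close> by (meson not_le)
    then have "\<epsilon> < S - u (\<gamma> z0)" using uS[of x] by linarith
    then have "\<epsilon> / R < v (\<gamma> z0)" unfolding v using R(1) by (intro divide_strict_right_mono)
    moreover have "\<delta> < \<epsilon> / R" using \<epsilon> R(1) by (simp add: \<delta>_def field_simps)
    ultimately show ?thesis by linarith
  qed
  obtain N where N: "open N" "z0 \<in> N" "\<And>\<delta>. \<delta> > 0 \<Longrightarrow> \<exists>\<epsilon>>0. \<forall>v. L_harmonic v \<longrightarrow> (\<forall>z. 0 \<le> v z \<and> v z \<le> 1) \<longrightarrow>
    (\<forall>z\<in>N. \<forall>z'\<in>N. v z \<le> \<epsilon> \<longrightarrow> v z' \<le> \<delta>)"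
    using weak_harnack_local[of z0] by blast
  obtain \<epsilon>1 where \<epsilon>1: "\<epsilon>1 > 0" "\<And>v z. L_harmonic v \<Longrightarrow> (\<forall>z. 0 \<le> v z \<and> v z \<le> 1) \<Longrightarrow> z \<in> N \<Longrightarrow> v z \<le> \<epsilon>1 \<Longrightarrow> v z0 \<le> \<delta>"
    using N(3)[OF \<delta>] N(2) by blast
  \<comment> \<open>Applied to \<open>v \<circ> \<gamma>\<close> at the fixed points
    \<open>z\<close> and \<open>z0\<close>, the Harnack inequality gives the same bound on every
    translate of \<open>N\<close>.\<close>
  have near: "v (\<gamma> z) > \<epsilon>1" if "\<gamma> \<in> \<Gamma>" "z \<in> N" for \<gamma> z
  proof (rule ccontr)
    assume "\<not> ?thesis"
    then have "(v \<circ> \<gamma>) z0 \<le> \<delta>"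
      using v01 that by (intro \<epsilon>1(2)[OF harm_deck[OF hv \<open>\<gamma> \<in> \<Gamma>\<close>], of z]) auto
    then show False using far[OF \<open>\<gamma> \<in> \<Gamma>\<close>] by simp
  qed
  define C' where "C' = flat 0 (1/4 - \<epsilon>1/8)"
  have U: "bh.fib q \<le> C'" if q: "q \<in> \<pi> ` N" for q
  proof (rule bh.fib_least)
    fix x assume "\<pi> x = q"
    then obtain z where "z \<in> N" "\<pi> z = \<pi> x" using q by auto
    then obtain \<gamma> where "\<gamma> \<in> \<Gamma>" "\<gamma> z = x" using deck_transitive by blast
    then have "v x > \<epsilon>1" using near \<open>z \<in> N\<close> by blast
    then show "flat 0 (w x) \<le> C'" unfolding C'_def w_def by (intro flat_mono) simp
  qed
  have bound: "bh.fib p \<le> C'" for p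
    by (rule bh.fib_recurrent_bound[OF P pi_open[OF N(1)] _ U]) (use N(2) flat_nonneg in \<open>auto simp: C'_def\<close>)
  \<comment> \<open>Being below \<open>\<epsilon>1\<close> contradicts the bound \<open>C'\<close>;
    being below 1 makes the argument of \<open>flat 0\<close> visibly positive, as strict
    monotonicity requires.\<close>
  define \<mu> where "\<mu> = min (\<epsilon>1 / 2) (1 / 2)"
  have \<mu>: "\<mu> > 0" "\<mu> < \<epsilon>1" "\<mu> < 1" using \<epsilon>1(1) by (auto simp: \<mu>_def min_def)
  have "S - R * \<mu> < S" using R(1) \<mu>(1) by simp
  then obtain x where x: "S - R * \<mu> < u x"
    unfolding S_def using less_cSup_iff[of "range u"] bdd by blast
  then have "S - u x < \<mu> * R" by (simp add: mult.commute)
  then have "v x < \<mu>" unfolding v using R(1) by (simp only: pos_divide_less_eq)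
  then have "v x < \<epsilon>1" "v x < 1" using \<mu>(2,3) by linarith+
  then have "C' < flat 0 (w x)" unfolding C'_def w_def by (intro flat_less) simp_all
  then show False using bh.fib_upper[of x] bound[of "\<pi> x"] by linarith
qed

theorem theoremF:
  fixes A :: "('m::{t2_space,second_countable_topology}, 'e::euclidean_space) chart set"
    and B :: "('n::{t2_space,second_countable_topology}, 'e) chart set"
    and \<pi> :: "'m \<Rightarrow> 'n"
    and L\<^sub>0 :: "('n \<Rightarrow> real) \<Rightarrow> 'n \<Rightarrow> real"
    and m :: "'n measure"
  assumes "smooth_atlas A" and "connected (UNIV :: 'm set)"
    and "smooth_atlas B" and "connected (UNIV :: 'n set)"
    and "normal_covering A B \<pi>"
    and "elliptic_diffusion_operator B L\<^sub>0"
    and "smooth_volume B m" and "symmetric_operator B L\<^sub>0 m"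
    and "recurrent_for B L\<^sub>0"
  shows "(\<forall>h. harmonic A (pullback_operator B \<pi> L\<^sub>0) h \<and> bounded (range h) \<longrightarrow>
            (\<forall>\<gamma>\<in>FC_hypercenter (deck_group \<pi>). h \<circ> \<gamma> = h)) \<and>
         (FC_hypercentral (deck_group \<pi>) \<longrightarrow>
            (\<forall>h. harmonic A (pullback_operator B \<pi> L\<^sub>0) h \<and> bounded (range h) \<longrightarrow>
               h constant_on UNIV))"
proof -
  interpret normal_cover A B \<pi> L\<^sub>0
    by unfold_locales (use assms in auto)
  note rec = fibre_recurrent[OF assms(9)]
  show ?thesis
    using invariance[OF assms(2) rec] liouville[OF assms(2) rec] by blast
qed

end
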